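(* Let $P(\lambda)=\sum_{i=0}^k A_i\lambda^i$ be a regular $m\times m$ complex matrix polynomial, with $A_i\in M_m(\mathbb C)$ and $A_0,A_k\neq 0$. Then the following hold. (i) All the separable bisolvents $(S_1,S_2)$ of $P$ can be constructed from a maximal (controllable) standard pair $([X,Y],T\oplus Z)$ of $P$ by restriction to an $m$-dimensional $T\oplus Z$-invariant subspace. Namely, $$S_1\lambda-S_2=[\tilde X,\tilde Y]\,\bigl[(I\lambda-\tilde T)\oplus(I-\lambda\tilde Z)\bigr]\,[\tilde X,\tilde Y]^{-1},$$ where $([\tilde X,\tilde Y],\tilde T\oplus\tilde Z)$ is the restriction of $([X,Y],T\oplus Z)$ to the subspace. (ii) In particular, the Kronecker–Weierstrass spectrum of the pencil $S_1\lambda-S_2$ is subordinate to that of the pencil $(I\lambda-T)\oplus(I-Z\lambda)$. (iii) A pencil $\lambda A+B$ with $A,B\in M_m(\mathbb C)$ is a regular right factor of $P$ if and only if $(S_1,S_2)=(GA,GB)$ is a separable bisolvent of $P$ for some $G\in GL_m(\mathbb C)$. In other words, separable bisolvents describe all the regular first order right factors of $P$ up to left equivalence (left multiplication by a constant invertible matrix).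
   Context: $M_{r,s}(\mathbb C)$ is the set of complex $r\times s$ matrices, $M_m(\mathbb C)=M_{m,m}(\mathbb C)$, and $GL_m(\mathbb C)$ is the set of invertible elements of $M_m(\mathbb C)$. The symbol $\oplus$ between matrices denotes the block diagonal sum. A square matrix polynomial is regular if its determinant is not identically zero. A pencil is a matrix polynomial of the form $\lambda A+B$. Bisolvents. A bisolvent of $P$ is a pair $(S_1,S_2)$ of commuting $m\times m$ complex matrices with $\sum_{i=0}^k A_iS_1^iS_2^{k-i}=0$. It is separable if there is an idempotent $\Pi\in M_m(\mathbb C)$ with $$S_1=\Pi S_1\Pi+(I-\Pi),\qquad S_2=\Pi+(I-\Pi)S_2(I-\Pi).$$ Standard pairs. A standard pair of $P$ is a pair $([X,Y],T\oplus Z)$ with $X\in M_{m,p}(\mathbb C)$, $T\in M_p(\mathbb C)$, $Y\in M_{m,q}(\mathbb C)$, $Z\in M_q(\mathbb C)$ such that $$\sum_{i=0}^kA_iXT^i=0,\qquad \sum_{i=0}^kA_iYZ^{k-i}=0,$$ and such that the $mk\times(p+q)$ matrix whose $j$-th block row ($j=0,\dots,k-1$) is $[\,XT^{j},\ YZ^{k-1-j}\,]$ has rank $p+q$ (controllability). It is maximal if $p+q=mk$. Restriction. Let $V_1\subseteq\mathbb C^p$ be $T$-invariant and $V_2\subseteq\mathbb C^q$ be $Z$-invariant, with $\dim V_1+\dim V_2=m$, so that $V_1\oplus V_2$ is an $m$-dimensional $T\oplus Z$-invariant subspace. Choose matrices $B_1,B_2$ whose columns are bases of $V_1,V_2$.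 The restriction of $([X,Y],T\oplus Z)$ to $V_1\oplus V_2$ is $([\tilde X,\tilde Y],\tilde T\oplus\tilde Z)$, where $\tilde X=XB_1$, $\tilde Y=YB_2$, $TB_1=B_1\tilde T$ and $ZB_2=B_2\tilde Z$; here the $m\times m$ matrix $[\tilde X,\tilde Y]$ is required to be invertible. Spectrum. A regular pencil is strictly equivalent (by left and right multiplication by constant invertible matrices) to a Weierstrass form $(\lambda I-J)\oplus(\lambda N-I)$ with $J,N$ in Jordan form and $N$ nilpotent. Its Kronecker–Weierstrass spectrum consists of the finite eigenvalues (those of $J$) and the eigenvalue $\infty$ (present if $N$ has positive size), with partial multiplicities given by the Jordan block sizes. "Subordinate" means that at each eigenvalue the partial multiplicities of the first pencil are dominated by those of the second (listed in decreasing order, padded with zeros). Right factors. A pencil $R(\lambda)$ is a regular (first order) right factor of $P$ if $R$ is regular and $P(\lambda)=Q(\lambda)R(\lambda)$ for some $m\times m$ matrix polynomial $Q(\lambda)$.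
   Formalization: The pencil is λS₂−S₁, and λA+B matches (−GB,GA); in (i) the identity is up to left equivalence for pairs whose two parts share no eigenvalue, and exact (with λZ̃−I) for spectrally separated bisolvents; in (iii) Q has degree below k, or A is invertible. *)

theory Defs
  imports
    "Jordan_Normal_Form.Jordan_Normal_Form_Existence"
    "Jordan_Normal_Form.DL_Rank"
    "HOL-Library.More_List"
begin

definition const_mat :: "complex mat \<Rightarrow> complex poly mat" where
  "const_mat A = map_mat (\<lambda>a. [:a:]) A"

text \<open>The pencil \<open>\<lambda> A + B\<close>, as a matrix over the polynomial ring.\<close>

definition pencil :: "complex mat \<Rightarrow> complex mat \<Rightarrow> complex poly mat" where
  "pencil A B = [:0, 1:] \<cdot>\<^sub>m const_mat A + const_mat B"

definition matrix_poly :: "nat \<Rightarrow> nat \<Rightarrow> (nat \<Rightarrow> complex mat) \<Rightarrow> complex poly mat" where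
  "matrix_poly m k A = mat m m (\<lambda>rc. \<Sum>i\<le>k. monom (A i $$ rc) i)"

definition regular :: "complex poly mat \<Rightarrow> bool" where
  "regular R \<longleftrightarrow> square_mat R \<and> det R \<noteq> 0"

definition hcat :: "'a :: zero mat \<Rightarrow> 'a mat \<Rightarrow> 'a mat" where
  "hcat X Y = four_block_mat X Y (0\<^sub>m 0 (dim_col X)) (0\<^sub>m 0 (dim_col Y))"

definition block_sum :: "'a :: zero mat \<Rightarrow> 'a mat \<Rightarrow> 'a mat"  (infixr \<open>\<oplus>\<^sub>m\<close> 65) where
  "A \<oplus>\<^sub>m B =
     four_block_mat A (0\<^sub>m (dim_row A) (dim_col B)) (0\<^sub>m (dim_row B) (dim_col A)) B"

text \<open>Matrices of varying size do not form an additive monoid type, hence the entrywise sum.\<close>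

definition mat_sum :: "nat \<Rightarrow> nat \<Rightarrow> (nat \<Rightarrow> complex mat) \<Rightarrow> nat set \<Rightarrow> complex mat" where
  "mat_sum r c F I = mat r c (\<lambda>ij. \<Sum>i\<in>I. F i $$ ij)"

subsection \<open>Bisolvents\<close>

definition bisolvent ::
  "nat \<Rightarrow> nat \<Rightarrow> (nat \<Rightarrow> complex mat) \<Rightarrow> complex mat \<Rightarrow> complex mat \<Rightarrow> bool" where
  "bisolvent m k A S1 S2 \<longleftrightarrow>
     S1 \<in> carrier_mat m m \<and> S2 \<in> carrier_mat m m \<and> S1 * S2 = S2 * S1 \<and>
     mat_sum m m (\<lambda>i. A i * (S1 ^\<^sub>m i) * (S2 ^\<^sub>m (k - i))) {..k} = 0\<^sub>m m m"

definition separated_by ::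
  "nat \<Rightarrow> complex mat \<Rightarrow> complex mat \<Rightarrow> complex mat \<Rightarrow> bool" where
  "separated_by m E S1 S2 \<longleftrightarrow>
     E \<in> carrier_mat m m \<and> E * E = E \<and>
     S1 = E * S1 * E + (1\<^sub>m m - E) \<and>
     S2 = E + (1\<^sub>m m - E) * S2 * (1\<^sub>m m - E)"

definition separable_bisolvent ::
  "nat \<Rightarrow> nat \<Rightarrow> (nat \<Rightarrow> complex mat) \<Rightarrow> complex mat \<Rightarrow> complex mat \<Rightarrow> bool" where
  "separable_bisolvent m k A S1 S2 \<longleftrightarrow>
     bisolvent m k A S1 S2 \<and> (\<exists>E. separated_by m E S1 S2)"

text \<open>
  If \<open>E\<close> separates \<open>(S1, S2)\<close>, then \<open>\<lambda> S2 - S1\<close> acts as \<open>\<lambda> I - S1\<close> on the range of \<open>E\<close>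
  and as \<open>\<lambda> S2 - I\<close> on its kernel. The next predicate says that these two parts have no
  common (necessarily finite and nonzero) eigenvalue.
\<close>

definition spectrally_separated_by ::
  "complex mat \<Rightarrow> complex mat \<Rightarrow> complex mat \<Rightarrow> bool" where
  "spectrally_separated_by E S1 S2 \<longleftrightarrow>
     \<not> (\<exists>t z x y. t * z = 1 \<and>
          eigenvector S1 x t \<and> E *\<^sub>v x = x \<and>
          eigenvector S2 y z \<and> E *\<^sub>v y = 0\<^sub>v (dim_row E))"

subsection \<open>Standard pairs and restrictions\<close>

definition controllability_mat ::
  "nat \<Rightarrow> nat \<Rightarrow> complex mat \<Rightarrow> complex mat \<Rightarrow> complex mat \<Rightarrow> complex mat \<Rightarrow> complex mat" where
  "controllability_mat m k X Y T Z =
     mat (m * k) (dim_col X + dim_col Y)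
       (\<lambda>(r, c). hcat (X * (T ^\<^sub>m (r div m))) (Y * (Z ^\<^sub>m (k - 1 - r div m))) $$ (r mod m, c))"

definition standard_pair ::
  "nat \<Rightarrow> nat \<Rightarrow> (nat \<Rightarrow> complex mat) \<Rightarrow> nat \<Rightarrow> nat \<Rightarrow>
    complex mat \<Rightarrow> complex mat \<Rightarrow> complex mat \<Rightarrow> complex mat \<Rightarrow> bool" where
  "standard_pair m k A p q X Y T Z \<longleftrightarrow>
     X \<in> carrier_mat m p \<and> T \<in> carrier_mat p p \<and>
     Y \<in> carrier_mat m q \<and> Z \<in> carrier_mat q q \<and>
     mat_sum m p (\<lambda>i. A i * X * (T ^\<^sub>m i)) {..k} = 0\<^sub>m m p \<and>
     mat_sum m q (\<lambda>i. A i * Y * (Z ^\<^sub>m (k - i))) {..k} = 0\<^sub>m m q \<and>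
     vec_space.rank (m * k) (controllability_mat m k X Y T Z) = p + q"

definition maximal_standard_pair ::
  "nat \<Rightarrow> nat \<Rightarrow> (nat \<Rightarrow> complex mat) \<Rightarrow> nat \<Rightarrow> nat \<Rightarrow>
    complex mat \<Rightarrow> complex mat \<Rightarrow> complex mat \<Rightarrow> complex mat \<Rightarrow> bool" where
  "maximal_standard_pair m k A p q X Y T Z \<longleftrightarrow>
     standard_pair m k A p q X Y T Z \<and> p + q = m * k"

text \<open>\<open>\<lambda> I - T\<close> and \<open>I - \<lambda> Z\<close> have no common eigenvalue.\<close>

definition spectrally_disjoint :: "complex mat \<Rightarrow> complex mat \<Rightarrow> bool" where
  "spectrally_disjoint T Z \<longleftrightarrow> \<not> (\<exists>t z. t * z = 1 \<and> eigenvalue T t \<and> eigenvalue Z z)"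

definition invariant_subspace :: "complex mat \<Rightarrow> complex vec set \<Rightarrow> bool" where
  "invariant_subspace T V \<longleftrightarrow>
     VectorSpace.subspace class_ring V (module_vec TYPE(complex) (dim_row T)) \<and>
     (\<forall>v\<in>V. T *\<^sub>v v \<in> V)"

definition basis_mat :: "nat \<Rightarrow> complex vec set \<Rightarrow> complex mat \<Rightarrow> bool" where
  "basis_mat n V B \<longleftrightarrow>
     dim_row B = n \<and> distinct (cols B) \<and>
     module.lin_indpt class_ring (module_vec TYPE(complex) n) (set (cols B)) \<and>
     LinearCombinations.module.span class_ring (module_vec TYPE(complex) n) (set (cols B)) = V"

definition restriction ::
  "nat \<Rightarrow> complex mat \<Rightarrow> complex mat \<Rightarrow> complex mat \<Rightarrow> complex mat \<Rightarrow>
    complex vec set \<Rightarrow> complex vec set \<Rightarrow>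
    complex mat \<Rightarrow> complex mat \<Rightarrow> complex mat \<Rightarrow> complex mat \<Rightarrow> bool" where
  "restriction m X Y T Z V1 V2 X' Y' T' Z' \<longleftrightarrow>
     invariant_subspace T V1 \<and> invariant_subspace Z V2 \<and>
     (\<exists>B1 B2. basis_mat (dim_row T) V1 B1 \<and> basis_mat (dim_row Z) V2 B2 \<and>
        dim_col B1 + dim_col B2 = m \<and>
        X' = X * B1 \<and> Y' = Y * B2 \<and>
        T' \<in> carrier_mat (dim_col B1) (dim_col B1) \<and> T * B1 = B1 * T' \<and>
        Z' \<in> carrier_mat (dim_col B2) (dim_col B2) \<and> Z * B2 = B2 * Z') \<and>
     invertible_mat (hcat X' Y')"

subsection \<open>Spectrum\<close>

definition strictly_equivalent :: "complex poly mat \<Rightarrow> complex poly mat \<Rightarrow> bool" where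
  "strictly_equivalent R R' \<longleftrightarrow>
     (\<exists>n E F. R \<in> carrier_mat n n \<and> E \<in> carrier_mat n n \<and> F \<in> carrier_mat n n \<and>
        invertible_mat E \<and> invertible_mat F \<and> const_mat E * R * const_mat F = R')"

text \<open>
  The lists \<open>js\<close> and \<open>ns\<close> hold the Jordan blocks of \<open>J\<close> (size and eigenvalue) and the sizes of
  the Jordan blocks of the nilpotent \<open>N\<close>; they are determined up to order by the pencil.
\<close>

definition weierstrass_form ::
  "complex poly mat \<Rightarrow> (nat \<times> complex) list \<Rightarrow> nat list \<Rightarrow> bool" where
  "weierstrass_form R js ns \<longleftrightarrow>
     0 \<notin> fst ` set js \<and> 0 \<notin> set ns \<and>
     (let J = jordan_matrix js; N = jordan_matrix (map (\<lambda>s. (s, 0)) ns) in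
        strictly_equivalent R
          (pencil (1\<^sub>m (dim_row J)) (- J) \<oplus>\<^sub>m pencil N (- 1\<^sub>m (dim_row N))))"

text \<open>Partial multiplicities in decreasing order; \<open>None\<close> stands for the eigenvalue \<open>\<infinity>\<close>, and
  points that are not eigenvalues get the empty list.\<close>

fun partial_mults ::
  "(nat \<times> complex) list \<Rightarrow> nat list \<Rightarrow> complex option \<Rightarrow> nat list" where
  "partial_mults js ns None = rev (sort ns)"
| "partial_mults js ns (Some a) = rev (sort (map fst (filter (\<lambda>b. snd b = a) js)))"

definition subordinate :: "complex poly mat \<Rightarrow> complex poly mat \<Rightarrow> bool" where
  "subordinate R R' \<longleftrightarrow>
     (\<exists>js ns js' ns'. weierstrass_form R js ns \<and> weierstrass_form R' js' ns' \<and>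
        (\<forall>e i. nth_default 0 (partial_mults js ns e) i
             \<le> nth_default 0 (partial_mults js' ns' e) i))"

subsection \<open>Right factors\<close>

definition regular_right_factor ::
  "nat \<Rightarrow> complex poly mat \<Rightarrow> complex poly mat \<Rightarrow> bool" where
  "regular_right_factor m P R \<longleftrightarrow>
     R \<in> carrier_mat m m \<and> regular R \<and> (\<exists>Q \<in> carrier_mat m m. P = Q * R)"

text \<open>
  The graded version regards \<open>P\<close> as having grade \<open>k\<close> and the pencil as having grade 1 (its
  leading coefficient may be singular, so that \<open>\<infinity>\<close> is an eigenvalue). The cofactor then has
  grade \<open>k - 1\<close>: its coefficients of index at least \<open>k\<close> vanish. For a pencil with invertible
  leading coefficient and \<open>P\<close> of grade \<open>k\<close> this holds automatically. In general it does not: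
  a constant invertible \<open>R\<close> satisfies the ungraded definition for every \<open>P\<close>.
\<close>

definition graded_regular_right_factor ::
  "nat \<Rightarrow> nat \<Rightarrow> complex poly mat \<Rightarrow> complex poly mat \<Rightarrow> bool" where
  "graded_regular_right_factor m k P R \<longleftrightarrow>
     R \<in> carrier_mat m m \<and> regular R \<and>
     (\<exists>Q \<in> carrier_mat m m. P = Q * R \<and>
        (\<forall>r<m. \<forall>c<m. \<forall>l\<ge>k. coeff (Q $$ (r, c)) l = 0))"

end

(* In coordinates adapted to its idempotent, a separable bisolvent is a pair ([X,Y], T + Z) with
   p + q = m and [X,Y] invertible that is annihilated by P, and it makes \<lambda> S2 - S1 equivalent to
   (\<lambda> I - T) + (\<lambda> Z - I). Splitting the companion pencil of P in the same way, with prescribed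
   finite eigenvalues in T, produces a maximal standard pair. The controllability matrices of two
   such pairs intertwine the pencils through the companion pencil; when the spectra are disjoint,
   uniqueness for the Stein equation b = T b Z makes the intertwiner block diagonal, and its blocks
   are bases of the invariant subspaces. Without disjointness the intertwiner is still left
   invertible, so it maps Jordan chains to Jordan chains, which gives subordination. Finally
   P = Q R amounts to a recurrence for the coefficients of Q; in split coordinates it unrolls to the
   two null equations for (X, T) and (Y, Z). *)
theory Submission
  imports Defs
begin

text \<open>On the range of the idempotent S2 is the identity and on its kernel S1 is, which is why
  A_i S1^i S2^(k-i) separates into A_i X T^i and A_i Y Z^(k-i), and why the pencil to look at is
  \<lambda> S2 - S1. The obstacle is that a pencil does not determine its splitting: a finite
  nonzero eigenvalue t may be carried by T, or as 1/t by Z. A given bisolvent and a given maximal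
  pair may distribute their common eigenvalues differently, and then the intertwiner mixes the two
  blocks. The lemma \<open>pencil_split\<close> therefore leaves the set \<Lambda> of finite
  eigenvalues that go to T as a parameter. If the pair is given, the pencil of the bisolvent is
  split again along the pair, at the price of a left factor G. If the idempotent has to be kept, the
  pair is chosen to fit it and no G appears, which works because its two parts are spectrally
  separated. For subordination both pencils are split with \<Lambda> = UNIV, the Weierstrass choice,
  which makes the second blocks nilpotent. The set \<Lambda> always contains 0, since t = 0 has no
  reciprocal that Z could carry.\<close>

lemma mult_mat_assoc:
  fixes A B C :: "'a :: semiring_0 mat"
  assumes "dim_col A = dim_row B" "dim_col B = dim_row C"
  shows "A * B * C = A * (B * C)"
  using assms by (intro assoc_mult_mat) auto

section \<open>Two-sided inverses of a fixed size\<close>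

definition inverse_mats :: "nat \<Rightarrow> 'a :: semiring_1 mat \<Rightarrow> 'a mat \<Rightarrow> bool" where
  "inverse_mats n U V \<longleftrightarrow>
     U \<in> carrier_mat n n \<and> V \<in> carrier_mat n n \<and> U * V = 1\<^sub>m n \<and> V * U = 1\<^sub>m n"

lemma inverse_matsD:
  assumes "inverse_mats n U V"
  shows "U \<in> carrier_mat n n" "V \<in> carrier_mat n n" "U * V = 1\<^sub>m n" "V * U = 1\<^sub>m n"
    "dim_row U = n" "dim_col U = n" "dim_row V = n" "dim_col V = n"
  using assms unfolding inverse_mats_def by auto

lemma inverse_mats_sym: "inverse_mats n U V \<Longrightarrow> inverse_mats n V U"
  unfolding inverse_mats_def by auto

lemma inverse_mats_cancel:
  assumes "inverse_mats n U V" "dim_row X = n"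
  shows "U * (V * X) = X" "V * (U * X) = X"
  using assms unfolding inverse_mats_def
  by (auto simp: mult_mat_assoc[symmetric] simp del: assoc_mult_mat)

lemma inverse_mats_cancel_right:
  assumes "inverse_mats n U V" "dim_col X = n"
  shows "X * U * V = X" "X * V * U = X"
  using assms unfolding inverse_mats_def by (auto simp: mult_mat_assoc simp del: assoc_mult_mat)

lemma inverse_mats_mult:
  assumes "inverse_mats n U V" "inverse_mats n U' V'"
  shows "inverse_mats n (U * U') (V' * V)"
  using assms inverse_matsD[OF assms(1)] inverse_matsD[OF assms(2)]
  unfolding inverse_mats_def
  by (auto simp: mult_mat_assoc inverse_mats_cancel[OF assms(1)] inverse_mats_cancel[OF assms(2)]
      simp del: assoc_mult_mat)

lemma inverse_mats_one: "inverse_mats n (1\<^sub>m n) (1\<^sub>m n)"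
  unfolding inverse_mats_def by auto

lemma inverse_mats_left:
  fixes U V :: "'a :: field mat"
  assumes "U \<in> carrier_mat n n" "V \<in> carrier_mat n n" "V * U = 1\<^sub>m n"
  shows "inverse_mats n U V"
  using assms mat_mult_left_right_inverse[of V n U] unfolding inverse_mats_def by auto

lemma inverse_mats_imp_det:
  fixes U V :: "'a :: field mat"
  assumes "inverse_mats n U V"
  shows "det U \<noteq> 0"
  using det_mult[of U n V] inverse_matsD[OF assms] by auto

lemma det_imp_inverse_mats:
  fixes U :: "'a :: field mat"
  assumes U: "U \<in> carrier_mat n n" and "det U \<noteq> 0"
  obtains V where "inverse_mats n U V"
proof -
  from det_non_zero_imp_unit[OF assms, of undefined]
  obtain V where "V \<in> carrier_mat n n" "V * U = 1\<^sub>m n"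
    unfolding Units_def ring_mat_def by auto
  from that[OF inverse_mats_left[OF U this]] show ?thesis .
qed

lemma injective_imp_inverse_mats:
  fixes U :: "'a :: field mat"
  assumes "U \<in> carrier_mat n n"
    and "\<And>v. v \<in> carrier_vec n \<Longrightarrow> U *\<^sub>v v = 0\<^sub>v n \<Longrightarrow> v = 0\<^sub>v n"
  obtains V where "inverse_mats n U V"
  using assms det_0_iff_vec_prod_zero_field[OF assms(1)] det_imp_inverse_mats by metis

lemma inverse_mats_imp_invertible: "inverse_mats n U V \<Longrightarrow> invertible_mat U"
  unfolding inverse_mats_def invertible_mat_def inverts_mat_def square_mat.simps
  by (auto intro!: exI[of _ V])

lemma invertible_imp_inverse_mats:
  assumes "invertible_mat U" "U \<in> carrier_mat n n"
  obtains V where "inverse_mats n U V"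
proof -
  from assms obtain V where V: "U * V = 1\<^sub>m n" "V * U = 1\<^sub>m (dim_row V)"
    unfolding invertible_mat_def inverts_mat_def by auto
  have "dim_col V = n" using arg_cong[OF V(1), of dim_col] by simp
  moreover have "dim_row V = n" using arg_cong[OF V(2), of dim_col] assms by simp
  ultimately have "inverse_mats n U V" using V assms unfolding inverse_mats_def by auto
  from that[OF this] show ?thesis .
qed

subsection \<open>Block matrices\<close>

lemma dim_block_sum [simp]:
  "dim_row (A \<oplus>\<^sub>m B) = dim_row A + dim_row B" "dim_col (A \<oplus>\<^sub>m B) = dim_col A + dim_col B"
  unfolding block_sum_def by auto

lemma block_sum_carrier [simp]:
  "A \<in> carrier_mat a b \<Longrightarrow> B \<in> carrier_mat c d \<Longrightarrow> A \<oplus>\<^sub>m B \<in> carrier_mat (a + c) (b + d)"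
  unfolding carrier_mat_def by auto

lemma index_block_sum:
  "i < dim_row A + dim_row B \<Longrightarrow> j < dim_col A + dim_col B \<Longrightarrow>
   (A \<oplus>\<^sub>m B) $$ (i, j) =
     (if i < dim_row A then if j < dim_col A then A $$ (i, j) else 0
      else if j < dim_col A then 0 else B $$ (i - dim_row A, j - dim_col A))"
  unfolding block_sum_def by auto

lemma dim_hcat [simp]: "dim_row (hcat X Y) = dim_row X" "dim_col (hcat X Y) = dim_col X + dim_col Y"
  unfolding hcat_def by auto

lemma hcat_carrier [simp]:
  "X \<in> carrier_mat m p \<Longrightarrow> Y \<in> carrier_mat m q \<Longrightarrow> hcat X Y \<in> carrier_mat m (p + q)"
  unfolding carrier_mat_def by auto

lemma index_hcat:
  "i < dim_row X \<Longrightarrow> j < dim_col X + dim_col Y \<Longrightarrow>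
   hcat X Y $$ (i, j) = (if j < dim_col X then X $$ (i, j) else Y $$ (i, j - dim_col X))"
  unfolding hcat_def by auto

lemma four_block_mult:
  fixes A B C D :: "'a :: semiring_0 mat"
  assumes d: "dim_row B = dim_row A" "dim_row C = dim_row D" "dim_col C = dim_col A" "dim_col B = dim_col D"
    and d': "dim_row A' = dim_col A" "dim_row B' = dim_col A" "dim_row C' = dim_col D" "dim_row D' = dim_col D"
    "dim_col C' = dim_col A'" "dim_col B' = dim_col D'"
  shows "four_block_mat A B C D * four_block_mat A' B' C' D' =
    four_block_mat (A * A' + B * C') (A * B' + B * D') (C * A' + D * C') (C * B' + D * D')"
proof -
  have "A \<in> carrier_mat (dim_row A) (dim_col A)" "B \<in> carrier_mat (dim_row A) (dim_col D)"
    "C \<in> carrier_mat (dim_row D) (dim_col A)" "D \<in> carrier_mat (dim_row D) (dim_col D)"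
    "A' \<in> carrier_mat (dim_col A) (dim_col A')" "B' \<in> carrier_mat (dim_col A) (dim_col D')"
    "C' \<in> carrier_mat (dim_col D) (dim_col A')" "D' \<in> carrier_mat (dim_col D) (dim_col D')"
    by (rule carrier_matI; simp add: d d')+
  from mult_four_block_mat[OF this] show ?thesis .
qed

lemma block_sum_mult:
  fixes A B C D :: "'a :: semiring_0 mat"
  assumes "dim_row C = dim_col A" "dim_row D = dim_col B"
  shows "(A \<oplus>\<^sub>m B) * (C \<oplus>\<^sub>m D) = (A * C) \<oplus>\<^sub>m (B * D)"
proof -
  have "A * C + 0\<^sub>m (dim_row A) (dim_col C) = A * C" "0\<^sub>m (dim_row B) (dim_col D) + B * D = B * D"
    by auto
  then show ?thesis
    unfolding block_sum_def using assms by (subst four_block_mult) auto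
qed

lemma hcat_block_sum:
  fixes X Y A B :: "'a :: semiring_0 mat"
  assumes "dim_row Y = dim_row X" "dim_row A = dim_col X" "dim_row B = dim_col Y"
  shows "hcat X Y * (A \<oplus>\<^sub>m B) = hcat (X * A) (Y * B)"
proof -
  have "X * A + Y * 0\<^sub>m (dim_row B) (dim_col A) = X * A" "X * 0\<^sub>m (dim_row A) (dim_col B) + Y * B = Y * B"
    using assms by auto
  moreover have "0\<^sub>m 0 (dim_col X) * A + 0\<^sub>m 0 (dim_col Y) * 0\<^sub>m (dim_row B) (dim_col A) = 0\<^sub>m 0 (dim_col A)"
    "0\<^sub>m 0 (dim_col X) * 0\<^sub>m (dim_row A) (dim_col B) + 0\<^sub>m 0 (dim_col Y) * B = 0\<^sub>m 0 (dim_col B)"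
    by (rule eq_matI, auto)+
  ultimately show ?thesis
    unfolding block_sum_def hcat_def using assms
    by (subst four_block_mult) auto
qed

lemma mult_hcat:
  fixes M X Y :: "'a :: semiring_0 mat"
  assumes "dim_row Y = dim_row X" "dim_col M = dim_row X"
  shows "M * hcat X Y = hcat (M * X) (M * Y)"
proof (rule eq_matI)
  fix i j assume "i < dim_row (hcat (M * X) (M * Y))" "j < dim_col (hcat (M * X) (M * Y))"
  then show "(M * hcat X Y) $$ (i, j) = hcat (M * X) (M * Y) $$ (i, j)"
    using assms by (auto simp: scalar_prod_def index_hcat intro!: sum.cong)
qed auto

lemma hcat_eqD:
  assumes eq: "hcat X Y = hcat X' Y'"
    and d: "dim_col X = dim_col X'" "dim_row Y = dim_row X" "dim_row Y' = dim_row X'"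
  shows "X = X'" "Y = Y'"
proof -
  have d': "dim_row X = dim_row X'" "dim_col Y = dim_col Y'"
    using arg_cong[OF eq, of dim_row] arg_cong[OF eq, of dim_col] d by simp_all
  have e: "hcat X Y $$ (i, j) = hcat X' Y' $$ (i, j)" for i j using eq by simp
  show "X = X'"
  proof (rule eq_matI)
    fix i j assume "i < dim_row X'" "j < dim_col X'"
    with e[of i j] show "X $$ (i, j) = X' $$ (i, j)" by (simp add: index_hcat d d')
  qed (simp_all add: d d')
  show "Y = Y'"
  proof (rule eq_matI)
    fix i j assume "i < dim_row Y'" "j < dim_col Y'"
    with e[of i "dim_col X + j"] show "Y $$ (i, j) = Y' $$ (i, j)"
      by (simp add: index_hcat d d')
  qed (simp_all add: d d')
qed

lemma hcat_split:
  assumes "M \<in> carrier_mat n (p + q)"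
  obtains X Y where "M = hcat X Y" "X \<in> carrier_mat n p" "Y \<in> carrier_mat n q"
proof (rule that)
  let ?X = "mat n p (\<lambda>ij. M $$ ij)" and ?Y = "mat n q (\<lambda>(i, j). M $$ (i, p + j))"
  show "M = hcat ?X ?Y" using assms by (intro eq_matI) (auto simp: index_hcat)
qed simp_all

lemma four_block_split:
  assumes "M \<in> carrier_mat (p + q) (p' + q')"
  obtains A B C D where "M = four_block_mat A B C D" "A \<in> carrier_mat p p'" "B \<in> carrier_mat p q'"
    "C \<in> carrier_mat q p'" "D \<in> carrier_mat q q'"
proof (rule that)
  let ?A = "mat p p' (\<lambda>ij. M $$ ij)" and ?B = "mat p q' (\<lambda>(i, j). M $$ (i, p' + j))"
    and ?C = "mat q p' (\<lambda>(i, j). M $$ (p + i, j))" and ?D = "mat q q' (\<lambda>(i, j). M $$ (p + i, p' + j))"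
  show "M = four_block_mat ?A ?B ?C ?D" using assms by (intro eq_matI) auto
qed auto

lemma four_block_eqD:
  assumes eq: "four_block_mat A B C D = four_block_mat A' B' C' D'"
    and c: "A \<in> carrier_mat p p'" "B \<in> carrier_mat p q'" "C \<in> carrier_mat q p'" "D \<in> carrier_mat q q'"
    and c': "A' \<in> carrier_mat p p'" "B' \<in> carrier_mat p q'" "C' \<in> carrier_mat q p'" "D' \<in> carrier_mat q q'"
  shows "A = A'" "B = B'" "C = C'" "D = D'"
proof -
  note d = c[THEN carrier_matD(1)] c[THEN carrier_matD(2)]
  note d' = c'[THEN carrier_matD(1)] c'[THEN carrier_matD(2)]
  have e: "four_block_mat A B C D $$ (i, j) = four_block_mat A' B' C' D' $$ (i, j)" for i j
    using eq by simp
  show "A = A'"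
  proof (rule eq_matI)
    fix i j assume "i < dim_row A'" "j < dim_col A'"
    with e[of "i" "j"] show "A $$ (i, j) = A' $$ (i, j)" by (simp add: d d')
  qed (simp_all add: d d')
  show "B = B'"
  proof (rule eq_matI)
    fix i j assume "i < dim_row B'" "j < dim_col B'"
    with e[of "i" "p' + j"] show "B $$ (i, j) = B' $$ (i, j)" by (simp add: d d')
  qed (simp_all add: d d')
  show "C = C'"
  proof (rule eq_matI)
    fix i j assume "i < dim_row C'" "j < dim_col C'"
    with e[of "p + i" "j"] show "C $$ (i, j) = C' $$ (i, j)" by (simp add: d d')
  qed (simp_all add: d d')
  show "D = D'"
  proof (rule eq_matI)
    fix i j assume "i < dim_row D'" "j < dim_col D'"
    with e[of "p + i" "p' + j"] show "D $$ (i, j) = D' $$ (i, j)" by (simp add: d d')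
  qed (simp_all add: d d')
qed

lemma block_sum_eqD:
  assumes eq: "A \<oplus>\<^sub>m B = A' \<oplus>\<^sub>m B'" and d: "dim_row A = dim_row A'" "dim_col A = dim_col A'"
  shows "A = A'" "B = B'"
proof -
  have d': "dim_row B = dim_row B'" "dim_col B = dim_col B'"
    using arg_cong[OF eq, of dim_row] arg_cong[OF eq, of dim_col] d by simp_all
  have c: "A \<in> carrier_mat (dim_row A') (dim_col A')" "B \<in> carrier_mat (dim_row B') (dim_col B')"
    "A' \<in> carrier_mat (dim_row A') (dim_col A')" "B' \<in> carrier_mat (dim_row B') (dim_col B')"
    by (rule carrier_matI; simp add: d d')+
  from four_block_eqD[OF eq[unfolded block_sum_def d d'] c(1) _ _ c(2) c(3) _ _ c(4)]
  show "A = A'" "B = B'" by simp_all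
qed

lemma block_sum_one: "1\<^sub>m p \<oplus>\<^sub>m 1\<^sub>m q = 1\<^sub>m (p + q)"
  unfolding block_sum_def by simp

lemma inverse_mats_block_sum:
  assumes "inverse_mats p A A'" "inverse_mats q B B'"
  shows "inverse_mats (p + q) (A \<oplus>\<^sub>m B) (A' \<oplus>\<^sub>m B')"
  using inverse_matsD[OF assms(1)] inverse_matsD[OF assms(2)]
  unfolding inverse_mats_def by (auto simp: block_sum_mult block_sum_one)

lemma uminus_block_sum: "- (A \<oplus>\<^sub>m B) = (- A) \<oplus>\<^sub>m (- B :: 'a :: group_add mat)"
  by (rule eq_matI) (auto simp: index_block_sum)

lemma block_sum_pow:
  fixes A B :: "'a :: semiring_1 mat"
  assumes "A \<in> carrier_mat p p" "B \<in> carrier_mat q q"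
  shows "(A \<oplus>\<^sub>m B) ^\<^sub>m k = (A ^\<^sub>m k) \<oplus>\<^sub>m (B ^\<^sub>m k)"
  using pow_four_block_mat[OF assms, of k] assms unfolding block_sum_def by simp

lemma eigenvectorI:
  "A \<in> carrier_mat n n \<Longrightarrow> v \<in> carrier_vec n \<Longrightarrow> v \<noteq> 0\<^sub>v n \<Longrightarrow> A *\<^sub>v v = e \<cdot>\<^sub>v v \<Longrightarrow> eigenvector A v e"
  unfolding eigenvector_def by auto

lemma eigenvectorD:
  "eigenvector A v e \<Longrightarrow> A \<in> carrier_mat n n \<Longrightarrow> v \<in> carrier_vec n \<and> v \<noteq> 0\<^sub>v n \<and> A *\<^sub>v v = e \<cdot>\<^sub>v v"
  unfolding eigenvector_def by auto

lemma eigenvalueI: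
  "A \<in> carrier_mat n n \<Longrightarrow> v \<in> carrier_vec n \<Longrightarrow> v \<noteq> 0\<^sub>v n \<Longrightarrow> A *\<^sub>v v = e \<cdot>\<^sub>v v \<Longrightarrow> eigenvalue A e"
  unfolding eigenvalue_def using eigenvectorI by blast

lemma eigenvalueE:
  assumes "eigenvalue A e" "A \<in> carrier_mat n n"
  obtains v where "v \<in> carrier_vec n" "v \<noteq> 0\<^sub>v n" "A *\<^sub>v v = e \<cdot>\<^sub>v v"
  using assms eigenvectorD unfolding eigenvalue_def by metis

subsection \<open>Spectral splitting of regular pencils\<close>

text \<open>Schur triangularisation of Z reduces the matrix equation to its columns. With c = b * P
  for the triangularising P, the equation becomes c = T * c * B with B upper triangular; if the
  columns before j vanish, column j satisfies c_j = B_jj T c_j. A nonzero solution would make 1 /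
  B_jj an eigenvalue of T, while B_jj is one of Z.\<close>

lemma stein_unique:
  fixes T Z b :: "complex mat"
  assumes T: "T \<in> carrier_mat p p" and Z: "Z \<in> carrier_mat q q" and b: "b \<in> carrier_mat p q"
    and eq: "b = T * b * Z" and disj: "spectrally_disjoint T Z"
  shows "b = 0\<^sub>m p q"
proof -
  obtain es where cp: "char_poly Z = (\<Prod>a\<leftarrow>es. [:- a, 1:])"
    using char_poly_factorized[OF Z] by auto
  obtain B where B: "B \<in> carrier_mat q q" "upper_triangular B" "similar_mat Z B"
    using schur_decomposition_exists[OF Z cp] by auto
  then obtain P Q where wit: "similar_mat_wit Z B P Q" unfolding similar_mat_def by auto
  note w = similar_mat_witD2[OF Z wit]
  define c where "c = b * P"
  have c: "c \<in> carrier_mat p q" unfolding c_def using b w(6) by auto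
  have "c = T * (c * B)"
  proof -
    have "c = T * b * Z * P" unfolding c_def by (subst eq) simp
    also have "\<dots> = T * (b * (P * (B * (Q * P))))"
      unfolding w(3) using T b w(5-7) by (simp add: mult_mat_assoc)
    also have "\<dots> = T * (c * B)"
      unfolding c_def w(2) using T b w(5-7) by (simp add: mult_mat_assoc)
    finally show ?thesis .
  qed
  have ev: "eigenvalue Z (B $$ (j, j))" if "j < q" for j
  proof -
    have "B $$ (j, j) \<in> set (diag_mat B)" using that B unfolding diag_mat_def by auto
    then have "poly (char_poly B) (B $$ (j, j)) = 0"
      unfolding char_poly_upper_triangular[OF B(1,2)] by (auto simp: poly_prod_list prod_list_zero_iff)
    then show ?thesis
      using char_poly_similar[OF B(3)] eigenvalue_root_char_poly[OF Z] by simp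
  qed
  have zero: "col c j = 0\<^sub>v p" if "j < q" for j
    using that
  proof (induction j rule: less_induct)
    case (less j)
    have cB: "col (c * B) j = B $$ (j, j) \<cdot>\<^sub>v col c j"
    proof (rule eq_vecI)
      fix i assume i: "i < dim_vec (B $$ (j, j) \<cdot>\<^sub>v col c j)"
      then have ip: "i < p" using c by simp
      have "col (c * B) j $ i = (\<Sum>l<q. c $$ (i, l) * B $$ (l, j))"
        using ip less.prems c B(1) by (simp add: scalar_prod_def atLeast0LessThan)
      also have "\<dots> = (\<Sum>l<q. if l = j then c $$ (i, j) * B $$ (j, j) else 0)"
      proof (rule sum.cong[OF refl])
        fix l assume l: "l \<in> {..<q}"
        consider "l = j" | "l < j" | "j < l" by linarith
        then show "c $$ (i, l) * B $$ (l, j) = (if l = j then c $$ (i, j) * B $$ (j, j) else 0)"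
        proof cases
          case 2
          have "c $$ (i, l) = col c l $ i" using l ip c by simp
          also have "\<dots> = 0" using less.IH[OF 2] l ip by simp
          finally show ?thesis using 2 by simp
        next
          case 3
          then have "B $$ (l, j) = 0" using upper_triangularD[OF B(2), of j l] l B(1) by auto
          then show ?thesis using 3 by simp
        qed simp
      qed
      also have "\<dots> = c $$ (i, j) * B $$ (j, j)" using less.prems by (simp add: sum.delta)
      finally show "col (c * B) j $ i = (B $$ (j, j) \<cdot>\<^sub>v col c j) $ i"
        using ip less.prems c by simp
    qed (use c B in simp)
    have "col c j = col (T * (c * B)) j" using \<open>c = T * (c * B)\<close> by simp
    also have "\<dots> = T *\<^sub>v col (c * B) j" using T c B less.prems by (intro col_mult2) auto
    also have "\<dots> = B $$ (j, j) \<cdot>\<^sub>v (T *\<^sub>v col c j)"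
      unfolding cB using T c by (intro mult_mat_vec) auto
    finally have *: "col c j = B $$ (j, j) \<cdot>\<^sub>v (T *\<^sub>v col c j)" .
    show ?case
    proof (rule ccontr)
      assume nz: "col c j \<noteq> 0\<^sub>v p"
      have car: "col c j \<in> carrier_vec p" using c less.prems by auto
      have Bnz: "B $$ (j, j) \<noteq> 0"
      proof
        assume "B $$ (j, j) = 0"
        with * have "col c j = 0 \<cdot>\<^sub>v (T *\<^sub>v col c j)" by simp
        also have "\<dots> = 0\<^sub>v p" using T by (intro eq_vecI) auto
        finally have "col c j = 0\<^sub>v p" .
        with nz show False ..
      qed
      have "(1 / B $$ (j, j)) \<cdot>\<^sub>v col c j = T *\<^sub>v col c j"
        using Bnz by (subst *) (simp add: smult_smult_assoc)
      then have "eigenvalue T (1 / B $$ (j, j))"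
        using eigenvalueI[OF T car nz] by simp
      with ev[OF less.prems] Bnz disj show False
        unfolding spectrally_disjoint_def by (metis divide_self_if times_divide_eq_left mult_1)
    qed
  qed
  have "c = 0\<^sub>m p q"
  proof (rule eq_matI)
    fix i j assume "i < dim_row (0\<^sub>m p q)" "j < dim_col (0\<^sub>m p q :: complex mat)"
    then have ij: "i < p" "j < q" by auto
    have "c $$ (i, j) = col c j $ i" using ij c by simp
    then show "c $$ (i, j) = 0\<^sub>m p q $$ (i, j)" using zero[OF ij(2)] ij by simp
  qed (use c in auto)
  moreover have "b = c * Q"
    unfolding c_def using b w by (simp add: mult_mat_assoc)
  ultimately show ?thesis using w by simp
qed

section \<open>Similarity splitting along a set of eigenvalues\<close>

lemma jordan_form:
  fixes T :: "complex mat"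
  assumes T: "T \<in> carrier_mat n n"
  obtains js P Q where "0 \<notin> fst ` set js" "sum_list (map fst js) = n"
    "inverse_mats n P Q" "T * P = P * jordan_matrix js"
proof -
  obtain es where "char_poly T = (\<Prod>a\<leftarrow>es. [:- a, 1:])"
    using char_poly_factorized[OF T] by auto
  from jordan_nf_exists[OF T this] obtain js P Q
    where js: "0 \<notin> fst ` set js" "similar_mat_wit T (jordan_matrix js) P Q"
    unfolding jordan_nf_def similar_mat_def by auto
  note w = similar_mat_witD2[OF T js(2)]
  show ?thesis
  proof (rule that[OF js(1)])
    show "sum_list (map fst js) = n" using w(5) by (metis carrier_matD(1) jordan_matrix_dim(1))
    show "inverse_mats n P Q" using w unfolding inverse_mats_def by auto
    show "T * P = P * jordan_matrix js" unfolding w(3) using w(2) carrier_matD[OF w(5)] carrier_matD[OF w(6)] carrier_matD[OF w(7)]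
      by (simp add: mult_mat_assoc)
  qed
qed

lemma block_sum_assoc: "A \<oplus>\<^sub>m (B \<oplus>\<^sub>m C) = (A \<oplus>\<^sub>m B) \<oplus>\<^sub>m C"
  using assoc_four_block_mat[of A B C] unfolding block_sum_def .

lemma jordan_matrix_Cons_block_sum:
  "jordan_matrix ((s, a) # js) = jordan_block s a \<oplus>\<^sub>m jordan_matrix js"
  unfolding jordan_matrix_Cons block_sum_def by simp

lemma eigenvalue_jordan_matrix:
  fixes js :: "(nat \<times> complex) list"
  assumes "eigenvalue (jordan_matrix js) e"
  shows "e \<in> snd ` set js"
proof -
  have "poly (\<Prod>(s, a)\<leftarrow>js. [:- a, 1:] ^ s) e = 0"
    using assms eigenvalue_root_char_poly[OF jordan_matrix_carrier] jordan_matrix_char_poly by metis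
  then show ?thesis by (induction js) auto
qed

lemma block_sum_swap:
  fixes A B :: "'a :: semiring_1 mat"
  assumes "A \<in> carrier_mat p p" "B \<in> carrier_mat q q"
  obtains X X' where "inverse_mats (p + q) X X'" "(A \<oplus>\<^sub>m B) * X = X * (B \<oplus>\<^sub>m A)"
proof -
  let ?X = "four_block_mat (0\<^sub>m p q) (1\<^sub>m p) (1\<^sub>m q) (0\<^sub>m q p) :: 'a mat"
  let ?X' = "four_block_mat (0\<^sub>m q p) (1\<^sub>m q) (1\<^sub>m p) (0\<^sub>m p q) :: 'a mat"
  have dims: "?X \<in> carrier_mat (p + q) (p + q)" "?X' \<in> carrier_mat (p + q) (p + q)"
    by (rule carrier_matI; simp)+
  have "?X * ?X' = 1\<^sub>m (p + q)" "?X' * ?X = 1\<^sub>m (p + q)"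
    by (simp_all add: four_block_mult add.commute[of q p])
  then have "inverse_mats (p + q) ?X ?X'" unfolding inverse_mats_def using dims by auto
  moreover have "(A \<oplus>\<^sub>m B) * ?X = ?X * (B \<oplus>\<^sub>m A)"
    unfolding block_sum_def using assms by (simp add: four_block_mult)
  ultimately show ?thesis using that by blast
qed

text \<open>A permutation of the Jordan blocks is a similarity. By induction the tail is already
  sorted; a new block with \<open>S a\<close> joins the first group in front, any other one is moved
  behind that group by \<open>block_sum_swap\<close>.\<close>

lemma jordan_matrix_partition:
  fixes js :: "(nat \<times> complex) list"
  shows "\<exists>W W'. inverse_mats (sum_list (map fst js)) W W' \<and>
    jordan_matrix js * W = W * (jordan_matrix (filter (\<lambda>b. S (snd b)) js) \<oplus>\<^sub>m
      jordan_matrix (filter (\<lambda>b. \<not> S (snd b)) js))"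
proof (induction js)
  case Nil
  have "jordan_matrix [] = (1\<^sub>m 0 :: complex mat)" by (rule eq_matI) auto
  then show ?case using inverse_mats_one[of 0] by (auto simp: block_sum_one intro!: exI)
next
  case (Cons sa js)
  obtain s a where sa: "sa = (s, a)" by force
  let ?n = "sum_list (map fst js)"
  let ?J1 = "jordan_matrix (filter (\<lambda>b. S (snd b)) js)"
  let ?J2 = "jordan_matrix (filter (\<lambda>b. \<not> S (snd b)) js)"
  let ?b = "jordan_block s a"
  from Cons obtain W W' where W: "inverse_mats ?n W W'"
    and JW: "jordan_matrix js * W = W * (?J1 \<oplus>\<^sub>m ?J2)" by blast
  have n: "sum_list (map fst (filter (\<lambda>b. S (snd b)) js)) +
      sum_list (map fst (filter (\<lambda>b. \<not> S (snd b)) js)) = ?n"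
    by (induction js) auto
  let ?W = "1\<^sub>m s \<oplus>\<^sub>m W"
  have iW: "inverse_mats (s + ?n) ?W (1\<^sub>m s \<oplus>\<^sub>m W')"
    by (rule inverse_mats_block_sum[OF inverse_mats_one W])
  note dW = inverse_matsD[OF W]
  have JW': "jordan_matrix (sa # js) * ?W = ?W * (?b \<oplus>\<^sub>m (?J1 \<oplus>\<^sub>m ?J2))"
    unfolding sa jordan_matrix_Cons_block_sum
    using dW n by (simp add: block_sum_mult JW)
  show ?case
  proof (cases "S a")
    case True
    then show ?thesis
      using iW JW' unfolding block_sum_assoc
      by (auto simp: sa jordan_matrix_Cons_block_sum[symmetric])
  next
    case False
    obtain X X' where X: "inverse_mats (s + dim_row ?J1) X X'"
        and bX: "(?b \<oplus>\<^sub>m ?J1) * X = X * (?J1 \<oplus>\<^sub>m ?b)"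
      using block_sum_swap[of ?b s ?J1 "dim_row ?J1"] by auto
    note dX = inverse_matsD[OF X]
    let ?X = "X \<oplus>\<^sub>m 1\<^sub>m (dim_row ?J2)"
    have iX: "inverse_mats (s + dim_row ?J1 + dim_row ?J2) ?X (X' \<oplus>\<^sub>m 1\<^sub>m (dim_row ?J2))"
      by (rule inverse_mats_block_sum[OF X inverse_mats_one])
    have eq: "s + dim_row ?J1 + dim_row ?J2 = s + ?n" using n by simp
    have "jordan_matrix (sa # js) * (?W * ?X) = jordan_matrix (sa # js) * ?W * ?X"
      using dX dW n by (intro mult_mat_assoc[symmetric]) (auto simp: sa)
    also have "\<dots> = ?W * ((?b \<oplus>\<^sub>m ?J1) \<oplus>\<^sub>m ?J2) * ?X" unfolding JW' block_sum_assoc ..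
    also have "\<dots> = ?W * (((?b \<oplus>\<^sub>m ?J1) \<oplus>\<^sub>m ?J2) * ?X)"
      using dX dW n by (intro mult_mat_assoc) (auto simp: sa)
    also have "((?b \<oplus>\<^sub>m ?J1) \<oplus>\<^sub>m ?J2) * ?X = ?X * (?J1 \<oplus>\<^sub>m (?b \<oplus>\<^sub>m ?J2))"
      using dX unfolding block_sum_assoc by (simp add: block_sum_mult bX)
    also have "?W * \<dots> = ?W * ?X * (?J1 \<oplus>\<^sub>m (?b \<oplus>\<^sub>m ?J2))"
      using dX dW n by (intro mult_mat_assoc[symmetric]) auto
    finally show ?thesis
      using inverse_mats_mult[OF iW iX[unfolded eq]] False
      by (auto simp: sa jordan_matrix_Cons_block_sum[symmetric])
  qed
qed

text \<open>Sorting the Jordan blocks stands in for spectral projections. The predicate is left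
  arbitrary because it is instantiated in two ways: by membership in a prescribed set of pencil
  eigenvalues, and by equality with 1 for an idempotent.\<close>

lemma spectral_split:
  fixes M :: "complex mat"
  assumes M: "M \<in> carrier_mat n n"
  obtains p q M1 M2 W W' where "p + q = n" "M1 \<in> carrier_mat p p" "M2 \<in> carrier_mat q q"
    "inverse_mats n W W'" "M * W = W * (M1 \<oplus>\<^sub>m M2)"
    "\<And>e. eigenvalue M1 e \<Longrightarrow> S e" "\<And>e. eigenvalue M2 e \<Longrightarrow> \<not> S e"
proof -
  obtain js P Q where js: "sum_list (map fst js) = n"
    and P: "inverse_mats n P Q" and MP: "M * P = P * jordan_matrix js"
    using jordan_form[OF M] by metis
  let ?J1 = "jordan_matrix (filter (\<lambda>b. S (snd b)) js)"
  let ?J2 = "jordan_matrix (filter (\<lambda>b. \<not> S (snd b)) js)"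
  obtain W W' where W: "inverse_mats n W W'" and JW: "jordan_matrix js * W = W * (?J1 \<oplus>\<^sub>m ?J2)"
    using jordan_matrix_partition[of js S] js by auto
  have n: "dim_row ?J1 + dim_row ?J2 = n" unfolding js[symmetric] by (induction js) auto
  note dP = inverse_matsD[OF P] and dW = inverse_matsD[OF W]
  have "M * (P * W) = M * P * W" using M dP dW by (simp add: mult_mat_assoc)
  also have "\<dots> = P * (jordan_matrix js * W)"
    unfolding MP using js dP dW by (simp add: mult_mat_assoc)
  also have "\<dots> = P * W * (?J1 \<oplus>\<^sub>m ?J2)" unfolding JW using dP dW n by (simp add: mult_mat_assoc)
  finally show ?thesis
    by (intro that[OF n _ _ inverse_mats_mult[OF P W]])
      (auto dest: eigenvalue_jordan_matrix)
qed

section \<open>Splitting a regular pencil into a T part and a Z part\<close>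

lemma spectrally_disjoint_sym: "spectrally_disjoint T Z \<Longrightarrow> spectrally_disjoint Z T"
  unfolding spectrally_disjoint_def by (auto simp: mult.commute)

lemma smult_zero_vec: "v \<in> carrier_vec n \<Longrightarrow> (0 :: complex) \<cdot>\<^sub>v v = 0\<^sub>v n"
  by (rule eq_vecI) auto

lemma no_eigenvalue_0_inverse:
  fixes A :: "complex mat"
  assumes A: "A \<in> carrier_mat n n" and "\<not> eigenvalue A 0"
  obtains A' where "inverse_mats n A A'"
proof (rule injective_imp_inverse_mats[OF A])
  fix v assume "v \<in> carrier_vec n" "A *\<^sub>v v = 0\<^sub>v n"
  then show "v = 0\<^sub>v n"
    using eigenvalueI[OF A, of v 0] assms(2) smult_zero_vec[of v n] by metis
qed

lemma one_minus_smult_mult_vec: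
  fixes A :: "complex mat"
  assumes "A \<in> carrier_mat n n" "v \<in> carrier_vec n"
  shows "(1\<^sub>m n - c \<cdot>\<^sub>m A) *\<^sub>v v = v - c \<cdot>\<^sub>v (A *\<^sub>v v)"
  using assms by (subst minus_mult_distrib_mat_vec) (auto intro!: eq_vecI)

lemma inverse_mats_cancel_vec:
  assumes "inverse_mats n U V" "v \<in> carrier_vec n"
  shows "U *\<^sub>v (V *\<^sub>v v) = v"
  using assms inverse_matsD[OF assms(1)] by (metis assoc_mult_mat_vec one_mult_mat_vec)

text \<open>Relative to \<open>K * W\<close> and \<open>W\<close>, C acts as M1 and M2 and K acts as
  the identity, so D = K - \<alpha> C acts as I - \<alpha> M1 and I - \<alpha> M2.\<close>

lemma pencil_split_eq:
  fixes K W :: "complex mat"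
  assumes K: "K \<in> carrier_mat n n" and W: "W \<in> carrier_mat n n" and pq: "p + q = n"
    and M1: "M1 \<in> carrier_mat p p" and M2: "M2 \<in> carrier_mat q q"
    and D: "D = K - \<alpha> \<cdot>\<^sub>m C" and C: "C \<in> carrier_mat n n" and CW: "C * W = K * W * (M1 \<oplus>\<^sub>m M2)"
  shows "D * W = K * W * ((1\<^sub>m p - \<alpha> \<cdot>\<^sub>m M1) \<oplus>\<^sub>m (1\<^sub>m q - \<alpha> \<cdot>\<^sub>m M2))"
proof -
  let ?B = "M1 \<oplus>\<^sub>m M2"
  have B: "?B \<in> carrier_mat n n" using pq M1 M2 by auto
  have KW: "K * W \<in> carrier_mat n n" using K W by simp
  have "D * W = K * W - \<alpha> \<cdot>\<^sub>m (C * W)"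
    unfolding D using K C W by (subst minus_mult_distrib_mat) auto
  also have "\<dots> = K * W * 1\<^sub>m n - K * W * (\<alpha> \<cdot>\<^sub>m ?B)"
    unfolding CW mult_smult_distrib[OF KW B] right_mult_one_mat[OF KW] ..
  also have "\<dots> = K * W * (1\<^sub>m n - \<alpha> \<cdot>\<^sub>m ?B)"
    using KW B by (intro mult_minus_distrib_mat[symmetric]) auto
  also have "1\<^sub>m n - \<alpha> \<cdot>\<^sub>m ?B = (1\<^sub>m p - \<alpha> \<cdot>\<^sub>m M1) \<oplus>\<^sub>m (1\<^sub>m q - \<alpha> \<cdot>\<^sub>m M2)"
    using M1 M2 pq by (intro eq_matI) (auto simp: index_block_sum)
  finally show ?thesis .
qed

text \<open>With \<open>K = \<alpha> C + D\<close>, an eigenvalue \<open>e\<close> of \<open>K\<^sup>-\<^sup>1 C\<close> corresponds to the eigenvalue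
  \<open>\<alpha> - 1 / e\<close> of the pencil (to \<open>\<infinity>\<close> if \<open>e = 0\<close>). Those in \<open>\<Lambda>\<close> are assigned to \<open>T\<close>.\<close>

lemma pencil_split:
  fixes C D :: "complex mat"
  assumes C: "C \<in> carrier_mat n n" and D: "D \<in> carrier_mat n n"
    and reg: "det (\<alpha> \<cdot>\<^sub>m C + D) \<noteq> 0" and \<Lambda>: "0 \<in> \<Lambda>"
  obtains p q T Z U U' W W' where "p + q = n" "T \<in> carrier_mat p p" "Z \<in> carrier_mat q q"
    "inverse_mats n U U'" "inverse_mats n W W'"
    "C * W = U * (1\<^sub>m p \<oplus>\<^sub>m Z)" "D * W = - (U * (T \<oplus>\<^sub>m 1\<^sub>m q))"
    "\<And>t. eigenvalue T t \<Longrightarrow> t \<in> \<Lambda>" "\<And>z t. eigenvalue Z z \<Longrightarrow> t \<in> \<Lambda> \<Longrightarrow> t * z \<noteq> 1"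
proof -
  let ?K = "\<alpha> \<cdot>\<^sub>m C + D"
  have Kc: "?K \<in> carrier_mat n n" using C D by auto
  obtain K' where K: "inverse_mats n ?K K'" using det_imp_inverse_mats[OF Kc reg] .
  note dK = inverse_matsD[OF K]
  have Mc: "K' * C \<in> carrier_mat n n" using dK C by auto
  obtain p q M1 M2 W W' where pq: "p + q = n" and M1: "M1 \<in> carrier_mat p p"
    and M2: "M2 \<in> carrier_mat q q" and W: "inverse_mats n W W'"
    and MW: "K' * C * W = W * (M1 \<oplus>\<^sub>m M2)"
    and S1: "\<And>e. eigenvalue M1 e \<Longrightarrow> e \<noteq> 0 \<and> \<alpha> - 1 / e \<in> \<Lambda>"
    and S2: "\<And>e. eigenvalue M2 e \<Longrightarrow> \<not> (e \<noteq> 0 \<and> \<alpha> - 1 / e \<in> \<Lambda>)"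
    using spectral_split[OF Mc, of "\<lambda>e. e \<noteq> 0 \<and> \<alpha> - 1 / e \<in> \<Lambda>"] by metis
  note dW = inverse_matsD[OF W]
  obtain M1' where M1': "inverse_mats p M1 M1'"
    using no_eigenvalue_0_inverse[OF M1] S1 by blast
  note dM1 = inverse_matsD[OF M1']
  let ?N = "1\<^sub>m q - \<alpha> \<cdot>\<^sub>m M2"
  have Nc: "?N \<in> carrier_mat q q" using M2 by (intro minus_carrier_mat) auto
  \<comment> \<open>Here 0 \<in> \<Lambda> is used: a nonzero kernel vector gives M2 the eigenvalue
    1 / \<alpha>, which corresponds to the pencil eigenvalue \<alpha> - \<alpha> = 0 and so has been
    assigned to M1.\<close>
  obtain N' where N': "inverse_mats q ?N N'"
  proof (rule injective_imp_inverse_mats[OF Nc])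
    fix v :: "complex vec" assume v: "v \<in> carrier_vec q" "?N *\<^sub>v v = 0\<^sub>v q"
    then have eq: "v - \<alpha> \<cdot>\<^sub>v (M2 *\<^sub>v v) = 0\<^sub>v q" using one_minus_smult_mult_vec[OF M2 v(1)] by metis
    have vi: "v $ i = \<alpha> * (M2 *\<^sub>v v) $ i" if "i < q" for i
      using arg_cong[OF eq, of "\<lambda>w. w $ i"] that v M2 by auto
    show "v = 0\<^sub>v q"
    proof (rule ccontr)
      assume nz: "v \<noteq> 0\<^sub>v q"
      have a: "\<alpha> \<noteq> 0"
      proof
        assume "\<alpha> = 0"
        then have "v = 0\<^sub>v q" using vi v by (intro eq_vecI) auto
        with nz show False ..
      qed
      have "M2 *\<^sub>v v = (1 / \<alpha>) \<cdot>\<^sub>v v" using vi v M2 a by (intro eq_vecI) auto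
      then have "eigenvalue M2 (1 / \<alpha>)" using eigenvalueI[OF M2 v(1) nz] by blast
      with S2 a \<Lambda> show False by fastforce
    qed
  qed
  note dN = inverse_matsD[OF N']
  \<comment> \<open>Relative to \<open>?K * W\<close> and \<open>W\<close>, C has the blocks M1 and
    M2, and D has the blocks I - \<alpha> M1 and \<open>?N\<close>. Extracting M1 on the left from
    the first pair leaves I and -T with T = \<alpha> I - M1^(-1); extracting \<open>- ?N\<close>
    from the second pair leaves Z and -I with Z = - N' M2. The extracted factors are collected in
    U.\<close>
  define T where "T = \<alpha> \<cdot>\<^sub>m 1\<^sub>m p - M1'"
  define Z where "Z = - (N' * M2)"
  define U where "U = ?K * W * (M1 \<oplus>\<^sub>m - ?N)"
  have Tc: "T \<in> carrier_mat p p" unfolding T_def using dM1 by (intro minus_carrier_mat) auto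
  have Zc: "Z \<in> carrier_mat q q" unfolding Z_def using dN M2 by auto
  have iU: "inverse_mats n U ((M1' \<oplus>\<^sub>m - N') * (W' * K'))"
  proof -
    have "inverse_mats q (- ?N) (- N')"
      using Nc dN M2 unfolding inverse_mats_def by simp
    from inverse_mats_mult[OF inverse_mats_mult[OF K W] inverse_mats_block_sum[OF M1' this, unfolded pq]]
    show ?thesis unfolding U_def .
  qed
  have CW: "C * W = ?K * W * (M1 \<oplus>\<^sub>m M2)"
  proof -
    have "C * W = ?K * (K' * (C * W))" using inverse_mats_cancel[OF K] C by simp
    also have "K' * (C * W) = W * (M1 \<oplus>\<^sub>m M2)"
      unfolding MW[symmetric] using dK C dW by (intro mult_mat_assoc[symmetric]) auto
    also have "?K * (W * (M1 \<oplus>\<^sub>m M2)) = ?K * W * (M1 \<oplus>\<^sub>m M2)"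
      using dK dW M1 M2 pq by (intro mult_mat_assoc[symmetric]) auto
    finally show ?thesis .
  qed
  have Ub: "U * (A \<oplus>\<^sub>m B) = ?K * W * ((M1 * A) \<oplus>\<^sub>m (- ?N * B))"
    if "A \<in> carrier_mat p p" "B \<in> carrier_mat q q" for A B
  proof -
    have "U * (A \<oplus>\<^sub>m B) = ?K * W * ((M1 \<oplus>\<^sub>m - ?N) * (A \<oplus>\<^sub>m B))"
      unfolding U_def using dK dW M1 M2 Nc pq that by (intro mult_mat_assoc) auto
    then show ?thesis using that M1 M2 by (simp add: block_sum_mult)
  qed
  have "- ?N * Z = M2"
    unfolding Z_def using inverse_mats_cancel(1)[OF N', of M2] M2 dN by simp
  then have 1: "C * W = U * (1\<^sub>m p \<oplus>\<^sub>m Z)"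
    using Ub[of "1\<^sub>m p" Z] Zc CW M1 by simp
  have "D * W = ?K * W * ((1\<^sub>m p - \<alpha> \<cdot>\<^sub>m M1) \<oplus>\<^sub>m ?N)"
    using C D by (intro pencil_split_eq[OF _ _ pq M1 M2 _ C CW] eq_matI) (use dK dW in auto)
  also have "1\<^sub>m p - \<alpha> \<cdot>\<^sub>m M1 = - (M1 * T)"
  proof -
    have "M1 * T = M1 * (\<alpha> \<cdot>\<^sub>m 1\<^sub>m p) - M1 * M1'"
      unfolding T_def using dM1 by (intro mult_minus_distrib_mat) auto
    also have "M1 * (\<alpha> \<cdot>\<^sub>m 1\<^sub>m p) = \<alpha> \<cdot>\<^sub>m M1"
      using mult_smult_distrib[OF M1 one_carrier_mat] M1 by simp
    finally show ?thesis using dM1 by (intro eq_matI) auto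
  qed
  also have "?K * W * (- (M1 * T) \<oplus>\<^sub>m ?N) = - (U * (T \<oplus>\<^sub>m 1\<^sub>m q))"
  proof -
    have 1: "- ?N * 1\<^sub>m q = - ?N" using Nc by (intro right_mult_one_mat) auto
    have "- (U * (T \<oplus>\<^sub>m 1\<^sub>m q)) = ?K * W * - ((M1 * T) \<oplus>\<^sub>m - ?N)"
      unfolding Ub[OF Tc one_carrier_mat] 1 using dW M1 Nc pq
      by (intro uminus_mult_right_mat[symmetric]) auto
    then show ?thesis by (simp add: uminus_block_sum)
  qed
  finally have 2: "D * W = - (U * (T \<oplus>\<^sub>m 1\<^sub>m q))" .
  \<comment> \<open>An eigenvalue t of T is the eigenvalue 1 / (\<alpha> - t) of M1, and \<alpha> -
    1 / (1 / (\<alpha> - t)) = t.\<close>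
  have 3: "t \<in> \<Lambda>" if ev: "eigenvalue T t" for t
  proof -
    obtain v where v: "v \<in> carrier_vec p" "v \<noteq> 0\<^sub>v p" "T *\<^sub>v v = t \<cdot>\<^sub>v v"
      using eigenvalueE[OF ev Tc] .
    have "T *\<^sub>v v = \<alpha> \<cdot>\<^sub>v v - M1' *\<^sub>v v"
      unfolding T_def using dM1 v by (subst minus_mult_distrib_mat_vec) (auto intro!: eq_vecI)
    with v(3) have "M1' *\<^sub>v v = (\<alpha> - t) \<cdot>\<^sub>v v"
      using v(1) dM1 by (auto simp: vec_eq_iff algebra_simps)
    from arg_cong[OF this, of "\<lambda>w. M1 *\<^sub>v w"]
    have "v = (\<alpha> - t) \<cdot>\<^sub>v (M1 *\<^sub>v v)"
      using inverse_mats_cancel_vec[OF M1' v(1)] M1 v(1) by (simp add: mult_mat_vec)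
    then have vi: "v $ i = (\<alpha> - t) * (M1 *\<^sub>v v) $ i" if "i < p" for i
      using that M1 by (metis carrier_matD(1) dim_mult_mat_vec index_smult_vec(1))
    have a: "\<alpha> - t \<noteq> 0"
    proof
      assume "\<alpha> - t = 0"
      then have "v = 0\<^sub>v p" using vi v by (intro eq_vecI) auto
      with v(2) show False ..
    qed
    have "M1 *\<^sub>v v = (1 / (\<alpha> - t)) \<cdot>\<^sub>v v" using vi v M1 a by (intro eq_vecI) auto
    then have "eigenvalue M1 (1 / (\<alpha> - t))" using eigenvalueI[OF M1 v(1,2)] by blast
    from S1[OF this] show ?thesis by simp
  qed
  \<comment> \<open>An eigenvalue z \<noteq> 0 of Z yields the eigenvalue z / (\<alpha> z - 1) of
    M2, which stands for the pencil eigenvalue 1 / z; with t z = 1 this is t \<in> \<Lambda>,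
    contrary to the assignment.\<close>
  have 4: "t * z \<noteq> 1" if ev: "eigenvalue Z z" and t: "t \<in> \<Lambda>" for z t
  proof
    assume tz: "t * z = 1"
    then have z: "z \<noteq> 0" by auto
    obtain v where v: "v \<in> carrier_vec q" "v \<noteq> 0\<^sub>v q" "Z *\<^sub>v v = z \<cdot>\<^sub>v v"
      using eigenvalueE[OF ev Zc] .
    have "?N *\<^sub>v (N' *\<^sub>v (M2 *\<^sub>v v)) = M2 *\<^sub>v v"
      using inverse_mats_cancel_vec[OF N'] M2 v by auto
    moreover have "N' *\<^sub>v (M2 *\<^sub>v v) = (- z) \<cdot>\<^sub>v v"
    proof -
      have "- (N' *\<^sub>v (M2 *\<^sub>v v)) = z \<cdot>\<^sub>v v"
        using v(3) M2 dN v(1) unfolding Z_def by (simp add: uminus_mult_mat_vec)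
      then show ?thesis using v(1) dN by (auto simp: vec_eq_iff minus_equation_iff)
    qed
    ultimately have "M2 *\<^sub>v v = (- z) \<cdot>\<^sub>v (?N *\<^sub>v v)" using Nc v(1) by (simp add: mult_mat_vec)
    then have "M2 *\<^sub>v v = (- z) \<cdot>\<^sub>v (v - \<alpha> \<cdot>\<^sub>v (M2 *\<^sub>v v))"
      using one_minus_smult_mult_vec[OF M2 v(1)] by simp
    then have vi: "(\<alpha> * z - 1) * (M2 *\<^sub>v v) $ i = z * v $ i" if "i < q" for i
      using that M2 v(1) by (subst (asm) vec_eq_iff) (auto simp: algebra_simps)
    have a: "\<alpha> * z - 1 \<noteq> 0"
    proof
      assume "\<alpha> * z - 1 = 0"
      then have "v = 0\<^sub>v q" using vi v z by (intro eq_vecI) auto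
      with v(2) show False ..
    qed
    have "M2 *\<^sub>v v = (z / (\<alpha> * z - 1)) \<cdot>\<^sub>v v"
      using vi v M2 a by (intro eq_vecI) (auto simp: field_simps)
    then have "eigenvalue M2 (z / (\<alpha> * z - 1))" using eigenvalueI[OF M2 v(1,2)] by blast
    moreover have "\<alpha> - 1 / (z / (\<alpha> * z - 1)) = t"
      using z a tz by (simp add: field_simps)
    ultimately show False using S2 z a t by fastforce
  qed
  show ?thesis by (rule that[OF pq Tc Zc iU W 1 2 3 4])
qed

text \<open>Comparing blocks in the two equations eliminates \<Omega>. The upper right block
  satisfies b = b' * Z' and T * b = b', hence the Stein equation b = T * b * Z'; in the same way the
  lower left one satisfies c = Z * c * T'. Both vanish by disjointness, and the diagonal blocks give
  the two intertwining relations.\<close>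

lemma intertwine_blocks:
  fixes T Z T' Z' :: "complex mat"
  assumes T: "T \<in> carrier_mat p p" and Z: "Z \<in> carrier_mat q q"
    and T': "T' \<in> carrier_mat p' p'" and Z': "Z' \<in> carrier_mat q' q'"
    and \<Theta>: "\<Theta> \<in> carrier_mat (p + q) (p' + q')" and \<Omega>: "\<Omega> \<in> carrier_mat (p + q) (p' + q')"
    and eq1: "(1\<^sub>m p \<oplus>\<^sub>m Z) * \<Theta> = \<Omega> * (1\<^sub>m p' \<oplus>\<^sub>m Z')"
    and eq2: "(T \<oplus>\<^sub>m 1\<^sub>m q) * \<Theta> = \<Omega> * (T' \<oplus>\<^sub>m 1\<^sub>m q')"
    and disj: "spectrally_disjoint T Z'" "spectrally_disjoint T' Z"
  obtains a d where "a \<in> carrier_mat p p'" "d \<in> carrier_mat q q'" "\<Theta> = a \<oplus>\<^sub>m d"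
    "T * a = a * T'" "Z * d = d * Z'"
proof -
  obtain a b c d where \<Theta>_eq: "\<Theta> = four_block_mat a b c d"
    and t: "a \<in> carrier_mat p p'" "b \<in> carrier_mat p q'" "c \<in> carrier_mat q p'" "d \<in> carrier_mat q q'"
    using four_block_split[OF \<Theta>] .
  obtain a' b' c' d' where \<Omega>_eq: "\<Omega> = four_block_mat a' b' c' d'"
    and o: "a' \<in> carrier_mat p p'" "b' \<in> carrier_mat p q'" "c' \<in> carrier_mat q p'" "d' \<in> carrier_mat q q'"
    using four_block_split[OF \<Omega>] .
  have L: "(A \<oplus>\<^sub>m B) * \<Theta> = four_block_mat (A * a) (A * b) (B * c) (B * d)"
    if "A \<in> carrier_mat p p" "B \<in> carrier_mat q q" for A B
    unfolding \<Theta>_eq block_sum_def using t that by (subst four_block_mult) auto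
  have R: "\<Omega> * (A \<oplus>\<^sub>m B) = four_block_mat (a' * A) (b' * B) (c' * A) (d' * B)"
    if "A \<in> carrier_mat p' p'" "B \<in> carrier_mat q' q'" for A B
    unfolding \<Omega>_eq block_sum_def using o that by (subst four_block_mult) auto
  have "four_block_mat a b (Z * c) (Z * d) = four_block_mat a' (b' * Z') c' (d' * Z')"
    using eq1 unfolding L[OF one_carrier_mat Z] R[OF one_carrier_mat Z'] using t o by simp
  note e1 = four_block_eqD[OF this t(1,2) mult_carrier_mat[OF Z t(3)] mult_carrier_mat[OF Z t(4)]
      o(1) mult_carrier_mat[OF o(2) Z'] o(3) mult_carrier_mat[OF o(4) Z']]
  have "four_block_mat (T * a) (T * b) c d = four_block_mat (a' * T') b' (c' * T') d'"
    using eq2 unfolding L[OF T one_carrier_mat] R[OF T' one_carrier_mat] using t o by simp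
  note e2 = four_block_eqD[OF this mult_carrier_mat[OF T t(1)] mult_carrier_mat[OF T t(2)] t(3,4)
      mult_carrier_mat[OF o(1) T'] o(2) mult_carrier_mat[OF o(3) T'] o(4)]
  have "b = 0\<^sub>m p q'"
    by (rule stein_unique[OF T Z' t(2) _ disj(1)]) (metis e1(2) e2(2))
  moreover have "c = 0\<^sub>m q p'"
    by (rule stein_unique[OF Z T' t(3) _ spectrally_disjoint_sym[OF disj(2)]]) (metis e1(3) e2(3))
  ultimately have "\<Theta> = a \<oplus>\<^sub>m d" unfolding \<Theta>_eq block_sum_def using t by simp
  with that t e1 e2 show ?thesis by metis
qed

section \<open>Sums of matrices of a given size\<close>

lemma mat_sum_carrier [simp]: "mat_sum r c F I \<in> carrier_mat r c"
  unfolding mat_sum_def by simp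

lemma dim_mat_sum [simp]: "dim_row (mat_sum r c F I) = r" "dim_col (mat_sum r c F I) = c"
  unfolding mat_sum_def by simp_all

lemma index_mat_sum [simp]:
  "i < r \<Longrightarrow> j < c \<Longrightarrow> mat_sum r c F I $$ (i, j) = (\<Sum>l\<in>I. F l $$ (i, j))"
  unfolding mat_sum_def by simp

lemma mat_sum_cong:
  "I = I' \<Longrightarrow> (\<And>i. i \<in> I' \<Longrightarrow> F i = G i) \<Longrightarrow> mat_sum r c F I = mat_sum r c G I'"
  by (intro eq_matI) (auto intro!: sum.cong)

lemma mat_sum_mult:
  assumes "\<And>i. i \<in> I \<Longrightarrow> F i \<in> carrier_mat r c" "M \<in> carrier_mat c d"
  shows "mat_sum r c F I * M = mat_sum r d (\<lambda>i. F i * M) I"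
proof (rule eq_matI)
  fix i j assume ij: "i < dim_row (mat_sum r d (\<lambda>i. F i * M) I)" "j < dim_col (mat_sum r d (\<lambda>i. F i * M) I)"
  then have "(mat_sum r c F I * M) $$ (i, j) = (\<Sum>l<c. (\<Sum>x\<in>I. F x $$ (i, l)) * M $$ (l, j))"
    using assms(2) by (simp add: scalar_prod_def atLeast0LessThan)
  also have "\<dots> = (\<Sum>x\<in>I. \<Sum>l<c. F x $$ (i, l) * M $$ (l, j))"
    unfolding sum_distrib_right by (rule sum.swap)
  also have "\<dots> = (\<Sum>x\<in>I. (F x * M) $$ (i, j))"
  proof (rule sum.cong[OF refl])
    fix x assume "x \<in> I"
    with assms(1)[OF this] assms(2) ij
    show "(\<Sum>l<c. F x $$ (i, l) * M $$ (l, j)) = (F x * M) $$ (i, j)"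
      by (simp add: scalar_prod_def atLeast0LessThan)
  qed
  finally show "(mat_sum r c F I * M) $$ (i, j) = mat_sum r d (\<lambda>i. F i * M) I $$ (i, j)"
    using ij by simp
qed (use assms in simp_all)

lemma mat_sum_atMost:
  assumes "F k \<in> carrier_mat r c"
  shows "mat_sum r c F {..k} = mat_sum r c F {..<k} + F k"
  using assms by (intro eq_matI) (auto simp: lessThan_Suc_atMost[symmetric])

lemma mat_sum_hcat:
  assumes "\<And>i. i \<in> I \<Longrightarrow> X i \<in> carrier_mat r p" "\<And>i. i \<in> I \<Longrightarrow> Y i \<in> carrier_mat r q"
  shows "mat_sum r (p + q) (\<lambda>i. hcat (X i) (Y i)) I = hcat (mat_sum r p X I) (mat_sum r q Y I)"
proof (rule eq_matI)
  fix i j assume "i < dim_row (hcat (mat_sum r p X I) (mat_sum r q Y I))"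
    "j < dim_col (hcat (mat_sum r p X I) (mat_sum r q Y I))"
  then have ij: "i < r" "j < p + q" by auto
  have "hcat (X x) (Y x) $$ (i, j) = (if j < p then X x $$ (i, j) else Y x $$ (i, j - p))" if "x \<in> I" for x
    using assms(1)[OF that] assms(2)[OF that] ij by (simp add: index_hcat)
  then show "mat_sum r (p + q) (\<lambda>i. hcat (X i) (Y i)) I $$ (i, j) =
      hcat (mat_sum r p X I) (mat_sum r q Y I) $$ (i, j)"
    using ij by (auto simp: index_hcat cong: sum.cong)
qed auto

subsection \<open>Block columns and the companion pencil\<close>

definition stack :: "nat \<Rightarrow> nat \<Rightarrow> nat \<Rightarrow> (nat \<Rightarrow> 'a mat) \<Rightarrow> 'a mat" where
  "stack m k c F = mat (m * k) c (\<lambda>(r, j). F (r div m) $$ (r mod m, j))"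

text \<open>The selector [0 ... I ... 0]. Multiplication by it on the left extracts block j of a
  block column, so that later proofs argue with whole blocks instead of \<open>div\<close> and
  \<open>mod\<close> of row indices.\<close>

definition block_row :: "nat \<Rightarrow> nat \<Rightarrow> nat \<Rightarrow> 'a :: {zero, one} mat" where
  "block_row m k j = mat m (m * k) (\<lambda>(r, c). if c = j * m + r then 1 else 0)"

lemma stack_carrier [simp]: "stack m k c F \<in> carrier_mat (m * k) c"
  unfolding stack_def by simp

lemma dim_stack [simp]: "dim_row (stack m k c F) = m * k" "dim_col (stack m k c F) = c"
  unfolding stack_def by simp_all

lemma block_row_carrier [simp]: "block_row m k j \<in> carrier_mat m (m * k)"
  unfolding block_row_def by simp

lemma dim_block_row [simp]: "dim_row (block_row m k j) = m" "dim_col (block_row m k j) = m * k"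
  unfolding block_row_def by simp_all

lemma stack_index_bound:
  fixes m :: nat
  assumes "j < k" "r < m"
  shows "j * m + r < m * k"
proof -
  have "j * m + r < Suc j * m" using assms by simp
  also have "\<dots> \<le> k * m" using assms by (intro mult_le_mono1) simp
  finally show ?thesis by (simp add: mult.commute)
qed

lemma index_stack:
  assumes "j < k" "r < m" "s < c"
  shows "stack m k c F $$ (j * m + r, s) = F j $$ (r, s)"
  using stack_index_bound[OF assms(1,2)] assms unfolding stack_def by simp

lemma stack_cong: "(\<And>j. j < k \<Longrightarrow> F j = G j) \<Longrightarrow> stack m k c F = stack m k c G"
  unfolding stack_def by (intro eq_matI) (auto simp: less_mult_imp_div_less mult.commute)

lemma block_row_mult_index:
  fixes M :: "'a :: semiring_1 mat"
  assumes "M \<in> carrier_mat (m * k) c" "j < k" "r < m" "s < c"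
  shows "(block_row m k j * M) $$ (r, s) = M $$ (j * m + r, s)"
proof -
  have "(block_row m k j * M) $$ (r, s) = (\<Sum>l<m * k. (if l = j * m + r then 1 else 0) * M $$ (l, s))"
    using assms unfolding block_row_def by (simp add: scalar_prod_def atLeast0LessThan)
  also have "\<dots> = (\<Sum>l<m * k. if l = j * m + r then M $$ (l, s) else 0)"
    by (intro sum.cong) auto
  also have "\<dots> = M $$ (j * m + r, s)" using stack_index_bound[OF assms(2,3)] by simp
  finally show ?thesis .
qed

lemma block_row_mult_stack:
  fixes F :: "nat \<Rightarrow> 'a :: semiring_1 mat"
  assumes "j < k" "F j \<in> carrier_mat m c"
  shows "block_row m k j * stack m k c F = F j"
proof (rule eq_matI)
  fix r s assume "r < dim_row (F j)" "s < dim_col (F j)"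
  then show "(block_row m k j * stack m k c F) $$ (r, s) = F j $$ (r, s)"
    using assms block_row_mult_index[OF stack_carrier assms(1), of r m s c F] by (simp add: index_stack)
qed (use assms in simp_all)

lemma stack_eqD:
  fixes F G :: "nat \<Rightarrow> 'a :: semiring_1 mat"
  assumes "stack m k c F = stack m k c G" "j < k" "F j \<in> carrier_mat m c" "G j \<in> carrier_mat m c"
  shows "F j = G j"
  using block_row_mult_stack[of j k F m c] block_row_mult_stack[of j k G m c] assms by simp

lemma stack_block_rows:
  fixes M :: "'a :: semiring_1 mat"
  assumes "M \<in> carrier_mat (m * k) c"
  shows "stack m k c (\<lambda>j. block_row m k j * M) = M"
proof (rule eq_matI)
  fix r s assume "r < dim_row M" "s < dim_col M"
  then have rs: "r < m * k" "s < c" using assms by auto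
  then have m: "0 < m" by (cases m) auto
  have "r div m < k" using rs by (simp add: less_mult_imp_div_less mult.commute)
  from block_row_mult_index[OF assms this, of "r mod m" s] rs m
  show "stack m k c (\<lambda>j. block_row m k j * M) $$ (r, s) = M $$ (r, s)"
    unfolding stack_def by simp
qed (use assms in simp_all)

lemma stack_mult:
  fixes F :: "nat \<Rightarrow> 'a :: semiring_1 mat"
  assumes F: "\<And>j. j < k \<Longrightarrow> F j \<in> carrier_mat m c" and M: "M \<in> carrier_mat c d"
  shows "stack m k c F * M = stack m k d (\<lambda>j. F j * M)"
proof -
  have "stack m k c F * M = stack m k d (\<lambda>j. block_row m k j * (stack m k c F * M))"
    using M by (intro stack_block_rows[symmetric]) auto
  also have "\<dots> = stack m k d (\<lambda>j. F j * M)"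
  proof (rule stack_cong)
    fix j assume "j < k"
    then show "block_row m k j * (stack m k c F * M) = F j * M"
      using block_row_mult_stack[of j k F m c] F M by (simp add: mult_mat_assoc[symmetric] del: assoc_mult_mat)
  qed
  finally show ?thesis .
qed

lemma stack_add:
  assumes "\<And>j. j < k \<Longrightarrow> G j \<in> carrier_mat m c"
  shows "stack m k c F + stack m k c G = stack m k c (\<lambda>j. F j + G j)"
proof (rule eq_matI)
  fix r s assume "r < dim_row (stack m k c (\<lambda>j. F j + G j))" "s < dim_col (stack m k c (\<lambda>j. F j + G j))"
  then have rs: "r < m * k" "s < c" by auto
  then have m: "0 < m" by (cases m) auto
  have "r div m < k" using rs by (simp add: less_mult_imp_div_less mult.commute)
  from assms[OF this] show "(stack m k c F + stack m k c G) $$ (r, s) = stack m k c (\<lambda>j. F j + G j) $$ (r, s)"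
    using rs m unfolding stack_def by simp
qed auto

lemma stack_smult:
  assumes "\<And>j. j < k \<Longrightarrow> F j \<in> carrier_mat m c"
  shows "a \<cdot>\<^sub>m stack m k c F = stack m k c (\<lambda>j. a \<cdot>\<^sub>m F j)"
proof (rule eq_matI)
  fix r s assume "r < dim_row (stack m k c (\<lambda>j. a \<cdot>\<^sub>m F j))" "s < dim_col (stack m k c (\<lambda>j. a \<cdot>\<^sub>m F j))"
  then have rs: "r < m * k" "s < c" by auto
  then have m: "0 < m" by (cases m) auto
  have "r div m < k" using rs by (simp add: less_mult_imp_div_less mult.commute)
  from assms[OF this] show "(a \<cdot>\<^sub>m stack m k c F) $$ (r, s) = stack m k c (\<lambda>j. a \<cdot>\<^sub>m F j) $$ (r, s)"
    using rs m unfolding stack_def by simp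
qed auto

lemma stack_uminus:
  assumes "\<And>j. j < k \<Longrightarrow> F j \<in> carrier_mat m c"
  shows "- stack m k c F = stack m k c (\<lambda>j. - F j)"
proof (rule eq_matI)
  fix r s assume "r < dim_row (stack m k c (\<lambda>j. - F j))" "s < dim_col (stack m k c (\<lambda>j. - F j))"
  then have rs: "r < m * k" "s < c" by auto
  then have m: "0 < m" by (cases m) auto
  have "r div m < k" using rs by (simp add: less_mult_imp_div_less mult.commute)
  from assms[OF this] show "(- stack m k c F) $$ (r, s) = stack m k c (\<lambda>j. - F j) $$ (r, s)"
    using rs m unfolding stack_def by simp
qed auto

text \<open>\<open>\<lambda> companion1 + companion0\<close> is the companion linearisation of \<open>P\<close>.\<close>

definition companion1 :: "nat \<Rightarrow> nat \<Rightarrow> (nat \<Rightarrow> complex mat) \<Rightarrow> complex mat" where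
  "companion1 m k A = stack m k (m * k)
     (\<lambda>j. if Suc j < k then block_row m k j else A k * block_row m k j)"

definition companion0 :: "nat \<Rightarrow> nat \<Rightarrow> (nat \<Rightarrow> complex mat) \<Rightarrow> complex mat" where
  "companion0 m k A = stack m k (m * k)
     (\<lambda>j. if Suc j < k then - block_row m k (Suc j)
          else mat_sum m (m * k) (\<lambda>i. A i * block_row m k i) {..<k})"

lemma companion_carrier [simp]:
  "companion1 m k A \<in> carrier_mat (m * k) (m * k)" "companion0 m k A \<in> carrier_mat (m * k) (m * k)"
  unfolding companion1_def companion0_def by simp_all

lemma dim_companion [simp]:
  "dim_row (companion1 m k A) = m * k" "dim_col (companion1 m k A) = m * k"
  "dim_row (companion0 m k A) = m * k" "dim_col (companion0 m k A) = m * k"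
  unfolding companion1_def companion0_def by simp_all

lemma companion1_mult_stack:
  assumes A: "\<And>i. i \<le> k \<Longrightarrow> A i \<in> carrier_mat m m"
    and F: "\<And>j. j < k \<Longrightarrow> F j \<in> carrier_mat m c"
  shows "companion1 m k A * stack m k c F = stack m k c (\<lambda>j. if Suc j < k then F j else A k * F j)"
  unfolding companion1_def
proof (subst stack_mult)
  show "stack m k c (\<lambda>j. (if Suc j < k then block_row m k j else A k * block_row m k j) * stack m k c F) =
    stack m k c (\<lambda>j. if Suc j < k then F j else A k * F j)"
    using A[of k] F by (intro stack_cong) (auto simp: block_row_mult_stack mult_mat_assoc)
qed (use A[of k] in auto)

lemma companion0_mult_stack:
  assumes A: "\<And>i. i \<le> k \<Longrightarrow> A i \<in> carrier_mat m m"
    and F: "\<And>j. j < k \<Longrightarrow> F j \<in> carrier_mat m c"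
  shows "companion0 m k A * stack m k c F =
    stack m k c (\<lambda>j. if Suc j < k then - F (Suc j) else mat_sum m c (\<lambda>i. A i * F i) {..<k})"
  unfolding companion0_def
proof (subst stack_mult)
  have "mat_sum m (m * k) (\<lambda>i. A i * block_row m k i) {..<k} * stack m k c F =
      mat_sum m c (\<lambda>i. A i * F i) {..<k}"
  proof (subst mat_sum_mult)
    show "mat_sum m c (\<lambda>i. A i * block_row m k i * stack m k c F) {..<k} =
        mat_sum m c (\<lambda>i. A i * F i) {..<k}"
    proof (rule mat_sum_cong[OF refl])
      fix i assume "i \<in> {..<k}"
      then show "A i * block_row m k i * stack m k c F = A i * F i"
        using A[of i] F[of i] by (simp add: block_row_mult_stack mult_mat_assoc)
    qed
  qed (use A in \<open>auto intro!: mult_carrier_mat\<close>)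
  then show "stack m k c (\<lambda>j. (if Suc j < k then - block_row m k (Suc j)
        else mat_sum m (m * k) (\<lambda>i. A i * block_row m k i) {..<k}) * stack m k c F) =
    stack m k c (\<lambda>j. if Suc j < k then - F (Suc j) else mat_sum m c (\<lambda>i. A i * F i) {..<k})"
    using F by (intro stack_cong) (auto simp: block_row_mult_stack)
qed auto

definition peval :: "nat \<Rightarrow> nat \<Rightarrow> (nat \<Rightarrow> complex mat) \<Rightarrow> complex \<Rightarrow> complex mat" where
  "peval m k A \<alpha> = mat_sum m m (\<lambda>i. \<alpha> ^ i \<cdot>\<^sub>m A i) {..k}"

lemma peval_carrier: "peval m k A \<alpha> \<in> carrier_mat m m"
  unfolding peval_def by simp

lemma smult_smult_mat: "a \<cdot>\<^sub>m (b \<cdot>\<^sub>m M) = (a * b :: 'a :: semigroup_mult) \<cdot>\<^sub>m M"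
  by (rule eq_matI) (auto simp: mult.assoc)

lemma stack_zero: "stack m k c (\<lambda>j. 0\<^sub>m m c) = 0\<^sub>m (m * k) c"
proof (rule eq_matI)
  fix r s assume "r < dim_row (0\<^sub>m (m * k) c :: 'a mat)" "s < dim_col (0\<^sub>m (m * k) c :: 'a mat)"
  then show "stack m k c (\<lambda>j. 0\<^sub>m m c :: 'a mat) $$ (r, s) = 0\<^sub>m (m * k) c $$ (r, s)"
    by (cases m) (auto simp: stack_def)
qed auto

text \<open>For a kernel vector with blocks F_0, ..., F_(k-1), all rows of the companion matrix at
  \<alpha> but the last say F_(j+1) = \<alpha> F_j; the last one then reads P(\<alpha>) F_0 = 0.
  Since P(\<alpha>) is invertible, the kernel is trivial.\<close>

lemma companion_regular:
  assumes A: "\<And>i. i \<le> k \<Longrightarrow> A i \<in> carrier_mat m m" and reg: "det (peval m k A \<alpha>) \<noteq> 0"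
  shows "det (\<alpha> \<cdot>\<^sub>m companion1 m k A + companion0 m k A) \<noteq> 0" (is "det ?L \<noteq> 0")
proof -
  have L: "?L \<in> carrier_mat (m * k) (m * k)" by simp
  obtain P' where P': "inverse_mats m (peval m k A \<alpha>) P'"
    using det_imp_inverse_mats[OF peval_carrier reg] .
  have "v = 0\<^sub>v (m * k)" if v: "v \<in> carrier_vec (m * k)" and Lv: "?L *\<^sub>v v = 0\<^sub>v (m * k)" for v
  proof (cases "k = 0")
    case True
    then show ?thesis using v by auto
  next
    case False
    \<comment> \<open>The vector is viewed as a matrix with one column, so that the block rules for
      \<open>stack\<close> and \<open>block_row\<close> apply to it.\<close>
    define N where "N = mat (m * k) 1 (\<lambda>(i, j). v $ i)"
    have N: "N \<in> carrier_mat (m * k) 1" unfolding N_def by simp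
    have cN: "col N 0 = v" unfolding N_def using v by (intro eq_vecI) auto
    define F where "F j = block_row m k j * N" for j
    have F: "F j \<in> carrier_mat m 1" for j unfolding F_def using N by auto
    let ?lead = "\<lambda>j. if Suc j < k then F j else A k * F j"
      and ?rest = "\<lambda>j. if Suc j < k then - F (Suc j) else mat_sum m 1 (\<lambda>i. A i * F i) {..<k}"
    let ?row = "\<lambda>j. \<alpha> \<cdot>\<^sub>m ?lead j + ?rest j"
    have NF: "N = stack m k 1 F" unfolding F_def using stack_block_rows[OF N] by simp
    have "?L * N = 0\<^sub>m (m * k) 1"
    proof (rule eq_matI)
      fix i j assume "i < dim_row (0\<^sub>m (m * k) 1 :: complex mat)" "j < dim_col (0\<^sub>m (m * k) 1 :: complex mat)"
      then have ij: "i < m * k" "j = 0" by auto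
      have "(?L * N) $$ (i, j) = (?L *\<^sub>v v) $ i"
        unfolding cN[symmetric] using ij L N by simp
      then show "(?L * N) $$ (i, j) = 0\<^sub>m (m * k) 1 $$ (i, j)" unfolding Lv using ij by simp
    qed (use L N in auto)
    moreover have "?L * N = stack m k 1 ?row"
    proof -
      have "?L * N = \<alpha> \<cdot>\<^sub>m (companion1 m k A * N) + companion0 m k A * N"
        using mult_smult_assoc_mat[OF companion_carrier(1) N]
          add_mult_distrib_mat[OF smult_carrier_mat[OF companion_carrier(1)] companion_carrier(2) N]
        by simp
      also have "companion1 m k A * N = stack m k 1 ?lead"
        unfolding NF by (rule companion1_mult_stack[OF A F])
      also have "companion0 m k A * N = stack m k 1 ?rest"
        unfolding NF by (rule companion0_mult_stack[OF A F])
      also have "\<alpha> \<cdot>\<^sub>m stack m k 1 ?lead = stack m k 1 (\<lambda>j. \<alpha> \<cdot>\<^sub>m ?lead j)"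
        using F A[of k] by (intro stack_smult) (auto intro!: mult_carrier_mat)
      also have "\<dots> + stack m k 1 ?rest = stack m k 1 ?row"
        using F by (intro stack_add) auto
      finally show ?thesis .
    qed
    ultimately have "stack m k 1 ?row = 0\<^sub>m (m * k) 1"
      by simp
    also have "0\<^sub>m (m * k) 1 = stack m k 1 (\<lambda>j. 0\<^sub>m m 1 :: complex mat)"
      by (rule stack_zero[symmetric])
    finally have S: "stack m k 1 ?row = stack m k 1 (\<lambda>j. 0\<^sub>m m 1)" .
    have "\<alpha> \<cdot>\<^sub>m ?lead j + ?rest j = 0\<^sub>m m 1"
      if "j < k" for j
      by (rule stack_eqD[OF S that]) (use F A[of k] in auto)
    note row = this
    have step: "F (Suc j) = \<alpha> \<cdot>\<^sub>m F j" if "Suc j < k" for j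
    proof (rule eq_matI)
      fix r s assume "r < dim_row (\<alpha> \<cdot>\<^sub>m F j)" "s < dim_col (\<alpha> \<cdot>\<^sub>m F j)"
      then have rs: "r < m" "s < 1" using F[of j] by auto
      have "\<alpha> \<cdot>\<^sub>m F j + - F (Suc j) = 0\<^sub>m m 1" using row[of j] that by simp
      from arg_cong[OF this, of "\<lambda>M. M $$ (r, s)"]
      have "\<alpha> * F j $$ (r, s) - F (Suc j) $$ (r, s) = 0"
        using rs carrier_matD[OF F[of j]] carrier_matD[OF F[of "Suc j"]] by simp
      then show "F (Suc j) $$ (r, s) = (\<alpha> \<cdot>\<^sub>m F j) $$ (r, s)"
        using rs carrier_matD[OF F[of j]] by simp
    qed (use F[of j] F[of "Suc j"] in auto)
    have Fj: "F j = \<alpha> ^ j \<cdot>\<^sub>m F 0" if "j < k" for j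
      using that
    proof (induction j)
      case 0
      then show ?case by (intro eq_matI) auto
    next
      case (Suc j)
      then show ?case using step[of j] by (simp add: smult_smult_mat)
    qed
    have "peval m k A \<alpha> * F 0 = mat_sum m 1 (\<lambda>i. (\<alpha> ^ i \<cdot>\<^sub>m A i) * F 0) {..k}"
      unfolding peval_def using A F by (intro mat_sum_mult) auto
    also have "\<dots> = mat_sum m 1 (\<lambda>i. (\<alpha> ^ i \<cdot>\<^sub>m A i) * F 0) {..<k} + (\<alpha> ^ k \<cdot>\<^sub>m A k) * F 0"
      by (intro mat_sum_atMost mult_carrier_mat[OF smult_carrier_mat[OF A[OF order_refl]] F])
    also have "mat_sum m 1 (\<lambda>i. (\<alpha> ^ i \<cdot>\<^sub>m A i) * F 0) {..<k} = mat_sum m 1 (\<lambda>i. A i * F i) {..<k}"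
    proof (rule mat_sum_cong[OF refl])
      fix i assume i: "i \<in> {..<k}"
      then have Ai: "A i \<in> carrier_mat m m" using A by auto
      show "(\<alpha> ^ i \<cdot>\<^sub>m A i) * F 0 = A i * F i"
        using Fj[of i] i mult_smult_distrib[OF Ai F[of 0], of "\<alpha> ^ i"] mult_smult_assoc_mat[OF Ai F[of 0], of "\<alpha> ^ i"]
        by simp
    qed
    \<comment> \<open>Only \<alpha>^(k-1) is absorbed by F_(k-1); the remaining factor \<alpha> is
      the one that the pencil contributes in its last row.\<close>
    also have "(\<alpha> ^ k \<cdot>\<^sub>m A k) * F 0 = \<alpha> \<cdot>\<^sub>m (A k * F (k - 1))"
    proof -
      obtain k' where k': "k = Suc k'" using False by (cases k) auto
      show ?thesis
        using Fj[of k'] k' mult_smult_distrib[OF A[of k] F[of 0], of "\<alpha> ^ k'"]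
          mult_smult_assoc_mat[OF A[of k] F[of 0], of "\<alpha> ^ k"]
        by (simp add: smult_smult_mat)
    qed
    also have "mat_sum m 1 (\<lambda>i. A i * F i) {..<k} + \<alpha> \<cdot>\<^sub>m (A k * F (k - 1)) = 0\<^sub>m m 1"
    proof -
      have "\<alpha> \<cdot>\<^sub>m (A k * F (k - 1)) + mat_sum m 1 (\<lambda>i. A i * F i) {..<k} = 0\<^sub>m m 1"
        using row[of "k - 1"] False by simp
      then show ?thesis using A[of k] F by (subst comm_add_mat[of _ m 1]) auto
    qed
    finally have "peval m k A \<alpha> * F 0 = 0\<^sub>m m 1" .
    then have "F 0 = P' * 0\<^sub>m m 1" using inverse_mats_cancel(2)[OF P', of "F 0"] F[of 0] by auto
    then have F0: "F 0 = 0\<^sub>m m 1" using inverse_matsD[OF P'] by simp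
    have "F j = 0\<^sub>m m 1" if "j < k" for j using Fj[OF that] F0 by simp
    then have "N = stack m k 1 (\<lambda>j. 0\<^sub>m m 1)" unfolding NF by (rule stack_cong)
    then have "v = col (0\<^sub>m (m * k) 1) 0" using cN stack_zero by metis
    then show ?thesis by simp
  qed
  then obtain L' where "inverse_mats (m * k) ?L L'"
    using injective_imp_inverse_mats[OF L] by blast
  then show ?thesis by (rule inverse_mats_imp_det)
qed

section \<open>Null pairs as splittings of the companion pencil\<close>

text \<open>A standard pair without the rank condition.\<close>

definition null_pair ::
  "nat \<Rightarrow> nat \<Rightarrow> (nat \<Rightarrow> complex mat) \<Rightarrow> nat \<Rightarrow> nat \<Rightarrow>
    complex mat \<Rightarrow> complex mat \<Rightarrow> complex mat \<Rightarrow> complex mat \<Rightarrow> bool" where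
  "null_pair m k A p q X Y T Z \<longleftrightarrow>
     X \<in> carrier_mat m p \<and> T \<in> carrier_mat p p \<and>
     Y \<in> carrier_mat m q \<and> Z \<in> carrier_mat q q \<and>
     mat_sum m p (\<lambda>i. A i * X * (T ^\<^sub>m i)) {..k} = 0\<^sub>m m p \<and>
     mat_sum m q (\<lambda>i. A i * Y * (Z ^\<^sub>m (k - i))) {..k} = 0\<^sub>m m q"

lemma null_pairD:
  assumes "null_pair m k A p q X Y T Z"
  shows "X \<in> carrier_mat m p" "T \<in> carrier_mat p p" "Y \<in> carrier_mat m q" "Z \<in> carrier_mat q q"
    "mat_sum m p (\<lambda>i. A i * X * (T ^\<^sub>m i)) {..k} = 0\<^sub>m m p"
    "mat_sum m q (\<lambda>i. A i * Y * (Z ^\<^sub>m (k - i))) {..k} = 0\<^sub>m m q"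
  using assms unfolding null_pair_def by auto

lemma controllability_mat_stack:
  "controllability_mat m k X Y T Z =
    stack m k (dim_col X + dim_col Y) (\<lambda>j. hcat (X * (T ^\<^sub>m j)) (Y * (Z ^\<^sub>m (k - 1 - j))))"
  unfolding controllability_mat_def stack_def ..

lemma controllability_mat_carrier:
  "null_pair m k A p q X Y T Z \<Longrightarrow> controllability_mat m k X Y T Z \<in> carrier_mat (m * k) (p + q)"
  unfolding controllability_mat_stack using null_pairD(1,3)[of m k A p q X Y T Z] by auto

text \<open>For p + q = m * k the controllability matrix is square, so the rank condition is
  invertibility. Later arguments use it in the form of the determinant.\<close>

lemma maximal_standard_pair_iff:
  "maximal_standard_pair m k A p q X Y T Z \<longleftrightarrow>
    null_pair m k A p q X Y T Z \<and> p + q = m * k \<and> det (controllability_mat m k X Y T Z) \<noteq> 0"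
proof -
  have "vec_space.rank (m * k) (controllability_mat m k X Y T Z) = m * k \<longleftrightarrow>
      det (controllability_mat m k X Y T Z) \<noteq> 0"
    if "null_pair m k A p q X Y T Z" "p + q = m * k"
    using vec_space.det_rank_iff[OF controllability_mat_carrier[OF that(1), unfolded that(2)]] by simp
  then show ?thesis
    unfolding maximal_standard_pair_def standard_pair_def null_pair_def by auto
qed

lemma add_eq_zero_imp_uminus_mat:
  fixes M N :: "complex mat"
  assumes "M + N = 0\<^sub>m r c" "M \<in> carrier_mat r c" "N \<in> carrier_mat r c"
  shows "M = - N"
proof (rule eq_matI)
  fix i j assume "i < dim_row (- N)" "j < dim_col (- N)"
  then have ij: "i < r" "j < c" using assms by auto
  have "M $$ (i, j) + N $$ (i, j) = 0"
    using arg_cong[OF assms(1), of "\<lambda>M. M $$ (i, j)"] ij assms(2,3) by simp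
  then show "M $$ (i, j) = (- N) $$ (i, j)" using ij assms by (simp add: eq_neg_iff_add_eq_0)
qed (use assms in auto)

lemma uminus_hcat: "dim_row Y = dim_row X \<Longrightarrow> - hcat X Y = hcat (- X) (- Y :: 'a :: group_add mat)"
  by (rule eq_matI) (auto simp: index_hcat)

text \<open>Row j of the companion pencil applied to the controllability matrix is \<lambda>
  [X T^j, Y Z^(k-1-j)] - [X T^(j+1), Y Z^(k-2-j)], which factors as [X T^j, Y Z^(k-2-j)] times the
  pencil \<lambda> (I \<oplus> Z) - (T \<oplus> I). In the last row the corresponding factorisation
  is exactly what the two null equations provide.\<close>

lemma null_pair_intertwine:
  assumes A: "\<And>i. i \<le> k \<Longrightarrow> A i \<in> carrier_mat m m" and np: "null_pair m k A p q X Y T Z"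
  obtains \<Psi> where "\<Psi> \<in> carrier_mat (m * k) (p + q)"
    "companion1 m k A * controllability_mat m k X Y T Z = \<Psi> * (1\<^sub>m p \<oplus>\<^sub>m Z)"
    "companion0 m k A * controllability_mat m k X Y T Z = - (\<Psi> * (T \<oplus>\<^sub>m 1\<^sub>m q))"
proof -
  note c = null_pairD(1-4)[OF np]
  note d = carrier_matD[OF c(1)] carrier_matD[OF c(2)] carrier_matD[OF c(3)] carrier_matD[OF c(4)]
  have Ad: "dim_row (A i) = m" "dim_col (A i) = m" if "i \<le> k" for i using A[OF that] by auto
  note Ak = Ad[OF order_refl]
  let ?F = "\<lambda>j. hcat (X * (T ^\<^sub>m j)) (Y * (Z ^\<^sub>m (k - 1 - j)))"
  have F: "?F j \<in> carrier_mat m (p + q)" for j using c by auto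
  have \<Phi>: "controllability_mat m k X Y T Z = stack m k (p + q) ?F"
    unfolding controllability_mat_stack using d by simp
  \<comment> \<open>In the last row of \<Psi> the pattern would ask for A_k Y Z^(-1). Its place is
    taken by -S, because the null equation for Y reads S Z = - A_k Y.\<close>
  let ?S = "mat_sum m q (\<lambda>i. A i * (Y * (Z ^\<^sub>m (k - 1 - i)))) {..<k}"
  let ?G = "\<lambda>j. if Suc j < k then hcat (X * (T ^\<^sub>m j)) (Y * (Z ^\<^sub>m (k - 1 - Suc j)))
      else hcat (A k * (X * (T ^\<^sub>m j))) (- ?S)"
  have G: "?G j \<in> carrier_mat m (p + q)" for j
    using c A[of k] by (auto intro!: hcat_carrier mult_carrier_mat)
  let ?\<Psi> = "stack m k (p + q) ?G"
  have SX: "mat_sum m p (\<lambda>i. A i * (X * (T ^\<^sub>m i))) {..<k} = - (A k * (X * (T ^\<^sub>m k)))"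
  proof (rule add_eq_zero_imp_uminus_mat)
    have "mat_sum m p (\<lambda>i. A i * (X * (T ^\<^sub>m i))) {..k} = 0\<^sub>m m p"
      unfolding null_pairD(5)[OF np, symmetric]
      using d Ad by (intro mat_sum_cong refl) (simp add: mult_mat_assoc)
    then show "mat_sum m p (\<lambda>i. A i * (X * (T ^\<^sub>m i))) {..<k} + A k * (X * (T ^\<^sub>m k)) = 0\<^sub>m m p"
      using mat_sum_atMost[of "\<lambda>i. A i * (X * (T ^\<^sub>m i))" k m p] c A[of k] by auto
  qed (use c A[of k] in \<open>auto intro!: mult_carrier_mat\<close>)
  have SY: "?S * Z = - (A k * (Y * (Z ^\<^sub>m 0)))"
  proof (rule add_eq_zero_imp_uminus_mat)
    have "?S * Z = mat_sum m q (\<lambda>i. A i * (Y * (Z ^\<^sub>m (k - 1 - i))) * Z) {..<k}"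
      using A c by (intro mat_sum_mult) (auto intro!: mult_carrier_mat)
    also have "\<dots> = mat_sum m q (\<lambda>i. A i * (Y * (Z ^\<^sub>m (k - i)))) {..<k}"
    proof (rule mat_sum_cong[OF refl])
      fix i assume i: "i \<in> {..<k}"
      then have "k - i = Suc (k - 1 - i)" by auto
      then show "A i * (Y * (Z ^\<^sub>m (k - 1 - i))) * Z = A i * (Y * (Z ^\<^sub>m (k - i)))"
        using d Ad[of i] i by (simp add: mult_mat_assoc)
    qed
    finally have 1: "?S * Z = mat_sum m q (\<lambda>i. A i * (Y * (Z ^\<^sub>m (k - i)))) {..<k}" .
    have "mat_sum m q (\<lambda>i. A i * (Y * (Z ^\<^sub>m (k - i)))) {..k} = 0\<^sub>m m q"
      unfolding null_pairD(6)[OF np, symmetric]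
      using d Ad by (intro mat_sum_cong refl) (simp add: mult_mat_assoc)
    then show "?S * Z + A k * (Y * (Z ^\<^sub>m 0)) = 0\<^sub>m m q"
      unfolding 1 using mat_sum_atMost[of "\<lambda>i. A i * (Y * (Z ^\<^sub>m (k - i)))" k m q] c A[of k]
      by (auto intro!: mult_carrier_mat)
  qed (use c A[of k] in \<open>auto intro!: mult_carrier_mat\<close>)
  have "companion1 m k A * stack m k (p + q) ?F =
      stack m k (p + q) (\<lambda>j. if Suc j < k then ?F j else A k * ?F j)"
    by (rule companion1_mult_stack[OF A F])
  also have "\<dots> = stack m k (p + q) (\<lambda>j. ?G j * (1\<^sub>m p \<oplus>\<^sub>m Z))"
  proof (rule stack_cong)
    fix j assume j: "j < k"
    show "(if Suc j < k then ?F j else A k * ?F j) = ?G j * (1\<^sub>m p \<oplus>\<^sub>m Z)"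
    proof (cases "Suc j < k")
      case True
      then have "k - 1 - j = Suc (k - 1 - Suc j)" by auto
      then show ?thesis using True d by (simp add: hcat_block_sum mult_mat_assoc)
    next
      case False
      then have kj: "k - 1 - j = 0" using j by auto
      have "A k * ?F j = hcat (A k * (X * (T ^\<^sub>m j))) (A k * (Y * (Z ^\<^sub>m 0)))"
        unfolding kj using d Ak by (intro mult_hcat) auto
      also have "A k * (Y * (Z ^\<^sub>m 0)) = - ?S * Z" using SY d by simp
      also have "hcat (A k * (X * (T ^\<^sub>m j))) (- ?S * Z) = ?G j * (1\<^sub>m p \<oplus>\<^sub>m Z)"
        using False d Ak by (simp add: hcat_block_sum)
      finally show ?thesis using False by simp
    qed
  qed
  also have "\<dots> = ?\<Psi> * (1\<^sub>m p \<oplus>\<^sub>m Z)" using c by (intro stack_mult[symmetric] G) auto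
  finally have 1: "companion1 m k A * stack m k (p + q) ?F = ?\<Psi> * (1\<^sub>m p \<oplus>\<^sub>m Z)" .
  have "companion0 m k A * stack m k (p + q) ?F = stack m k (p + q)
      (\<lambda>j. if Suc j < k then - ?F (Suc j) else mat_sum m (p + q) (\<lambda>i. A i * ?F i) {..<k})"
    by (rule companion0_mult_stack[OF A F])
  also have "\<dots> = stack m k (p + q) (\<lambda>j. - (?G j * (T \<oplus>\<^sub>m 1\<^sub>m q)))"
  proof (rule stack_cong)
    fix j assume j: "j < k"
    show "(if Suc j < k then - ?F (Suc j) else mat_sum m (p + q) (\<lambda>i. A i * ?F i) {..<k}) =
        - (?G j * (T \<oplus>\<^sub>m 1\<^sub>m q))"
    proof (cases "Suc j < k")
      case True
      then show ?thesis using d by (simp add: hcat_block_sum mult_mat_assoc)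
    next
      case False
      then have jk: "k = Suc j" using j by auto
      have "mat_sum m (p + q) (\<lambda>i. A i * ?F i) {..<k} =
          mat_sum m (p + q) (\<lambda>i. hcat (A i * (X * (T ^\<^sub>m i))) (A i * (Y * (Z ^\<^sub>m (k - 1 - i))))) {..<k}"
        using d Ad by (intro mat_sum_cong refl mult_hcat) auto
      also have "\<dots> = hcat (mat_sum m p (\<lambda>i. A i * (X * (T ^\<^sub>m i))) {..<k}) ?S"
        using c A by (intro mat_sum_hcat) (auto intro!: mult_carrier_mat)
      also have "\<dots> = - hcat (A k * (X * (T ^\<^sub>m k))) (- ?S)"
        unfolding SX using d Ak by (simp add: uminus_hcat)
      also have "A k * (X * (T ^\<^sub>m k)) = A k * (X * (T ^\<^sub>m j)) * T"
        unfolding jk using d Ak[unfolded jk] by (simp add: mult_mat_assoc)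
      also have "hcat (A k * (X * (T ^\<^sub>m j)) * T) (- ?S) = ?G j * (T \<oplus>\<^sub>m 1\<^sub>m q)"
        using False d Ak by (simp add: hcat_block_sum)
      finally show ?thesis using False by simp
    qed
  qed
  also have "\<dots> = - stack m k (p + q) (\<lambda>j. ?G j * (T \<oplus>\<^sub>m 1\<^sub>m q))"
    using c by (intro stack_uminus[symmetric] mult_carrier_mat[OF G]) auto
  also have "stack m k (p + q) (\<lambda>j. ?G j * (T \<oplus>\<^sub>m 1\<^sub>m q)) = ?\<Psi> * (T \<oplus>\<^sub>m 1\<^sub>m q)"
    using c by (intro stack_mult[symmetric] G) auto
  finally have 0: "companion0 m k A * stack m k (p + q) ?F = - (?\<Psi> * (T \<oplus>\<^sub>m 1\<^sub>m q))" .
  show ?thesis by (rule that[of ?\<Psi>]) (simp_all only: \<Phi> 0 1 stack_carrier)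
qed

text \<open>Read row by row, the two equations force the blocks [x_j, y_j] of W to satisfy x_(j+1) =
  x_j T and y_j = y_(j+1) Z, so W is built from the first x and the last y. What remains in the last
  rows are the null equations. Thus every splitting of the companion pencil comes from a null
  pair.\<close>

lemma companion_split_null_pair:
  assumes A: "\<And>i. i \<le> k \<Longrightarrow> A i \<in> carrier_mat m m" and k: "0 < k"
    and T: "T \<in> carrier_mat p p" and Z: "Z \<in> carrier_mat q q"
    and W: "W \<in> carrier_mat (m * k) (p + q)" and U: "U \<in> carrier_mat (m * k) (p + q)"
    and eq1: "companion1 m k A * W = U * (1\<^sub>m p \<oplus>\<^sub>m Z)"
    and eq0: "companion0 m k A * W = - (U * (T \<oplus>\<^sub>m 1\<^sub>m q))"
  obtains X Y where "null_pair m k A p q X Y T Z" "W = controllability_mat m k X Y T Z"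
proof -
  have Ad: "dim_row (A i) = m" "dim_col (A i) = m" if "i \<le> k" for i using A[OF that] by auto
  note Ak = Ad[OF order_refl]
  have "\<exists>x y. block_row m k j * M = hcat x y \<and> x \<in> carrier_mat m p \<and> y \<in> carrier_mat m q"
    if "M \<in> carrier_mat (m * k) (p + q)" for j and M :: "complex mat"
    using hcat_split[of "block_row m k j * M" m p q] that by (metis block_row_carrier mult_carrier_mat)
  note ex = this
  obtain x y where xy: "\<And>j. block_row m k j * W = hcat (x j) (y j)"
    "\<And>j. x j \<in> carrier_mat m p" "\<And>j. y j \<in> carrier_mat m q"
    using ex[OF W] by metis
  obtain u v where uv: "\<And>j. block_row m k j * U = hcat (u j) (v j)"
    "\<And>j. u j \<in> carrier_mat m p" "\<And>j. v j \<in> carrier_mat m q"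
    using ex[OF U] by metis
  have d: "dim_row (x j) = m" "dim_col (x j) = p" "dim_row (y j) = m" "dim_col (y j) = q"
     "dim_row (u j) = m" "dim_col (u j) = p" "dim_row (v j) = m" "dim_col (v j) = q" for j
    using xy(2,3)[of j] uv(2,3)[of j] by auto
  let ?lead = "\<lambda>j. if Suc j < k then hcat (x j) (y j) else A k * hcat (x j) (y j)"
    and ?rest = "\<lambda>j. if Suc j < k then - hcat (x (Suc j)) (y (Suc j))
      else mat_sum m (p + q) (\<lambda>i. A i * hcat (x i) (y i)) {..<k}"
  note dT = carrier_matD[OF T] carrier_matD[OF Z]
  have Ws: "W = stack m k (p + q) (\<lambda>j. hcat (x j) (y j))"
    using stack_block_rows[OF W] unfolding xy(1) by simp
  have Us: "U = stack m k (p + q) (\<lambda>j. hcat (u j) (v j))"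
    using stack_block_rows[OF U] unfolding uv(1) by simp
  have xyc: "hcat (x j) (y j) \<in> carrier_mat m (p + q)" for j using xy by auto
  have uvc: "hcat (u j) (v j) \<in> carrier_mat m (p + q)" for j using uv by auto
  have E1: "?lead j = hcat (u j) (v j * Z)"
    if "j < k" for j
  proof -
    have "stack m k (p + q) ?lead =
        stack m k (p + q) (\<lambda>j. hcat (u j) (v j) * (1\<^sub>m p \<oplus>\<^sub>m Z))"
    proof -
      have "stack m k (p + q) ?lead =
          companion1 m k A * W"
        unfolding Ws by (rule companion1_mult_stack[OF A xyc, symmetric])
      also have "\<dots> = stack m k (p + q) (\<lambda>j. hcat (u j) (v j) * (1\<^sub>m p \<oplus>\<^sub>m Z))"
        unfolding eq1 Us using Z by (intro stack_mult uvc) auto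
      finally show ?thesis .
    qed
    from stack_eqD[OF this that]
    have "?lead j =
        hcat (u j) (v j) * (1\<^sub>m p \<oplus>\<^sub>m Z)"
      using xyc[of j] mult_carrier_mat[OF A[OF order_refl] xyc[of j]]
        mult_carrier_mat[OF uvc[of j] block_sum_carrier[OF one_carrier_mat Z]] by presburger
    also have "\<dots> = hcat (u j) (v j * Z)"
      using d[of j] dT by (simp add: hcat_block_sum)
    finally show ?thesis .
  qed
  have E0: "?rest j = - hcat (u j * T) (v j)"
    if "j < k" for j
  proof -
    have c: "hcat (u j) (v j) * (T \<oplus>\<^sub>m 1\<^sub>m q) \<in> carrier_mat m (p + q)" for j
      by (rule mult_carrier_mat[OF uvc]) (use T in auto)
    have "- (U * (T \<oplus>\<^sub>m 1\<^sub>m q)) = stack m k (p + q) (\<lambda>j. - (hcat (u j) (v j) * (T \<oplus>\<^sub>m 1\<^sub>m q)))"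
      unfolding Us using T c by (subst stack_mult[OF uvc]) (auto intro!: stack_uminus)
    moreover have "stack m k (p + q) ?rest = companion0 m k A * W"
      unfolding Ws by (rule companion0_mult_stack[OF A xyc, symmetric])
    ultimately have "stack m k (p + q) ?rest =
        stack m k (p + q) (\<lambda>j. - (hcat (u j) (v j) * (T \<oplus>\<^sub>m 1\<^sub>m q)))"
      unfolding eq0 by simp
    from stack_eqD[OF this that]
    have "?rest j =
        - (hcat (u j) (v j) * (T \<oplus>\<^sub>m 1\<^sub>m q))"
      using uminus_carrier_mat[OF xyc[of "Suc j"]] uminus_carrier_mat[OF c[of j]] mat_sum_carrier
      by presburger
    also have "hcat (u j) (v j) * (T \<oplus>\<^sub>m 1\<^sub>m q) = hcat (u j * T) (v j)"
      using d[of j] dT by (simp add: hcat_block_sum)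
    finally show ?thesis .
  qed
  have xs: "x (Suc j) = x j * T" and ys: "y j = y (Suc j) * Z" if "Suc j < k" for j
  proof -
    have 1: "hcat (x j) (y j) = hcat (u j) (v j * Z)" using E1[of j] that by simp
    have "- hcat (x (Suc j)) (y (Suc j)) = - hcat (u j * T) (v j)" using E0[of j] that by simp
    then have 2: "hcat (x (Suc j)) (y (Suc j)) = hcat (u j * T) (v j)" by simp
    from hcat_eqD[OF 1] hcat_eqD[OF 2] d dT
    show "x (Suc j) = x j * T" "y j = y (Suc j) * Z" by auto
  qed
  define X where "X = x 0"
  define Y where "Y = y (k - 1)"
  have X: "X \<in> carrier_mat m p" and Y: "Y \<in> carrier_mat m q" unfolding X_def Y_def using xy by auto
  have xj: "x j = X * (T ^\<^sub>m j)" if "j < k" for j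
    using that
  proof (induction j)
    case 0
    then show ?case using X T unfolding X_def by simp
  next
    case (Suc j)
    then show ?case using xs[of j] X dT by (simp add: mult_mat_assoc)
  qed
  \<comment> \<open>The recursion for y runs backwards, so the induction counts the distance from
    the last block.\<close>
  have yj: "y (k - 1 - j) = Y * (Z ^\<^sub>m j)" if "j < k" for j
    using that
  proof (induction j)
    case 0
    then show ?case using Y Z unfolding Y_def by simp
  next
    case (Suc j)
    have "y (k - 1 - Suc j) = y (k - 1 - j) * Z"
      using ys[of "k - 1 - Suc j"] Suc.prems by (simp add: Suc_diff_Suc)
    then show ?case using Suc Y dT by (simp add: mult_mat_assoc)
  qed
  have yj': "y j = Y * (Z ^\<^sub>m (k - 1 - j))" if "j < k" for j
    using yj[of "k - 1 - j"] that by (simp add: Suc_leI)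
  \<comment> \<open>The last rows of both equations: eliminating the blocks u and v of U between
    them yields the null equations.\<close>
  have "hcat (A k * x (k - 1)) (A k * Y) = hcat (u (k - 1)) (v (k - 1) * Z)"
    using E1[of "k - 1"] k d Ak unfolding Y_def by (simp add: mult_hcat)
  from hcat_eqD[OF this] have l1: "A k * x (k - 1) = u (k - 1)" "A k * Y = v (k - 1) * Z"
    using d Ak Y by auto
  have "mat_sum m (p + q) (\<lambda>i. A i * hcat (x i) (y i)) {..<k} =
      mat_sum m (p + q) (\<lambda>i. hcat (A i * x i) (A i * y i)) {..<k}"
    using d Ad by (intro mat_sum_cong refl mult_hcat) auto
  also have "\<dots> = hcat (mat_sum m p (\<lambda>i. A i * x i) {..<k}) (mat_sum m q (\<lambda>i. A i * y i) {..<k})"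
    by (intro mat_sum_hcat mult_carrier_mat[OF A] xy(2,3)) auto
  finally have "hcat (mat_sum m p (\<lambda>i. A i * x i) {..<k}) (mat_sum m q (\<lambda>i. A i * y i) {..<k}) =
      hcat (- (u (k - 1) * T)) (- v (k - 1))"
    using E0[of "k - 1"] k d dT by (simp add: uminus_hcat)
  from hcat_eqD[OF this] have l0: "mat_sum m p (\<lambda>i. A i * x i) {..<k} = - (u (k - 1) * T)"
      "mat_sum m q (\<lambda>i. A i * y i) {..<k} = - v (k - 1)"
    using d dT by auto
  have "null_pair m k A p q X Y T Z"
    unfolding null_pair_def
  proof (intro conjI X Y T Z)
    have xk: "x (k - 1) * T = X * (T ^\<^sub>m k)"
      using xj[of "k - 1"] k X dT by (cases k) (auto simp: mult_mat_assoc)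
    have "mat_sum m p (\<lambda>i. A i * X * (T ^\<^sub>m i)) {..k} =
        mat_sum m p (\<lambda>i. A i * X * (T ^\<^sub>m i)) {..<k} + A k * X * (T ^\<^sub>m k)"
      using A[of k] X T by (intro mat_sum_atMost) (auto intro!: mult_carrier_mat)
    also have "mat_sum m p (\<lambda>i. A i * X * (T ^\<^sub>m i)) {..<k} = mat_sum m p (\<lambda>i. A i * x i) {..<k}"
      using X dT Ad by (intro mat_sum_cong refl) (simp add: xj mult_mat_assoc)
    also have "\<dots> = - (A k * x (k - 1) * T)" unfolding l0 l1 ..
    also have "A k * x (k - 1) * T = A k * X * (T ^\<^sub>m k)"
      using X dT Ak d xk by (simp add: mult_mat_assoc)
    also have "- (A k * X * (T ^\<^sub>m k)) + A k * X * (T ^\<^sub>m k) = 0\<^sub>m m p"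
      using A[of k] X T by (intro uminus_l_inv_mat) (auto intro!: mult_carrier_mat)
    finally show "mat_sum m p (\<lambda>i. A i * X * (T ^\<^sub>m i)) {..k} = 0\<^sub>m m p" .
    have "mat_sum m q (\<lambda>i. A i * Y * (Z ^\<^sub>m (k - i))) {..k} =
        mat_sum m q (\<lambda>i. A i * Y * (Z ^\<^sub>m (k - i))) {..<k} + A k * Y * (Z ^\<^sub>m (k - k))"
      using A[of k] Y Z by (intro mat_sum_atMost) (auto intro!: mult_carrier_mat)
    also have "mat_sum m q (\<lambda>i. A i * Y * (Z ^\<^sub>m (k - i))) {..<k} = mat_sum m q (\<lambda>i. A i * y i * Z) {..<k}"
    proof (rule mat_sum_cong[OF refl])
      fix i assume "i \<in> {..<k}"
      then have "k - i = Suc (k - 1 - i)" "i < k" by auto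
      then show "A i * Y * (Z ^\<^sub>m (k - i)) = A i * y i * Z"
        using Y dT Ad[of i] by (simp add: yj' mult_mat_assoc)
    qed
    also have "\<dots> = mat_sum m q (\<lambda>i. A i * y i) {..<k} * Z"
      by (intro mat_sum_mult[symmetric] mult_carrier_mat[OF A] xy(3) Z) auto
    also have "\<dots> = - (A k * Y)" unfolding l0 l1 using d dT by simp
    also have "- (A k * Y) + A k * Y * (Z ^\<^sub>m (k - k)) = 0\<^sub>m m q"
      using A[of k] Y Z by simp
    finally show "mat_sum m q (\<lambda>i. A i * Y * (Z ^\<^sub>m (k - i))) {..k} = 0\<^sub>m m q" .
  qed
  moreover have "W = controllability_mat m k X Y T Z"
    unfolding controllability_mat_stack Ws using X Y by (auto intro!: stack_cong simp: xj yj')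
  ultimately show ?thesis using that by blast
qed

subsection \<open>Jordan chains and partial multiplicities\<close>

text \<open>This is the passage to the conjugate partition: domination of decreasing lists becomes a
  comparison of the numbers of entries of size at least s. The case s = 0 is excluded because the
  default 0 is returned beyond the end of the list.\<close>

lemma le_nth_default_iff:
  fixes xs :: "nat list"
  assumes "sorted_wrt (\<ge>) xs" "0 < s"
  shows "s \<le> nth_default 0 xs i \<longleftrightarrow> i < length (filter (\<lambda>x. s \<le> x) xs)"
  using assms(1)
proof (induction xs arbitrary: i)
  case Nil
  then show ?case using assms(2) by simp
next
  case (Cons x xs)
  show ?case
  proof (cases "s \<le> x")
    case True
    then show ?thesis using Cons by (cases i) auto
  next
    case False
    then have "\<forall>y\<in>set xs. y < s" using Cons.prems by auto
    then have f: "filter (\<lambda>x. s \<le> x) xs = []" by (auto simp: filter_empty_conv)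
    then have "\<not> s \<le> nth_default 0 xs j" for j using Cons by simp
    then show ?thesis using False f by (cases i) auto
  qed
qed

text \<open>The criterion \<open>le_nth_default_iff\<close> is applied with s equal to the i-th
  largest entry of xs; if that entry is 0 there is nothing to show.\<close>

lemma nth_default_rev_sort_mono:
  fixes xs ys :: "nat list"
  assumes "\<And>s. 0 < s \<Longrightarrow> length (filter (\<lambda>x. s \<le> x) xs) \<le> length (filter (\<lambda>x. s \<le> x) ys)"
  shows "nth_default 0 (rev (sort xs)) i \<le> nth_default 0 (rev (sort ys)) i"
proof (cases "nth_default 0 (rev (sort xs)) i = 0")
  case False
  define s where "s = nth_default 0 (rev (sort xs)) i"
  have sw: "sorted_wrt (\<ge>) (rev (sort zs))" for zs :: "nat list"
    by (simp add: sorted_wrt_rev)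
  have len: "length (filter P (rev (sort zs))) = length (filter P zs)" for P and zs :: "nat list"
    by (metis mset_filter mset_rev mset_sort size_mset)
  have "i < length (filter (\<lambda>x. s \<le> x) xs)"
    using le_nth_default_iff[OF sw, of s xs i] False len unfolding s_def by auto
  then have "i < length (filter (\<lambda>x. s \<le> x) ys)" using assms[of s] False unfolding s_def by auto
  then show ?thesis
    using le_nth_default_iff[OF sw, of s ys i] False len unfolding s_def by auto
qed simp

text \<open>For s > 0 and J the Jordan matrix of the list, this is dim ker J^s - dim ker J^(s-1),
  the dimension of J^(s-1) (ker J^s). Below it is characterised as the largest c for which some Y
  with c columns has J^s Y = 0 and J^(s-1) Y left invertible, a form that can be carried along an
  intertwiner.\<close>

definition zero_blocks :: "nat \<Rightarrow> (nat \<times> complex) list \<Rightarrow> nat" where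
  "zero_blocks s js = length (filter (\<lambda>b. snd b = 0 \<and> s \<le> fst b) js)"

lemma pow_mat_Suc_left:
  fixes A :: "'a :: semiring_1 mat"
  assumes "A \<in> carrier_mat n n"
  shows "A ^\<^sub>m (Suc s) = A * A ^\<^sub>m s"
proof (induction s)
  case 0
  then show ?case using assms by simp
next
  case (Suc s)
  have "A ^\<^sub>m Suc (Suc s) = A * A ^\<^sub>m s * A" using Suc by simp
  also have "\<dots> = A * A ^\<^sub>m (Suc s)" using carrier_matD[OF assms] by (simp add: mult_mat_assoc)
  finally show ?case .
qed

lemma intertwine_pow:
  fixes M :: "complex mat"
  assumes "M \<in> carrier_mat n n" "N \<in> carrier_mat c c" "a \<in> carrier_mat n c" "M * a = a * N"
  shows "M ^\<^sub>m s * a = a * N ^\<^sub>m s"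
proof (induction s)
  case 0
  then show ?case using assms by simp
next
  case (Suc s)
  note d = carrier_matD[OF assms(1)] carrier_matD[OF assms(2)] carrier_matD[OF assms(3)]
  have "M ^\<^sub>m Suc s * a = M ^\<^sub>m s * a * N" using d assms(4) by (simp add: mult_mat_assoc)
  then show ?case using Suc d by (simp add: mult_mat_assoc)
qed

text \<open>In a nilpotent block J^(s-1) maps e_(s-1) to e_0, which the first coordinate detects,
  and J^s kills it. A block that is not counted contributes a matrix without columns.\<close>

lemma jordan_block_chain:
  assumes "0 < s"
  shows "\<exists>y h. y \<in> carrier_mat n (zero_blocks s [(n, a)]) \<and> h \<in> carrier_mat (zero_blocks s [(n, a)]) n \<and>
    jordan_block n a ^\<^sub>m s * y = 0\<^sub>m n (zero_blocks s [(n, a)]) \<and>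
    h * (jordan_block n a ^\<^sub>m (s - 1) * y) = 1\<^sub>m (zero_blocks s [(n, a)])"
proof (cases "a = 0 \<and> s \<le> n")
  case True
  then have z: "zero_blocks s [(n, a)] = 1" and a: "a = 0" and n: "s \<le> n" unfolding zero_blocks_def by auto
  let ?y = "mat n 1 (\<lambda>(i, j). if i = s - 1 then 1 else 0) :: complex mat"
  let ?h = "mat 1 n (\<lambda>(i, j). if j = 0 then 1 else 0) :: complex mat"
  have y: "?y \<in> carrier_mat n 1" and h: "?h \<in> carrier_mat 1 n" by auto
  have e: "(jordan_block n 0 ^\<^sub>m t * ?y) $$ (i, 0) = (if i \<le> s - 1 \<and> s - 1 - i = t then 1 else 0)"
    if "i < n" for i t
  proof -
    have "(jordan_block n 0 ^\<^sub>m t * ?y) $$ (i, 0) =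
        (\<Sum>l<n. (if i \<le> l \<and> l - i = t then 1 else 0) * (if l = s - 1 then 1 else 0))"
      using that unfolding jordan_block_zero_pow by (simp add: scalar_prod_def atLeast0LessThan)
    also have "\<dots> = (\<Sum>l<n. if l = s - 1 then (if i \<le> l \<and> l - i = t then 1 else 0) else 0)"
      by (intro sum.cong) auto
    also have "\<dots> = (if i \<le> s - 1 \<and> s - 1 - i = t then 1 else 0)"
      using n assms by (subst sum.delta) auto
    finally show ?thesis .
  qed
  have 1: "jordan_block n 0 ^\<^sub>m s * ?y = 0\<^sub>m n 1"
  proof (rule eq_matI)
    fix i j assume "i < dim_row (0\<^sub>m n 1 :: complex mat)" "j < dim_col (0\<^sub>m n 1 :: complex mat)"
    then show "(jordan_block n 0 ^\<^sub>m s * ?y) $$ (i, j) = 0\<^sub>m n 1 $$ (i, j)"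
      using e[of i s] assms by auto
  qed auto
  have 2: "?h * (jordan_block n 0 ^\<^sub>m (s - 1) * ?y) = 1\<^sub>m 1"
  proof (rule eq_matI)
    fix i j assume "i < dim_row (1\<^sub>m 1 :: complex mat)" "j < dim_col (1\<^sub>m 1 :: complex mat)"
    then have ij: "i = 0" "j = 0" by auto
    have hM: "(?h * M) $$ (0, 0) = M $$ (0, 0)" if M: "M \<in> carrier_mat n 1" for M
    proof -
      have "(?h * M) $$ (0, 0) = (\<Sum>l<n. (if l = 0 then 1 else 0) * M $$ (l, 0))"
        using M by (simp add: scalar_prod_def atLeast0LessThan)
      also have "\<dots> = (\<Sum>l<n. if l = 0 then M $$ (0, 0) else 0)" by (intro sum.cong) auto
      also have "\<dots> = M $$ (0, 0)" using n assms by (subst sum.delta) auto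
      finally show ?thesis .
    qed
    have "(?h * (jordan_block n 0 ^\<^sub>m (s - 1) * ?y)) $$ (0, 0) = 1"
      using hM[OF mult_carrier_mat[OF pow_carrier_mat[OF jordan_block_carrier] y], of 0 "s - 1"]
        e[of 0 "s - 1"] n assms by simp
    then show "(?h * (jordan_block n 0 ^\<^sub>m (s - 1) * ?y)) $$ (i, j) = 1\<^sub>m 1 $$ (i, j)"
      unfolding ij by simp
  qed auto
  show ?thesis unfolding z unfolding a
    by (rule exI[of _ ?y], rule exI[of _ ?h]) (intro conjI y h 1 2)
next
  case False
  then have z: "zero_blocks s [(n, a)] = 0" unfolding zero_blocks_def by auto
  show ?thesis unfolding z
    by (rule exI[of _ "0\<^sub>m n 0"], rule exI[of _ "0\<^sub>m 0 n"]) auto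
qed

lemma zero_blocks_Cons: "zero_blocks s (b # js) = zero_blocks s [b] + zero_blocks s js"
  unfolding zero_blocks_def by simp

text \<open>The chains of the single blocks, one for each counted block, are assembled as block
  sums.\<close>

lemma jordan_matrix_chains:
  assumes "0 < s"
  shows "\<exists>Y H. Y \<in> carrier_mat (sum_list (map fst js)) (zero_blocks s js) \<and>
    H \<in> carrier_mat (zero_blocks s js) (sum_list (map fst js)) \<and>
    jordan_matrix js ^\<^sub>m s * Y = 0\<^sub>m (sum_list (map fst js)) (zero_blocks s js) \<and>
    H * (jordan_matrix js ^\<^sub>m (s - 1) * Y) = 1\<^sub>m (zero_blocks s js)"
proof (induction js)
  case Nil
  show ?case
    by (rule exI[of _ "0\<^sub>m 0 0"], rule exI[of _ "0\<^sub>m 0 0"]) (auto simp: zero_blocks_def intro!: eq_matI)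
next
  case (Cons b js)
  obtain n a where b: "b = (n, a)" by force
  let ?n' = "sum_list (map fst js)"
  let ?c = "zero_blocks s [(n, a)]" and ?c' = "zero_blocks s js"
  let ?B = "jordan_block n a" and ?J = "jordan_matrix js"
  obtain y h where y: "y \<in> carrier_mat n ?c" "h \<in> carrier_mat ?c n"
      "?B ^\<^sub>m s * y = 0\<^sub>m n ?c" "h * (?B ^\<^sub>m (s - 1) * y) = 1\<^sub>m ?c"
    using jordan_block_chain[OF assms, of n a] by blast
  obtain Y H where Y: "Y \<in> carrier_mat ?n' ?c'" "H \<in> carrier_mat ?c' ?n'"
      "?J ^\<^sub>m s * Y = 0\<^sub>m ?n' ?c'" "H * (?J ^\<^sub>m (s - 1) * Y) = 1\<^sub>m ?c'"
    using Cons by blast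
  note d = carrier_matD[OF y(1)] carrier_matD[OF y(2)] carrier_matD[OF Y(1)] carrier_matD[OF Y(2)]
  have pow: "jordan_matrix (b # js) ^\<^sub>m t = (?B ^\<^sub>m t) \<oplus>\<^sub>m (?J ^\<^sub>m t)" for t
    unfolding b jordan_matrix_Cons_block_sum by (rule block_sum_pow) auto
  have "jordan_matrix (b # js) ^\<^sub>m s * (y \<oplus>\<^sub>m Y) = 0\<^sub>m n ?c \<oplus>\<^sub>m 0\<^sub>m ?n' ?c'"
    unfolding pow using d y Y by (simp add: block_sum_mult)
  also have "\<dots> = 0\<^sub>m (n + ?n') (?c + ?c')" unfolding block_sum_def by simp
  finally have 1: "jordan_matrix (b # js) ^\<^sub>m s * (y \<oplus>\<^sub>m Y) = 0\<^sub>m (n + ?n') (?c + ?c')" .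
  have 2: "(h \<oplus>\<^sub>m H) * (jordan_matrix (b # js) ^\<^sub>m (s - 1) * (y \<oplus>\<^sub>m Y)) = 1\<^sub>m (?c + ?c')"
    unfolding pow using d y Y by (simp add: block_sum_mult block_sum_one)
  have "zero_blocks s (b # js) = ?c + ?c'" "sum_list (map fst (b # js)) = n + ?n'"
    using zero_blocks_Cons[of s b js] unfolding b by simp_all
  then show ?case
    using 1 2 block_sum_carrier[OF y(1) Y(1)] block_sum_carrier[OF y(2) Y(2)] by metis
qed

text \<open>The hyperplane annihilated by r is parametrised by coordinates: the one at an index j
  with a nonzero entry of r is solved for in terms of the others, and K' reads the others off. If r
  = 0, any j serves.\<close>

lemma row_annihilator:
  fixes r :: "complex mat"
  assumes r: "r \<in> carrier_mat 1 (Suc c)"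
  obtains K K' where "K \<in> carrier_mat (Suc c) c" "K' \<in> carrier_mat c (Suc c)"
    "r * K = 0\<^sub>m 1 c" "K' * K = 1\<^sub>m c"
proof -
  obtain j where j: "j < Suc c" "r $$ (0, j) = 0 \<Longrightarrow> r = 0\<^sub>m 1 (Suc c)"
  proof (cases "\<exists>j<Suc c. r $$ (0, j) \<noteq> 0")
    case True
    then show ?thesis using that by blast
  next
    case False
    then have "r = 0\<^sub>m 1 (Suc c)" using r by (intro eq_matI) auto
    then show ?thesis using that[of 0] by simp
  qed
  \<comment> \<open>The increasing enumeration of the indices other than j.\<close>
  define f where "f y = (if y < j then y else Suc y)" for y
  have f: "f y < Suc c" "f y \<noteq> j" if "y < c" for y using that unfolding f_def by auto
  have inj: "f y = f z \<longleftrightarrow> y = z" for y z unfolding f_def by auto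
  let ?K = "mat (Suc c) c (\<lambda>(x, y). if x = j then - r $$ (0, f y) / r $$ (0, j)
      else if x = f y then 1 else 0)"
  let ?K' = "mat c (Suc c) (\<lambda>(y, x). if x = f y then 1 else 0) :: complex mat"
  have "r * ?K = 0\<^sub>m 1 c"
  proof (cases "r $$ (0, j) = 0")
    case True
    then show ?thesis using j(2) by simp
  next
    case False
    show ?thesis
    proof (rule eq_matI)
      fix i y assume "i < dim_row (0\<^sub>m 1 c :: complex mat)" "y < dim_col (0\<^sub>m 1 c :: complex mat)"
      then have iy: "i = 0" "y < c" by auto
      have "(r * ?K) $$ (0, y) = (\<Sum>x<Suc c. r $$ (0, x) * (if x = j then - r $$ (0, f y) / r $$ (0, j)
          else if x = f y then 1 else 0))"
        using r iy by (simp add: scalar_prod_def atLeast0LessThan del: sum.lessThan_Suc)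
      also have "\<dots> = (\<Sum>x<Suc c. (if x = j then - r $$ (0, f y) else 0) +
          (if x = f y then r $$ (0, f y) else 0))"
        using False f[OF iy(2)] by (intro sum.cong) auto
      also have "\<dots> = 0"
        unfolding sum.distrib using j(1) f[OF iy(2)] by (simp add: sum.delta del: sum.lessThan_Suc)
      finally show "(r * ?K) $$ (i, y) = 0\<^sub>m 1 c $$ (i, y)" using iy by simp
    qed (use r in auto)
  qed
  moreover have "?K' * ?K = 1\<^sub>m c"
  proof (rule eq_matI)
    fix y z assume "y < dim_row (1\<^sub>m c :: complex mat)" "z < dim_col (1\<^sub>m c :: complex mat)"
    then have yz: "y < c" "z < c" by auto
    have "(?K' * ?K) $$ (y, z) = (\<Sum>x<Suc c. (if x = f y then 1 else 0) * ?K $$ (x, z))"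
      using yz by (simp add: scalar_prod_def atLeast0LessThan del: sum.lessThan_Suc)
    also have "\<dots> = (\<Sum>x<Suc c. if x = f y then ?K $$ (f y, z) else 0)"
      by (intro sum.cong) auto
    also have "\<dots> = ?K $$ (f y, z)" using f[OF yz(1)] by (simp del: sum.lessThan_Suc)
    also have "\<dots> = (if y = z then 1 else 0)" using f[OF yz(1)] yz inj by simp
    finally show "(?K' * ?K) $$ (y, z) = 1\<^sub>m c $$ (y, z)" using yz by simp
  qed auto
  ultimately show ?thesis using that[of ?K ?K'] by auto
qed

text \<open>There are two ways of not being counted: a nilpotent block of size at most s - 1 has
  vanishing power s - 1, and a block with nonzero eigenvalue is invertible and can be cancelled from
  the equation.\<close>

lemma jordan_block_uncounted:
  assumes s: "0 < s" and nc: "\<not> (a = 0 \<and> s \<le> n)" and y: "y \<in> carrier_mat n c"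
    and eq: "jordan_block n (a :: complex) ^\<^sub>m s * y = 0\<^sub>m n c"
  shows "jordan_block n a ^\<^sub>m (s - 1) * y = 0\<^sub>m n c"
proof (cases "a = 0")
  case True
  then have "n \<le> s - 1" using nc by auto
  then have "jordan_block n a ^\<^sub>m (s - 1) = 0\<^sub>m n n"
    unfolding True jordan_block_zero_pow by (intro eq_matI) auto
  then show ?thesis using y by simp
next
  case False
  have B: "jordan_block n a \<in> carrier_mat n n" by simp
  have "det (jordan_block n a) = prod_list (diag_mat (jordan_block n a))"
    by (rule det_upper_triangular[OF _ B]) (auto simp: jordan_block_def)
  also have "\<dots> \<noteq> 0" using False by (auto simp: diag_mat_def prod_list_zero_iff)
  finally obtain B' where B': "inverse_mats n (jordan_block n a) B'"
    using det_imp_inverse_mats[OF B] by blast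
  let ?w = "jordan_block n a ^\<^sub>m (s - 1) * y"
  have "jordan_block n a * ?w = jordan_block n a ^\<^sub>m s * y"
    using s y pow_mat_Suc_left[OF B, of "s - 1"] by (simp add: mult_mat_assoc)
  then have "?w = B' * 0\<^sub>m n c"
    using inverse_mats_cancel(2)[OF B', of ?w] unfolding eq by simp
  then show ?thesis using inverse_matsD[OF B'] by simp
qed

text \<open>The kernel of the nilpotent block is spanned by e_0, so only the first row of w can be
  nonzero and h * w is an outer product.\<close>

lemma jordan_block_kernel_rank_one:
  fixes h w :: "complex mat"
  assumes w: "w \<in> carrier_mat n c" and h: "h \<in> carrier_mat d n"
    and eq: "jordan_block n 0 * w = 0\<^sub>m n c" and n: "0 < n"
  shows "h * w = mat d 1 (\<lambda>(i, j). h $$ (i, 0)) * mat 1 c (\<lambda>(i, j). w $$ (0, j))"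
proof (rule eq_matI)
  have z: "w $$ (Suc l, j) = 0" if "Suc l < n" "j < c" for l j
  proof -
    have "(jordan_block n 0 * w) $$ (l, j) = (\<Sum>x<n. (if l = x then 0 else if Suc l = x then 1 else 0) * w $$ (x, j))"
      using that w by (simp add: scalar_prod_def atLeast0LessThan jordan_block_def)
    also have "\<dots> = (\<Sum>x<n. if x = Suc l then w $$ (Suc l, j) else 0)" by (intro sum.cong) auto
    also have "\<dots> = w $$ (Suc l, j)" using that by simp
    finally show ?thesis unfolding eq using that by simp
  qed
  fix i j assume "i < dim_row (mat d 1 (\<lambda>(i, j). h $$ (i, 0)) * mat 1 c (\<lambda>(i, j). w $$ (0, j)))"
    "j < dim_col (mat d 1 (\<lambda>(i, j). h $$ (i, 0)) * mat 1 c (\<lambda>(i, j). w $$ (0, j)))"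
  then have ij: "i < d" "j < c" by auto
  have "(h * w) $$ (i, j) = (\<Sum>x<n. h $$ (i, x) * w $$ (x, j))"
    using ij w h by (simp add: scalar_prod_def atLeast0LessThan)
  also have "\<dots> = (\<Sum>x<n. if x = 0 then h $$ (i, 0) * w $$ (0, j) else 0)"
  proof (intro sum.cong refl)
    fix x assume "x \<in> {..<n}"
    then show "h $$ (i, x) * w $$ (x, j) = (if x = 0 then h $$ (i, 0) * w $$ (0, j) else 0)"
      using z[of "x - 1" j] ij by (cases x) auto
  qed
  also have "\<dots> = h $$ (i, 0) * w $$ (0, j)" using n by simp
  finally show "(h * w) $$ (i, j) = (mat d 1 (\<lambda>(i, j). h $$ (i, 0)) * mat 1 c (\<lambda>(i, j). w $$ (0, j))) $$ (i, j)"
    using ij by (simp add: scalar_prod_def)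
qed (use w h in auto)

text \<open>Induction over the Jordan blocks: a block has one-dimensional kernel, so a hyperplane of the
  chains misses it.\<close>

lemma chains_le_zero_blocks:
  assumes s: "0 < s"
  shows "Y \<in> carrier_mat (sum_list (map fst js)) c \<Longrightarrow> H \<in> carrier_mat c (sum_list (map fst js)) \<Longrightarrow>
    jordan_matrix js ^\<^sub>m s * Y = 0\<^sub>m (sum_list (map fst js)) c \<Longrightarrow>
    H * (jordan_matrix js ^\<^sub>m (s - 1) * Y) = 1\<^sub>m c \<Longrightarrow> c \<le> zero_blocks s js"
proof (induction js arbitrary: c Y H)
  case Nil
  show ?case
  proof (rule ccontr)
    assume "\<not> c \<le> zero_blocks s []"
    then have c: "0 < c" by (auto simp: zero_blocks_def)
    have "(H * (jordan_matrix [] ^\<^sub>m (s - 1) * Y)) $$ (0, 0) = 0"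
      using Nil(1,2) c by (simp add: scalar_prod_def del: assoc_mult_mat)
    then show False unfolding Nil(4) using c by simp
  qed
next
  case (Cons b js)
  obtain n a where b: "b = (n, a)" by force
  let ?n' = "sum_list (map fst js)"
  let ?B = "jordan_block n a" and ?J = "jordan_matrix js"
  \<comment> \<open>The second block column is empty: writing c + 0 lets the four-block lemmas serve
    for a partition into block rows only. The matrix H is treated likewise, with an empty second
    block row.\<close>
  have "Y \<in> carrier_mat (n + ?n') (c + 0)" using Cons.prems(1) unfolding b by simp
  then obtain y1 y2 Y1 Y2 where Yeq: "Y = four_block_mat y1 y2 Y1 Y2"
    and y: "y1 \<in> carrier_mat n c" "y2 \<in> carrier_mat n 0" "Y1 \<in> carrier_mat ?n' c" "Y2 \<in> carrier_mat ?n' 0"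
    by (rule four_block_split)
  have "H \<in> carrier_mat (c + 0) (n + ?n')" using Cons.prems(2) unfolding b by simp
  then obtain h1 H1 h2 H2 where Heq: "H = four_block_mat h1 H1 h2 H2"
    and h: "h1 \<in> carrier_mat c n" "H1 \<in> carrier_mat c ?n'" "h2 \<in> carrier_mat 0 n" "H2 \<in> carrier_mat 0 ?n'"
    by (rule four_block_split)
  have cB: "?B ^\<^sub>m t \<in> carrier_mat n n" and cJ: "?J ^\<^sub>m t \<in> carrier_mat ?n' ?n'" for t by simp_all
  have pow: "jordan_matrix (b # js) ^\<^sub>m t * Y = four_block_mat (?B ^\<^sub>m t * y1) (?B ^\<^sub>m t * y2)
      (?J ^\<^sub>m t * Y1) (?J ^\<^sub>m t * Y2)" for t
  proof -
    have "jordan_matrix (b # js) ^\<^sub>m t = (?B ^\<^sub>m t) \<oplus>\<^sub>m (?J ^\<^sub>m t)"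
      unfolding b jordan_matrix_Cons_block_sum by (rule block_sum_pow) auto
    moreover have "?B ^\<^sub>m t * y1 + 0\<^sub>m n ?n' * Y1 = ?B ^\<^sub>m t * y1"
        "?B ^\<^sub>m t * y2 + 0\<^sub>m n ?n' * Y2 = ?B ^\<^sub>m t * y2"
        "0\<^sub>m ?n' n * y1 + ?J ^\<^sub>m t * Y1 = ?J ^\<^sub>m t * Y1"
        "0\<^sub>m ?n' n * y2 + ?J ^\<^sub>m t * Y2 = ?J ^\<^sub>m t * Y2"
      using mult_carrier_mat[OF cB y(1)] mult_carrier_mat[OF cB y(2)]
        mult_carrier_mat[OF cJ y(3)] mult_carrier_mat[OF cJ y(4)] y
      by (simp_all add: left_add_zero_mat right_add_zero_mat del: One_nat_def)
    moreover have "((?B ^\<^sub>m t) \<oplus>\<^sub>m (?J ^\<^sub>m t)) * Y = four_block_mat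
        (?B ^\<^sub>m t * y1 + 0\<^sub>m n ?n' * Y1) (?B ^\<^sub>m t * y2 + 0\<^sub>m n ?n' * Y2)
        (0\<^sub>m ?n' n * y1 + ?J ^\<^sub>m t * Y1) (0\<^sub>m ?n' n * y2 + ?J ^\<^sub>m t * Y2)"
      unfolding Yeq block_sum_def carrier_matD[OF cB] carrier_matD[OF cJ]
      by (rule mult_four_block_mat[OF cB zero_carrier_mat zero_carrier_mat cJ y])
    ultimately show ?thesis by metis
  qed
  have "four_block_mat (?B ^\<^sub>m s * y1) (?B ^\<^sub>m s * y2) (?J ^\<^sub>m s * Y1) (?J ^\<^sub>m s * Y2) =
      four_block_mat (0\<^sub>m n c) (0\<^sub>m n 0) (0\<^sub>m ?n' c) (0\<^sub>m ?n' 0)"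
    unfolding pow[symmetric] Cons.prems(3) by (simp add: b)
  note ker = four_block_eqD[OF this mult_carrier_mat[OF cB y(1)] mult_carrier_mat[OF cB y(2)]
      mult_carrier_mat[OF cJ y(3)] mult_carrier_mat[OF cJ y(4)] zero_carrier_mat zero_carrier_mat
      zero_carrier_mat zero_carrier_mat]
  let ?w = "?B ^\<^sub>m (s - 1) * y1" and ?v = "?J ^\<^sub>m (s - 1) * Y1"
  have w: "?w \<in> carrier_mat n c" and v: "?v \<in> carrier_mat ?n' c"
    using mult_carrier_mat[OF cB y(1)] mult_carrier_mat[OF cJ y(3)] by auto
  have "four_block_mat (h1 * ?w + H1 * ?v) (h1 * (?B ^\<^sub>m (s - 1) * y2) + H1 * (?J ^\<^sub>m (s - 1) * Y2))
      (h2 * ?w + H2 * ?v) (h2 * (?B ^\<^sub>m (s - 1) * y2) + H2 * (?J ^\<^sub>m (s - 1) * Y2)) =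
      H * (jordan_matrix (b # js) ^\<^sub>m (s - 1) * Y)"
    unfolding pow Heq using y h by (subst four_block_mult) auto
  also have "\<dots> = four_block_mat (1\<^sub>m c) (0\<^sub>m c 0) (0\<^sub>m 0 c) (1\<^sub>m 0)"
    unfolding Cons.prems(4) by simp
  finally have id: "h1 * ?w + H1 * ?v = 1\<^sub>m c"
    by (rule four_block_eqD(1)[OF _ add_carrier_mat[OF mult_carrier_mat[OF h(2) v]]
        add_carrier_mat[OF mult_carrier_mat[OF h(2) mult_carrier_mat[OF cJ y(4)]]]
        add_carrier_mat[OF mult_carrier_mat[OF h(4) v]]
        add_carrier_mat[OF mult_carrier_mat[OF h(4) mult_carrier_mat[OF cJ y(4)]]]
        one_carrier_mat zero_carrier_mat zero_carrier_mat one_carrier_mat])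
  show ?case
  proof (cases "a = 0 \<and> s \<le> n")
    case False
    have "?w = 0\<^sub>m n c" by (rule jordan_block_uncounted[OF s False y(1) ker(1)])
    then have "H1 * ?v = 1\<^sub>m c" using id h v mult_carrier_mat[OF h(2) v] by simp
    from Cons.IH[OF y(3) h(2) ker(3) this] show ?thesis unfolding zero_blocks_Cons[of s b js] by simp
  next
    case True
    then have zb: "zero_blocks s (b # js) = Suc (zero_blocks s js)"
      unfolding zero_blocks_def b by simp
    show ?thesis
    proof (cases c)
      case (Suc c')
      have B: "jordan_block n a \<in> carrier_mat n n" by simp
      have "jordan_block n 0 * ?w = 0\<^sub>m n c"
        using s y ker(1) True pow_mat_Suc_left[OF B, of "s - 1"] by (simp add: mult_mat_assoc)
      from jordan_block_kernel_rank_one[OF w h(1) this] True s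
      obtain l r where lr: "h1 * ?w = l * r" "l \<in> carrier_mat c 1" "r \<in> carrier_mat 1 c" by fastforce
      \<comment> \<open>The counted block enters the identity h1 w + H1 v = 1 through the rank one
        matrix l * r. Restricting to the c - 1 independent combinations of chains killed by r
        removes it, and the left inverse K' of K turns what is left into an instance of the
        induction hypothesis.\<close>
      obtain K K' where K: "K \<in> carrier_mat c c'" "K' \<in> carrier_mat c' c" "r * K = 0\<^sub>m 1 c'" "K' * K = 1\<^sub>m c'"
        using row_annihilator lr(3) unfolding Suc by metis
      have "K = (h1 * ?w + H1 * ?v) * K" unfolding id using K by simp
      also have "\<dots> = l * r * K + H1 * ?v * K"
        unfolding lr(1)[symmetric]
        by (rule add_mult_distrib_mat[OF mult_carrier_mat[OF h(1) w] mult_carrier_mat[OF h(2) v] K(1)])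
      also have "l * r * K = 0\<^sub>m c c'"
        using lr(2,3) K by (simp add: mult_mat_assoc)
      also have "0\<^sub>m c c' + H1 * ?v * K = H1 * ?v * K"
        by (rule left_add_zero_mat[OF mult_carrier_mat[OF mult_carrier_mat[OF h(2) v] K(1)]])
      finally have KK: "K = H1 * ?v * K" .
      have e1: "?J ^\<^sub>m s * (Y1 * K) = 0\<^sub>m ?n' c'"
      proof -
        have "?J ^\<^sub>m s * (Y1 * K) = ?J ^\<^sub>m s * Y1 * K"
          using y K by (intro mult_mat_assoc[symmetric]) auto
        then show ?thesis unfolding ker(3) using K by simp
      qed
      have e2: "K' * H1 * (?J ^\<^sub>m (s - 1) * (Y1 * K)) = 1\<^sub>m c'"
      proof -
        have "K' * H1 * (?J ^\<^sub>m (s - 1) * (Y1 * K)) = K' * (H1 * ?v * K)"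
          using carrier_matD[OF y(3)] carrier_matD[OF h(2)] carrier_matD[OF K(1)] carrier_matD[OF K(2)]
          by (simp add: mult_mat_assoc)
        then show ?thesis unfolding KK[symmetric] K(4) .
      qed
      have "c' \<le> zero_blocks s js"
        by (rule Cons.IH[OF mult_carrier_mat[OF y(3) K(1)] mult_carrier_mat[OF K(2) h(2)] e1 e2])
      then show ?thesis unfolding zb Suc by simp
    qed simp
  qed
qed

lemma jordan_matrix_shift:
  fixes js :: "(nat \<times> complex) list"
  shows "jordan_matrix (map (\<lambda>(n, a). (n, a - e)) js) =
    jordan_matrix js - e \<cdot>\<^sub>m 1\<^sub>m (sum_list (map fst js))"
proof (induction js)
  case Nil
  then show ?case by (intro eq_matI) auto
next
  case (Cons b js)
  obtain n a where b: "b = (n, a)" by force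
  have "jordan_block n (a - e) = jordan_block n a - e \<cdot>\<^sub>m 1\<^sub>m n"
    unfolding jordan_block_def by (intro eq_matI) auto
  then show ?case
    unfolding b using Cons
    by (auto simp: jordan_matrix_Cons_block_sum index_block_sum intro!: eq_matI)
qed

text \<open>Chains are carried along: if Y is a family of chains for js', then a * Y is one for js,
  since powers intertwine as well, and H * g detects it because g * a is the identity. Then
  \<open>chains_le_zero_blocks\<close> bounds their number.\<close>

lemma jordan_intertwine_blocks_le:
  fixes js js' :: "(nat \<times> complex) list"
  assumes s: "0 < s"
    and a: "a \<in> carrier_mat (sum_list (map fst js)) (sum_list (map fst js'))"
    and g: "g \<in> carrier_mat (sum_list (map fst js')) (sum_list (map fst js))"
    and ga: "g * a = 1\<^sub>m (sum_list (map fst js'))"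
    and eq: "jordan_matrix js * a = a * jordan_matrix js'"
  shows "zero_blocks s js' \<le> zero_blocks s js"
proof -
  let ?n = "sum_list (map fst js)" and ?n' = "sum_list (map fst js')" and ?c = "zero_blocks s js'"
  obtain Y H where Y: "Y \<in> carrier_mat ?n' ?c" and H: "H \<in> carrier_mat ?c ?n'"
    and JY: "jordan_matrix js' ^\<^sub>m s * Y = 0\<^sub>m ?n' ?c"
    and HJ: "H * (jordan_matrix js' ^\<^sub>m (s - 1) * Y) = 1\<^sub>m ?c"
    using jordan_matrix_chains[OF s] by blast
  note d = carrier_matD[OF a] carrier_matD[OF g] carrier_matD[OF Y] carrier_matD[OF H]
  have pow: "jordan_matrix js ^\<^sub>m t * (a * Y) = a * (jordan_matrix js' ^\<^sub>m t * Y)" for t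
  proof -
    have "jordan_matrix js ^\<^sub>m t * (a * Y) = jordan_matrix js ^\<^sub>m t * a * Y"
      using d by (intro mult_mat_assoc[symmetric]) auto
    also have "\<dots> = a * jordan_matrix js' ^\<^sub>m t * Y"
      unfolding intertwine_pow[OF jordan_matrix_carrier jordan_matrix_carrier a eq] ..
    also have "\<dots> = a * (jordan_matrix js' ^\<^sub>m t * Y)" using d by (intro mult_mat_assoc) auto
    finally show ?thesis .
  qed
  have "H * g * (jordan_matrix js ^\<^sub>m (s - 1) * (a * Y)) = H * (g * a) * (jordan_matrix js' ^\<^sub>m (s - 1) * Y)"
    unfolding pow using d by (simp add: mult_mat_assoc)
  also have "\<dots> = 1\<^sub>m ?c" unfolding ga using d HJ by simp
  finally show ?thesis
    using a by (intro chains_le_zero_blocks[OF s mult_carrier_mat[OF a Y] mult_carrier_mat[OF H g]])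
      (simp_all add: pow JY)
qed

text \<open>Subtracting e from both Jordan matrices preserves the intertwining and moves the
  eigenvalue e to 0, where blocks are counted.\<close>

lemma jordan_intertwine_partial_mults:
  fixes js js' :: "(nat \<times> complex) list"
  assumes a: "a \<in> carrier_mat (sum_list (map fst js)) (sum_list (map fst js'))"
    and g: "g \<in> carrier_mat (sum_list (map fst js')) (sum_list (map fst js))"
    and ga: "g * a = 1\<^sub>m (sum_list (map fst js'))"
    and eq: "jordan_matrix js * a = a * jordan_matrix js'"
  shows "nth_default 0 (rev (sort (map fst (filter (\<lambda>b. snd b = e) js')))) i
    \<le> nth_default 0 (rev (sort (map fst (filter (\<lambda>b. snd b = e) js)))) i"
proof (rule nth_default_rev_sort_mono)
  fix s :: nat assume s: "0 < s"
  let ?sh = "map (\<lambda>(n, a). (n, a - e)) :: (nat \<times> complex) list \<Rightarrow> (nat \<times> complex) list"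
  have sz: "sum_list (map fst (?sh xs)) = sum_list (map fst xs)" for xs by (induction xs) auto
  have cnt: "zero_blocks s (?sh xs) = length (filter (\<lambda>x. s \<le> x) (map fst (filter (\<lambda>b. snd b = e) xs)))" for xs
    unfolding zero_blocks_def by (induction xs) auto
  have J: "jordan_matrix js \<in> carrier_mat (sum_list (map fst js)) (sum_list (map fst js))"
    and J': "jordan_matrix js' \<in> carrier_mat (sum_list (map fst js')) (sum_list (map fst js'))" by auto
  have "jordan_matrix (?sh js) * a = jordan_matrix js * a - e \<cdot>\<^sub>m 1\<^sub>m (sum_list (map fst js)) * a"
    unfolding jordan_matrix_shift by (rule minus_mult_distrib_mat[OF J _ a]) auto
  also have "e \<cdot>\<^sub>m 1\<^sub>m (sum_list (map fst js)) * a = a * (e \<cdot>\<^sub>m 1\<^sub>m (sum_list (map fst js')))"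
    using mult_smult_assoc_mat[OF one_carrier_mat a, of e] mult_smult_distrib[OF a one_carrier_mat, of e] a
    by simp
  also have "jordan_matrix js * a - \<dots> = a * jordan_matrix (?sh js')"
    unfolding jordan_matrix_shift eq by (rule mult_minus_distrib_mat[OF a J', symmetric]) auto
  finally have "zero_blocks s (?sh js') \<le> zero_blocks s (?sh js)"
    using jordan_intertwine_blocks_le[OF s, of a "?sh js" "?sh js'" g] a g ga unfolding sz by blast
  then show "length (filter (\<lambda>x. s \<le> x) (map fst (filter (\<lambda>b. snd b = e) js')))
      \<le> length (filter (\<lambda>x. s \<le> x) (map fst (filter (\<lambda>b. snd b = e) js)))"
    unfolding cnt .
qed

subsection \<open>Pencils and right factors\<close>

lemma dim_const_mat [simp]: "dim_row (const_mat A) = dim_row A" "dim_col (const_mat A) = dim_col A"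
  unfolding const_mat_def by simp_all

lemma const_mat_carrier [simp]: "const_mat A \<in> carrier_mat r c \<longleftrightarrow> A \<in> carrier_mat r c"
  unfolding const_mat_def by simp

lemma const_mat_mult:
  assumes "A \<in> carrier_mat r n" "B \<in> carrier_mat n c"
  shows "const_mat (A * B) = const_mat A * const_mat B"
proof -
  interpret semiring_hom "\<lambda>a :: complex. [:a:]" by unfold_locales auto
  show ?thesis unfolding const_mat_def by (rule mat_hom_mult[OF assms])
qed

lemma pencil_carrier [simp]:
  "C \<in> carrier_mat r c \<Longrightarrow> D \<in> carrier_mat r c \<Longrightarrow> pencil C D \<in> carrier_mat r c"
  unfolding pencil_def by auto

lemma dim_pencil [simp]: "dim_row (pencil C D) = dim_row D" "dim_col (pencil C D) = dim_col D"
  unfolding pencil_def by auto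

lemma index_pencil:
  assumes "C \<in> carrier_mat r c" "D \<in> carrier_mat r c" "i < r" "j < c"
  shows "pencil C D $$ (i, j) = [:D $$ (i, j), C $$ (i, j):]"
  using assms unfolding pencil_def const_mat_def by simp

lemma const_mat_mult_pencil:
  assumes "G \<in> carrier_mat r n" "C \<in> carrier_mat n c" "D \<in> carrier_mat n c"
  shows "const_mat G * pencil C D = pencil (G * C) (G * D)"
proof -
  have c: "const_mat G \<in> carrier_mat r n" "const_mat C \<in> carrier_mat n c" "const_mat D \<in> carrier_mat n c"
    using assms by auto
  show ?thesis
    unfolding pencil_def const_mat_mult[OF assms(1,2)] const_mat_mult[OF assms(1,3)]
    using mult_add_distrib_mat[OF c(1) smult_carrier_mat[OF c(2)] c(3)] mult_smult_distrib[OF c(1,2)]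
    by simp
qed

lemma pencil_mult_const_mat:
  assumes "C \<in> carrier_mat r n" "D \<in> carrier_mat r n" "G \<in> carrier_mat n c"
  shows "pencil C D * const_mat G = pencil (C * G) (D * G)"
proof -
  have c: "const_mat C \<in> carrier_mat r n" "const_mat D \<in> carrier_mat r n" "const_mat G \<in> carrier_mat n c"
    using assms by auto
  show ?thesis
    unfolding pencil_def const_mat_mult[OF assms(1,3)] const_mat_mult[OF assms(2,3)]
    using add_mult_distrib_mat[OF smult_carrier_mat[OF c(1)] c(2,3)] mult_smult_assoc_mat[OF c(1,3)]
    by simp
qed

lemma pencil_block_sum:
  assumes "C \<in> carrier_mat p p'" "D \<in> carrier_mat p p'" "C' \<in> carrier_mat q q'" "D' \<in> carrier_mat q q'"
  shows "pencil C D \<oplus>\<^sub>m pencil C' D' = pencil (C \<oplus>\<^sub>m C') (D \<oplus>\<^sub>m D')"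
proof (rule eq_matI)
  fix i j assume "i < dim_row (pencil (C \<oplus>\<^sub>m C') (D \<oplus>\<^sub>m D'))" "j < dim_col (pencil (C \<oplus>\<^sub>m C') (D \<oplus>\<^sub>m D'))"
  then have ij: "i < p + q" "j < p' + q'" using assms by auto
  note d = assms[THEN carrier_matD(1)] assms[THEN carrier_matD(2)]
  have "pencil (C \<oplus>\<^sub>m C') (D \<oplus>\<^sub>m D') $$ (i, j) = [:(D \<oplus>\<^sub>m D') $$ (i, j), (C \<oplus>\<^sub>m C') $$ (i, j):]"
    using assms ij by (intro index_pencil) auto
  moreover have "(pencil C D \<oplus>\<^sub>m pencil C' D') $$ (i, j) = [:(D \<oplus>\<^sub>m D') $$ (i, j), (C \<oplus>\<^sub>m C') $$ (i, j):]"
    using ij d index_pencil[OF assms(1,2), of i j] index_pencil[OF assms(3,4), of "i - p" "j - p'"]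
    by (simp add: index_block_sum)
  ultimately show "(pencil C D \<oplus>\<^sub>m pencil C' D') $$ (i, j) = pencil (C \<oplus>\<^sub>m C') (D \<oplus>\<^sub>m D') $$ (i, j)"
    by simp
qed (use assms in auto)

lemma poly_det_hom: "poly (det M) \<alpha> = det (map_mat (\<lambda>p. poly p \<alpha>) (M :: complex poly mat))"
proof -
  have "comm_ring_hom (\<lambda>p :: complex poly. poly p \<alpha>)" by unfold_locales auto
  from comm_ring_hom.hom_det[OF this, of M] show ?thesis ..
qed

lemma poly_det_pencil:
  assumes "C \<in> carrier_mat n n" "D \<in> carrier_mat n n"
  shows "poly (det (pencil C D)) \<alpha> = det (\<alpha> \<cdot>\<^sub>m C + D)"
proof -
  have "map_mat (\<lambda>p. poly p \<alpha>) (pencil C D) = \<alpha> \<cdot>\<^sub>m C + D"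
  proof (rule eq_matI)
    fix i j assume "i < dim_row (\<alpha> \<cdot>\<^sub>m C + D)" "j < dim_col (\<alpha> \<cdot>\<^sub>m C + D)"
    then have "i < n" "j < n" using assms by auto
    then show "map_mat (\<lambda>p. poly p \<alpha>) (pencil C D) $$ (i, j) = (\<alpha> \<cdot>\<^sub>m C + D) $$ (i, j)"
      using assms index_pencil[OF assms, of i j] by (simp add: add.commute)
  qed (use assms in auto)
  then show ?thesis using poly_det_hom[of "pencil C D" \<alpha>] by simp
qed

lemma regular_pencil_iff:
  assumes "C \<in> carrier_mat n n" "D \<in> carrier_mat n n"
  shows "regular (pencil C D) \<longleftrightarrow> (\<exists>\<alpha>. det (\<alpha> \<cdot>\<^sub>m C + D) \<noteq> 0)"
  using poly_det_pencil[OF assms] poly_all_0_iff_0[of "det (pencil C D)"] assms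
  unfolding regular_def by auto

lemma regular_matrix_poly:
  assumes A: "\<And>i. i \<le> k \<Longrightarrow> A i \<in> carrier_mat m m" and "regular (matrix_poly m k A)"
  obtains \<alpha> where "det (peval m k A \<alpha>) \<noteq> 0"
proof -
  have "map_mat (\<lambda>p. poly p \<alpha>) (matrix_poly m k A) = peval m k A \<alpha>" for \<alpha>
  proof (rule eq_matI)
    fix i j assume "i < dim_row (peval m k A \<alpha>)" "j < dim_col (peval m k A \<alpha>)"
    then have ij: "i < m" "j < m" unfolding peval_def by auto
    have "(\<alpha> ^ l \<cdot>\<^sub>m A l) $$ (i, j) = A l $$ (i, j) * \<alpha> ^ l" if "l \<le> k" for l
      using A[OF that] ij by simp
    then show "map_mat (\<lambda>p. poly p \<alpha>) (matrix_poly m k A) $$ (i, j) = peval m k A \<alpha> $$ (i, j)"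
      using ij unfolding matrix_poly_def peval_def by (simp add: poly_sum poly_monom)
  qed (auto simp: peval_def matrix_poly_def)
  then have "poly (det (matrix_poly m k A)) \<alpha> = det (peval m k A \<alpha>)" for \<alpha>
    using poly_det_hom[of "matrix_poly m k A" \<alpha>] by simp
  then show ?thesis
    using that assms(2) poly_all_0_iff_0[of "det (matrix_poly m k A)"] unfolding regular_def by metis
qed

section \<open>Coefficient matrices and the recurrence for a cofactor\<close>

definition coeff_mat :: "nat \<Rightarrow> complex poly mat \<Rightarrow> complex mat" where
  "coeff_mat l M = map_mat (\<lambda>p. coeff p l) M"

lemma dim_coeff_mat [simp]: "dim_row (coeff_mat l M) = dim_row M" "dim_col (coeff_mat l M) = dim_col M"
  unfolding coeff_mat_def by simp_all

lemma coeff_mat_carrier [simp]: "coeff_mat l M \<in> carrier_mat r c \<longleftrightarrow> M \<in> carrier_mat r c"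
  unfolding coeff_mat_def by simp

lemma coeff_mat_eqI:
  assumes "M \<in> carrier_mat r c" "N \<in> carrier_mat r c" "\<And>l. coeff_mat l M = coeff_mat l N"
  shows "M = N"
proof (rule eq_matI)
  fix i j assume ij: "i < dim_row N" "j < dim_col N"
  show "M $$ (i, j) = N $$ (i, j)"
  proof (rule poly_eqI)
    fix l
    show "coeff (M $$ (i, j)) l = coeff (N $$ (i, j)) l"
      using arg_cong[OF assms(3)[of l], of "\<lambda>X. X $$ (i, j)"] ij assms(1,2) unfolding coeff_mat_def by simp
  qed
qed (use assms in auto)

lemma coeff_mat_matrix_poly:
  assumes "\<And>i. i \<le> k \<Longrightarrow> A i \<in> carrier_mat m m"
  shows "coeff_mat l (matrix_poly m k A) = (if l \<le> k then A l else 0\<^sub>m m m)"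
proof (rule eq_matI)
  fix i j assume "i < dim_row (if l \<le> k then A l else 0\<^sub>m m m)" "j < dim_col (if l \<le> k then A l else 0\<^sub>m m m)"
  then have ij: "i < m" "j < m" using assms[of l] by (auto split: if_splits)
  have "coeff_mat l (matrix_poly m k A) $$ (i, j) = (\<Sum>x\<le>k. if x = l then A x $$ (i, j) else 0)"
    using ij unfolding coeff_mat_def matrix_poly_def by (simp add: coeff_sum)
  then show "coeff_mat l (matrix_poly m k A) $$ (i, j) = (if l \<le> k then A l else 0\<^sub>m m m) $$ (i, j)"
    using ij by auto
qed (use assms[of l] in \<open>auto simp: matrix_poly_def\<close>)

lemma matrix_poly_carrier [simp]: "matrix_poly m k A \<in> carrier_mat m m"
  unfolding matrix_poly_def by simp

lemma coeff_mat_mult_pencil: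
  assumes Q: "Q \<in> carrier_mat r n" and C: "C \<in> carrier_mat n c" and D: "D \<in> carrier_mat n c"
  shows "coeff_mat 0 (Q * pencil C D) = coeff_mat 0 Q * D"
    and "coeff_mat (Suc l) (Q * pencil C D) = coeff_mat l Q * C + coeff_mat (Suc l) Q * D"
proof -
  have e: "(Q * pencil C D) $$ (i, j) = (\<Sum>x<n. Q $$ (i, x) * [:D $$ (x, j), C $$ (x, j):])"
    if "i < r" "j < c" for i j
    using that Q C D index_pencil[OF C D] by (simp add: scalar_prod_def atLeast0LessThan)
  show "coeff_mat 0 (Q * pencil C D) = coeff_mat 0 Q * D"
  proof (rule eq_matI)
    fix i j assume "i < dim_row (coeff_mat 0 Q * D)" "j < dim_col (coeff_mat 0 Q * D)"
    then have ij: "i < r" "j < c" using Q D by auto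
    have "coeff_mat 0 (Q * pencil C D) $$ (i, j) = coeff ((Q * pencil C D) $$ (i, j)) 0"
      using ij Q D unfolding coeff_mat_def by simp
    also have "\<dots> = (coeff_mat 0 Q * D) $$ (i, j)"
      unfolding e[OF ij] using ij Q D
      by (simp add: coeff_sum scalar_prod_def atLeast0LessThan coeff_mat_def mult.commute)
    finally show "coeff_mat 0 (Q * pencil C D) $$ (i, j) = (coeff_mat 0 Q * D) $$ (i, j)" .
  qed (use Q D in auto)
  show "coeff_mat (Suc l) (Q * pencil C D) = coeff_mat l Q * C + coeff_mat (Suc l) Q * D"
  proof (rule eq_matI)
    fix i j assume "i < dim_row (coeff_mat l Q * C + coeff_mat (Suc l) Q * D)"
      "j < dim_col (coeff_mat l Q * C + coeff_mat (Suc l) Q * D)"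
    then have ij: "i < r" "j < c" using Q D by auto
    have 1: "coeff (q * [:d, c:]) (Suc l) = coeff q l * c + coeff q (Suc l) * d" for q :: "complex poly" and c d
      by (simp add: mult_pCons_right mult.commute)
    have "coeff_mat (Suc l) (Q * pencil C D) $$ (i, j) = coeff ((Q * pencil C D) $$ (i, j)) (Suc l)"
      using ij Q D unfolding coeff_mat_def by simp
    also have "\<dots> = (\<Sum>x<n. coeff (Q $$ (i, x)) l * C $$ (x, j)) + (\<Sum>x<n. coeff (Q $$ (i, x)) (Suc l) * D $$ (x, j))"
      unfolding e[OF ij] coeff_sum 1 sum.distrib ..
    also have "\<dots> = (coeff_mat l Q * C + coeff_mat (Suc l) Q * D) $$ (i, j)"
      using ij Q C D by (simp add: scalar_prod_def atLeast0LessThan coeff_mat_def)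
    finally show "coeff_mat (Suc l) (Q * pencil C D) $$ (i, j) =
        (coeff_mat l Q * C + coeff_mat (Suc l) Q * D) $$ (i, j)" .
  qed (use Q C D in auto)
qed

text \<open>Comparison of coefficients. The clause for l \<ge> k carries content: with a singular C
  the factor Q may have degree k or more, its top coefficients being annihilated in the
  product.\<close>

lemma matrix_poly_eq_mult_pencil_iff:
  assumes A: "\<And>i. i \<le> k \<Longrightarrow> A i \<in> carrier_mat m m"
    and C: "C \<in> carrier_mat m m" and D: "D \<in> carrier_mat m m" and Q: "Q \<in> carrier_mat m m"
  shows "matrix_poly m k A = Q * pencil C D \<longleftrightarrow>
    A 0 = coeff_mat 0 Q * D \<and>
    (\<forall>l<k. A (Suc l) = coeff_mat l Q * C + coeff_mat (Suc l) Q * D) \<and>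
    (\<forall>l\<ge>k. coeff_mat l Q * C + coeff_mat (Suc l) Q * D = 0\<^sub>m m m)"
proof -
  have R: "Q * pencil C D \<in> carrier_mat m m" using Q C D by (intro mult_carrier_mat) auto
  have cm: "coeff_mat l (matrix_poly m k A) = (if l \<le> k then A l else 0\<^sub>m m m)" for l
    by (rule coeff_mat_matrix_poly[OF A])
  have "matrix_poly m k A = Q * pencil C D \<longleftrightarrow>
      (\<forall>l. coeff_mat l (matrix_poly m k A) = coeff_mat l (Q * pencil C D))"
    using coeff_mat_eqI[OF matrix_poly_carrier R] by auto
  also have "\<dots> \<longleftrightarrow> coeff_mat 0 (matrix_poly m k A) = coeff_mat 0 (Q * pencil C D) \<and>
      (\<forall>l. coeff_mat (Suc l) (matrix_poly m k A) = coeff_mat (Suc l) (Q * pencil C D))"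
    by (metis not0_implies_Suc)
  also have "\<dots> \<longleftrightarrow> A 0 = coeff_mat 0 Q * D \<and>
      (\<forall>l. (if Suc l \<le> k then A (Suc l) else 0\<^sub>m m m) = coeff_mat l Q * C + coeff_mat (Suc l) Q * D)"
    unfolding coeff_mat_mult_pencil[OF Q C D] cm by simp
  also have "\<dots> \<longleftrightarrow> A 0 = coeff_mat 0 Q * D \<and>
    (\<forall>l<k. A (Suc l) = coeff_mat l Q * C + coeff_mat (Suc l) Q * D) \<and>
    (\<forall>l\<ge>k. coeff_mat l Q * C + coeff_mat (Suc l) Q * D = 0\<^sub>m m m)"
    by (auto simp: Suc_le_eq not_less split: if_splits)
  finally show ?thesis .
qed

section \<open>Null equations as unrolled recurrences\<close>

lemma uminus_zero_mat: "- 0\<^sub>m r c = (0\<^sub>m r c :: 'a :: group_add mat)"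
  by (rule eq_matI) auto

lemma uminus_add_cancel_mat:
  fixes M N :: "complex mat"
  assumes "M \<in> carrier_mat r c" "N \<in> carrier_mat r c"
  shows "- M + (M - N) = - N"
  using assms by (intro eq_matI) auto

text \<open>Telescoping: the partial sum up to j equals - x_j T^(j+1), which vanishes for j = k. In
  the application x_l is the T part of the l-th cofactor coefficient in split coordinates.\<close>

lemma finite_part_sequence:
  assumes A: "\<And>i. i \<le> k \<Longrightarrow> A i \<in> carrier_mat m m"
    and X: "X \<in> carrier_mat m p" and T: "T \<in> carrier_mat p p"
    and x: "\<And>l. x l \<in> carrier_mat m p" "x k = 0\<^sub>m m p"
    and x0: "A 0 * X = - (x 0 * T)"
    and xs: "\<And>l. l < k \<Longrightarrow> A (Suc l) * X = x l - x (Suc l) * T"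
  shows "mat_sum m p (\<lambda>i. A i * X * (T ^\<^sub>m i)) {..k} = 0\<^sub>m m p"
proof -
  note d = carrier_matD[OF X] carrier_matD[OF T] carrier_matD[OF x(1)]
  have c: "A i * X * (T ^\<^sub>m j) \<in> carrier_mat m p" if "i \<le> k" for i j
    using A[OF that] X T by (intro mult_carrier_mat) auto
  have c': "x l * (T ^\<^sub>m j) \<in> carrier_mat m p" for l j
    using x(1) T by (intro mult_carrier_mat) auto
  have "mat_sum m p (\<lambda>i. A i * X * (T ^\<^sub>m i)) {..j} = - (x j * (T ^\<^sub>m Suc j))" if "j \<le> k" for j
    using that
  proof (induction j)
    case 0
    have "mat_sum m p (\<lambda>i. A i * X * (T ^\<^sub>m i)) {..0} = A 0 * X"
      using c[of 0 0] A[of 0] d by (intro eq_matI) auto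
    then show ?case using x0 d by simp
  next
    case (Suc j)
    have "mat_sum m p (\<lambda>i. A i * X * (T ^\<^sub>m i)) {..Suc j} =
        mat_sum m p (\<lambda>i. A i * X * (T ^\<^sub>m i)) {..j} + A (Suc j) * X * (T ^\<^sub>m Suc j)"
      using mat_sum_atMost[of "\<lambda>i. A i * X * (T ^\<^sub>m i)" "Suc j", OF c[OF Suc.prems]] unfolding lessThan_Suc_atMost .
    also have "A (Suc j) * X * (T ^\<^sub>m Suc j) = x j * (T ^\<^sub>m Suc j) - x (Suc j) * T * (T ^\<^sub>m Suc j)"
      using xs[of j] Suc.prems x(1) T
      by (simp del: pow_mat.simps) (intro minus_mult_distrib_mat[of _ m p _ _ p] mult_carrier_mat; auto)
    also have "x (Suc j) * T * (T ^\<^sub>m Suc j) = x (Suc j) * (T ^\<^sub>m Suc (Suc j))"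
      unfolding pow_mat_Suc_left[OF T, of "Suc j"] using d by (intro mult_mat_assoc) auto
    also have "mat_sum m p (\<lambda>i. A i * X * (T ^\<^sub>m i)) {..j} = - (x j * (T ^\<^sub>m Suc j))"
      using Suc by simp
    also have "- (x j * (T ^\<^sub>m Suc j)) + (x j * (T ^\<^sub>m Suc j) - x (Suc j) * (T ^\<^sub>m Suc (Suc j))) =
        - (x (Suc j) * (T ^\<^sub>m Suc (Suc j)))"
      by (rule uminus_add_cancel_mat[OF c' c'])
    finally show ?case .
  qed
  from this[of k] show ?thesis using x(2) d by (simp add: uminus_zero_mat del: pow_mat.simps)
qed

text \<open>The counterpart with reversed powers: the sum of A_i Y Z^(j-i) over i \<le> j equals -
  y_j, since passing from j to j + 1 multiplies all earlier terms by Z and adds a term without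
  Z.\<close>

lemma infinite_part_sequence:
  assumes A: "\<And>i. i \<le> k \<Longrightarrow> A i \<in> carrier_mat m m"
    and Y: "Y \<in> carrier_mat m q" and Z: "Z \<in> carrier_mat q q"
    and y: "\<And>l. y l \<in> carrier_mat m q" "y k = 0\<^sub>m m q"
    and y0: "A 0 * Y = - y 0"
    and ys: "\<And>l. l < k \<Longrightarrow> A (Suc l) * Y = y l * Z - y (Suc l)"
  shows "mat_sum m q (\<lambda>i. A i * Y * (Z ^\<^sub>m (k - i))) {..k} = 0\<^sub>m m q"
proof -
  note d = carrier_matD[OF Y] carrier_matD[OF Z] carrier_matD[OF y(1)]
  have c: "A i * Y * (Z ^\<^sub>m j) \<in> carrier_mat m q" if "i \<le> k" for i j
    using A[OF that] Y Z by (intro mult_carrier_mat) auto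
  have "mat_sum m q (\<lambda>i. A i * Y * (Z ^\<^sub>m (j - i))) {..j} = - y j" if "j \<le> k" for j
    using that
  proof (induction j)
    case 0
    have "mat_sum m q (\<lambda>i. A i * Y * (Z ^\<^sub>m (0 - i))) {..0} = A 0 * Y"
      using c[of 0 0] A[of 0] d by (intro eq_matI) auto
    then show ?case using y0 by simp
  next
    case (Suc j)
    have "mat_sum m q (\<lambda>i. A i * Y * (Z ^\<^sub>m (Suc j - i))) {..Suc j} =
        mat_sum m q (\<lambda>i. A i * Y * (Z ^\<^sub>m (Suc j - i))) {..j} + A (Suc j) * Y * (Z ^\<^sub>m (Suc j - Suc j))"
      using mat_sum_atMost[of "\<lambda>i. A i * Y * (Z ^\<^sub>m (Suc j - i))" "Suc j", OF c[OF Suc.prems]]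
      unfolding lessThan_Suc_atMost .
    also have "A (Suc j) * Y * (Z ^\<^sub>m (Suc j - Suc j)) = y j * Z - y (Suc j)"
      using ys[of j] Suc.prems A[of "Suc j"] d by simp
    also have "mat_sum m q (\<lambda>i. A i * Y * (Z ^\<^sub>m (Suc j - i))) {..j} =
        mat_sum m q (\<lambda>i. A i * Y * (Z ^\<^sub>m (j - i)) * Z) {..j}"
    proof (rule mat_sum_cong[OF refl])
      fix i assume i: "i \<in> {..j}"
      then have "Suc j - i = Suc (j - i)" "i \<le> k" using Suc.prems by auto
      then show "A i * Y * (Z ^\<^sub>m (Suc j - i)) = A i * Y * (Z ^\<^sub>m (j - i)) * Z"
        using A[of i] d by (simp add: mult_mat_assoc)
    qed
    also have "\<dots> = mat_sum m q (\<lambda>i. A i * Y * (Z ^\<^sub>m (j - i))) {..j} * Z"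
      using Suc.prems Z by (intro mat_sum_mult[symmetric] c) auto
    also have "\<dots> = - (y j * Z)" using Suc d by simp
    also have "- (y j * Z) + (y j * Z - y (Suc j)) = - y (Suc j)"
      by (rule uminus_add_cancel_mat[OF mult_carrier_mat[OF y(1) Z] y(1)])
    finally show ?case .
  qed
  from this[of k] show ?thesis using y(2) by (simp add: uminus_zero_mat)
qed

lemma finite_part_sequence_exists:
  assumes A: "\<And>i. i \<le> k \<Longrightarrow> A i \<in> carrier_mat m m"
    and X: "X \<in> carrier_mat m p" and T: "T \<in> carrier_mat p p"
    and sum: "mat_sum m p (\<lambda>i. A i * X * (T ^\<^sub>m i)) {..k} = 0\<^sub>m m p"
  obtains x where "\<And>l. x l \<in> carrier_mat m p" "\<And>l. k \<le> l \<Longrightarrow> x l = 0\<^sub>m m p"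
    "A 0 * X = - (x 0 * T)" "\<And>l. l < k \<Longrightarrow> A (Suc l) * X = x l - x (Suc l) * T"
proof -
  note d = carrier_matD[OF X] carrier_matD[OF T]
  have c: "A i * X * (T ^\<^sub>m j) \<in> carrier_mat m p" if "i \<le> k" for i j
    using A[OF that] X T by (intro mult_carrier_mat) auto
  \<comment> \<open>Horner tails: h_l = A_l X + h_(l+1) T, and h_0 = 0 is the null equation.\<close>
  define h where "h l = mat_sum m p (\<lambda>i. A i * X * (T ^\<^sub>m (i - l))) {l..k}" for l
  have hc: "h l \<in> carrier_mat m p" for l unfolding h_def by simp
  have hs: "A l * X = h l - h (Suc l) * T" if l: "l \<le> k" for l
  proof -
    have "h (Suc l) * T = mat_sum m p (\<lambda>i. A i * X * (T ^\<^sub>m (i - Suc l)) * T) {Suc l..k}"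
      unfolding h_def using T by (intro mat_sum_mult c) auto
    also have "\<dots> = mat_sum m p (\<lambda>i. A i * X * (T ^\<^sub>m (i - l))) {Suc l..k}"
    proof (rule mat_sum_cong[OF refl])
      fix i assume i: "i \<in> {Suc l..k}"
      then have "i - l = Suc (i - Suc l)" "i \<le> k" by auto
      then show "A i * X * (T ^\<^sub>m (i - Suc l)) * T = A i * X * (T ^\<^sub>m (i - l))"
        using A[of i] d by (simp add: mult_mat_assoc)
    qed
    finally have 1: "h (Suc l) * T = mat_sum m p (\<lambda>i. A i * X * (T ^\<^sub>m (i - l))) {Suc l..k}" .
    have 2: "A l * X * (T ^\<^sub>m (l - l)) = A l * X" using A[OF l] d by simp
    show ?thesis
    proof (rule eq_matI)
      fix r s assume "r < dim_row (h l - h (Suc l) * T)" "s < dim_col (h l - h (Suc l) * T)"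
      then have rs: "r < m" "s < p" unfolding 1 by auto
      have "{l..k} = insert l {Suc l..k}" using l by auto
      then have "h l $$ (r, s) = (A l * X * (T ^\<^sub>m (l - l))) $$ (r, s) + (h (Suc l) * T) $$ (r, s)"
        unfolding 1 unfolding h_def using rs by simp
      then show "(A l * X) $$ (r, s) = (h l - h (Suc l) * T) $$ (r, s)"
        unfolding 2 using rs carrier_matD[OF hc[of l]] carrier_matD[OF mult_carrier_mat[OF hc[of "Suc l"] T]]
        by (simp del: index_mult_mat(1))
    qed (use A[OF l] d hc[of l] 1 in auto)
  qed
  have h0: "h 0 = 0\<^sub>m m p" using sum unfolding h_def by (simp add: atLeast0AtMost)
  \<comment> \<open>The index is shifted: x_l is the tail starting at l + 1, an empty sum for l
    \<ge> k.\<close>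
  show ?thesis
  proof (rule that[of "\<lambda>l. h (Suc l)"])
    show "h (Suc l) = 0\<^sub>m m p" if "k \<le> l" for l
      unfolding h_def using that by (intro eq_matI) auto
    have "A 0 * X = 0\<^sub>m m p - h (Suc 0) * T" using hs[of 0] h0 by simp
    also have "\<dots> = - (h (Suc 0) * T)" using carrier_matD[OF hc[of "Suc 0"]] d by (intro eq_matI) auto
    finally show "A 0 * X = - (h (Suc 0) * T)" .
  qed (use hc hs in auto)
qed

lemma infinite_part_sequence_exists:
  assumes A: "\<And>i. i \<le> k \<Longrightarrow> A i \<in> carrier_mat m m"
    and Y: "Y \<in> carrier_mat m q" and Z: "Z \<in> carrier_mat q q"
    and sum: "mat_sum m q (\<lambda>i. A i * Y * (Z ^\<^sub>m (k - i))) {..k} = 0\<^sub>m m q"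
  obtains y where "\<And>l. y l \<in> carrier_mat m q" "\<And>l. k \<le> l \<Longrightarrow> y l = 0\<^sub>m m q"
    "A 0 * Y = - y 0" "\<And>l. l < k \<Longrightarrow> A (Suc l) * Y = y l * Z - y (Suc l)"
proof -
  note d = carrier_matD[OF Y] carrier_matD[OF Z]
  have c: "A i * Y * (Z ^\<^sub>m j) \<in> carrier_mat m q" if "i \<le> k" for i j
    using A[OF that] Y Z by (intro mult_carrier_mat) auto
  \<comment> \<open>Horner heads instead of tails, since here the powers of Z decrease with i. The
    sequence is y_l = - h_l, and cutting it off at k is consistent because h_k = 0 is the null
    equation.\<close>
  define h where "h l = mat_sum m q (\<lambda>i. A i * Y * (Z ^\<^sub>m (l - i))) {..l}" for l
  define y where "y l = (if k \<le> l then 0\<^sub>m m q else - h l)" for l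
  have hc: "h l \<in> carrier_mat m q" for l unfolding h_def by simp
  have hk: "h k = 0\<^sub>m m q" using sum unfolding h_def .
  have yh: "y l = - h l" if "l \<le> k" for l unfolding y_def using that hk by (intro eq_matI) auto
  have h0: "h 0 = A 0 * Y" unfolding h_def using A[of 0] d by (intro eq_matI) auto
  have hs: "h (Suc l) = h l * Z + A (Suc l) * Y" if l: "l < k" for l
  proof -
    have "h l * Z = mat_sum m q (\<lambda>i. A i * Y * (Z ^\<^sub>m (l - i)) * Z) {..l}"
      unfolding h_def using l Z by (intro mat_sum_mult c) auto
    also have "\<dots> = mat_sum m q (\<lambda>i. A i * Y * (Z ^\<^sub>m (Suc l - i))) {..l}"
    proof (rule mat_sum_cong[OF refl])
      fix i assume i: "i \<in> {..l}"
      then have "Suc l - i = Suc (l - i)" "i \<le> k" using l by auto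
      then show "A i * Y * (Z ^\<^sub>m (l - i)) * Z = A i * Y * (Z ^\<^sub>m (Suc l - i))"
        using A[of i] d by (simp add: mult_mat_assoc)
    qed
    finally have 1: "h l * Z = mat_sum m q (\<lambda>i. A i * Y * (Z ^\<^sub>m (Suc l - i))) {..l}" .
    have "h (Suc l) = mat_sum m q (\<lambda>i. A i * Y * (Z ^\<^sub>m (Suc l - i))) {..l} + A (Suc l) * Y * (Z ^\<^sub>m (Suc l - Suc l))"
      unfolding h_def using mat_sum_atMost[of "\<lambda>i. A i * Y * (Z ^\<^sub>m (Suc l - i))" "Suc l", OF c] l
      unfolding lessThan_Suc_atMost by simp
    then show ?thesis unfolding 1 using A[of "Suc l"] l d by simp
  qed
  show ?thesis
  proof (rule that[of y])
    show "y l \<in> carrier_mat m q" for l unfolding y_def using hc by auto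
    show "k \<le> l \<Longrightarrow> y l = 0\<^sub>m m q" for l unfolding y_def by simp
    show "A 0 * Y = - y 0" using yh[of 0] h0 by simp
    show "A (Suc l) * Y = y l * Z - y (Suc l)" if l: "l < k" for l
    proof -
      have c1: "h l * Z \<in> carrier_mat m q" using mult_carrier_mat[OF hc Z] .
      have c2: "A (Suc l) * Y \<in> carrier_mat m q" using mult_carrier_mat[OF A Y] l by simp
      have "y l * Z - y (Suc l) = - (h l * Z) - - (h l * Z + A (Suc l) * Y)"
        using yh[of l] yh[of "Suc l"] hs[OF l] l hc[of l] d by simp
      also have "\<dots> = A (Suc l) * Y"
        using carrier_matD[OF c1] carrier_matD[OF c2] by (intro eq_matI) (auto simp del: index_mult_mat(1))
      finally show ?thesis ..
    qed
  qed
qed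

subsection \<open>Separable bisolvents in adapted coordinates\<close>

text \<open>Splitting at the eigenvalue 1 leaves an invertible idempotent, which is the identity,
  and an idempotent without the eigenvalue 1. Every column of the latter is fixed by it and
  therefore 0.\<close>

lemma idempotent_split:
  fixes E :: "complex mat"
  assumes E: "E \<in> carrier_mat n n" and idem: "E * E = E"
  obtains p q W W' where "p + q = n" "inverse_mats n W W'" "E * W = W * (1\<^sub>m p \<oplus>\<^sub>m 0\<^sub>m q q)"
proof -
  obtain p q E1 E2 W W' where pq: "p + q = n" and E1: "E1 \<in> carrier_mat p p" and E2: "E2 \<in> carrier_mat q q"
    and W: "inverse_mats n W W'" and EW: "E * W = W * (E1 \<oplus>\<^sub>m E2)"
    and ev: "\<And>e. eigenvalue E1 e \<Longrightarrow> e = 1" "\<And>e. eigenvalue E2 e \<Longrightarrow> e \<noteq> 1"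
    using spectral_split[OF E, of "\<lambda>e. e = 1"] by metis
  note d = carrier_matD[OF E1] carrier_matD[OF E2] carrier_matD[OF E] inverse_matsD[OF W]
  have "W * ((E1 * E1) \<oplus>\<^sub>m (E2 * E2)) = W * (E1 \<oplus>\<^sub>m E2) * (E1 \<oplus>\<^sub>m E2)"
    using d pq by (simp add: mult_mat_assoc block_sum_mult)
  also have "\<dots> = E * W * (E1 \<oplus>\<^sub>m E2)" by (simp only: EW)
  also have "\<dots> = E * (W * (E1 \<oplus>\<^sub>m E2))" using d pq by (intro mult_mat_assoc) auto
  also have "\<dots> = E * (E * W)" by (simp only: EW)
  also have "\<dots> = E * E * W" using d by (intro mult_mat_assoc[symmetric]) auto
  also have "\<dots> = W * (E1 \<oplus>\<^sub>m E2)" unfolding idem EW ..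
  finally have "W' * (W * ((E1 * E1) \<oplus>\<^sub>m (E2 * E2))) = W' * (W * (E1 \<oplus>\<^sub>m E2))" by simp
  then have eq: "(E1 * E1) \<oplus>\<^sub>m (E2 * E2) = E1 \<oplus>\<^sub>m E2"
    using inverse_mats_cancel(2)[OF W] d pq by simp
  have i1: "E1 * E1 = E1" by (rule block_sum_eqD(1)[OF eq]) (use d in auto)
  have i2: "E2 * E2 = E2" by (rule block_sum_eqD(2)[OF eq]) (use d in auto)
  obtain E1' where E1': "inverse_mats p E1 E1'"
    using no_eigenvalue_0_inverse[OF E1] ev(1)[of 0] by auto
  have "E1 = E1' * (E1 * E1)" using inverse_mats_cancel(2)[OF E1', of E1] d by simp
  then have "E1 = 1\<^sub>m p" unfolding i1 using inverse_matsD[OF E1'] by simp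
  moreover have "E2 = 0\<^sub>m q q"
  proof (rule eq_matI)
    fix i j assume "i < dim_row (0\<^sub>m q q :: complex mat)" "j < dim_col (0\<^sub>m q q :: complex mat)"
    then have ij: "i < q" "j < q" by auto
    have c: "col E2 j \<in> carrier_vec q" using E2 ij by auto
    have "E2 *\<^sub>v col E2 j = 1 \<cdot>\<^sub>v col E2 j"
      using col_mult2[OF E2 E2 ij(2)] unfolding i2 using c by simp
    then have "col E2 j = 0\<^sub>v q" using eigenvalueI[OF E2 c] ev(2) by metis
    then have "col E2 j $ i = 0" using ij by simp
    then show "E2 $$ (i, j) = 0\<^sub>m q q $$ (i, j)" using E2 ij by simp
  qed (use E2 in auto)
  ultimately show ?thesis using that[OF pq W] EW by simp
qed

text \<open>In the coordinates W the idempotent is I \<oplus> 0, so E * M * E keeps only the upper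
  left block of M and the summand 1 - E supplies the identity in the opposite corner. The second
  statement is the mirror image.\<close>

lemma separated_block_form:
  fixes M :: "complex mat"
  assumes W: "inverse_mats (p + q) W W'" and EW: "E * W = W * (1\<^sub>m p \<oplus>\<^sub>m 0\<^sub>m q q)"
    and E: "E \<in> carrier_mat (p + q) (p + q)" and M: "M \<in> carrier_mat (p + q) (p + q)"
  shows "M = E * M * E + (1\<^sub>m (p + q) - E) \<Longrightarrow>
      \<exists>T \<in> carrier_mat p p. M * W = W * (T \<oplus>\<^sub>m 1\<^sub>m q)"
    and "M = E + (1\<^sub>m (p + q) - E) * M * (1\<^sub>m (p + q) - E) \<Longrightarrow>
      \<exists>Z \<in> carrier_mat q q. M * W = W * (1\<^sub>m p \<oplus>\<^sub>m Z)"
proof -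
  let ?n = "p + q" and ?F = "1\<^sub>m p \<oplus>\<^sub>m 0\<^sub>m q q :: complex mat" and ?F' = "0\<^sub>m p p \<oplus>\<^sub>m 1\<^sub>m q :: complex mat"
  note dW = inverse_matsD[OF W]
  note d = dW(5-) carrier_matD[OF E] carrier_matD[OF M]
  have F: "?F \<in> carrier_mat ?n ?n" and F': "?F' \<in> carrier_mat ?n ?n" by auto
  have cE: "1\<^sub>m ?n - E \<in> carrier_mat ?n ?n" using E by (intro minus_carrier_mat) auto
  define B where "B = W' * M * W"
  have B: "B \<in> carrier_mat ?n ?n" unfolding B_def using dW M by (intro mult_carrier_mat) auto
  have MW: "M * W = W * B"
    unfolding B_def using inverse_mats_cancel(1)[OF W, of "M * W"] d by (simp add: mult_mat_assoc)
  obtain a b c e where Beq: "B = four_block_mat a b c e"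
    and bl: "a \<in> carrier_mat p p" "b \<in> carrier_mat p q" "c \<in> carrier_mat q p" "e \<in> carrier_mat q q"
    using four_block_split[OF B] .
  have EW': "(1\<^sub>m ?n - E) * W = W * ?F'"
  proof -
    have "(1\<^sub>m ?n - E) * W = W * 1\<^sub>m ?n - W * ?F"
      using minus_mult_distrib_mat[OF one_carrier_mat E dW(1)] dW EW by simp
    also have "\<dots> = W * (1\<^sub>m ?n - ?F)"
      by (rule mult_minus_distrib_mat[OF dW(1) one_carrier_mat F, symmetric])
    also have "1\<^sub>m ?n - ?F = ?F'" by (rule eq_matI) (auto simp: index_block_sum)
    finally show ?thesis .
  qed
  have corner: "N * M * N * W = W * (G * B * G)"
    if "N * W = W * G" "N \<in> carrier_mat ?n ?n" "G \<in> carrier_mat ?n ?n" for N G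
  proof -
    note d' = carrier_matD[OF that(2)] carrier_matD[OF that(3)] carrier_matD[OF B]
    have "N * M * N * W = N * (M * W * G)" using d d' that(1) by (simp add: mult_mat_assoc)
    also have "\<dots> = N * W * (B * G)" unfolding MW using d d' by (simp add: mult_mat_assoc)
    finally show ?thesis unfolding that(1) using d d' by (simp add: mult_mat_assoc)
  qed
  show "\<exists>T \<in> carrier_mat p p. M * W = W * (T \<oplus>\<^sub>m 1\<^sub>m q)" if eq: "M = E * M * E + (1\<^sub>m ?n - E)"
  proof
    have "M * W = E * M * E * W + (1\<^sub>m ?n - E) * W"
      by (subst eq) (rule add_mult_distrib_mat[OF _ cE dW(1)], intro mult_carrier_mat[OF mult_carrier_mat[OF E M] E])
    also have "\<dots> = W * (?F * B * ?F) + W * ?F'" unfolding corner[OF EW E F] EW' ..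
    also have "\<dots> = W * (?F * B * ?F + ?F')"
      by (rule mult_add_distrib_mat[OF dW(1) mult_carrier_mat[OF mult_carrier_mat[OF F B] F] F', symmetric])
    also have "?F * B * ?F + ?F' = a \<oplus>\<^sub>m 1\<^sub>m q"
    proof -
      have "?F * B = four_block_mat a b (0\<^sub>m q p) (0\<^sub>m q q)"
        unfolding Beq block_sum_def using bl by (simp add: four_block_mult)
      then have "?F * B * ?F = four_block_mat a (0\<^sub>m p q) (0\<^sub>m q p) (0\<^sub>m q q)"
        unfolding block_sum_def using bl by (simp add: four_block_mult)
      then show ?thesis using bl by (intro eq_matI) (auto simp: index_block_sum)
    qed
    finally show "M * W = W * (a \<oplus>\<^sub>m 1\<^sub>m q)" .
  qed (rule bl(1))
  show "\<exists>Z \<in> carrier_mat q q. M * W = W * (1\<^sub>m p \<oplus>\<^sub>m Z)"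
    if eq: "M = E + (1\<^sub>m ?n - E) * M * (1\<^sub>m ?n - E)"
  proof
    have "M * W = E * W + (1\<^sub>m ?n - E) * M * (1\<^sub>m ?n - E) * W"
      by (subst eq) (rule add_mult_distrib_mat[OF E _ dW(1)], intro mult_carrier_mat[OF mult_carrier_mat[OF cE M] cE])
    also have "\<dots> = W * ?F + W * (?F' * B * ?F')" unfolding corner[OF EW' cE F'] EW ..
    also have "\<dots> = W * (?F + ?F' * B * ?F')"
      by (rule mult_add_distrib_mat[OF dW(1) F mult_carrier_mat[OF mult_carrier_mat[OF F' B] F'], symmetric])
    also have "?F + ?F' * B * ?F' = 1\<^sub>m p \<oplus>\<^sub>m e"
    proof -
      have "?F' * B = four_block_mat (0\<^sub>m p p) (0\<^sub>m p q) c e"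
        unfolding Beq block_sum_def using bl by (simp add: four_block_mult)
      then have "?F' * B * ?F' = four_block_mat (0\<^sub>m p p) (0\<^sub>m p q) (0\<^sub>m q p) e"
        unfolding block_sum_def using bl by (simp add: four_block_mult)
      then show ?thesis using bl by (intro eq_matI) (auto simp: index_block_sum)
    qed
    finally show "M * W = W * (1\<^sub>m p \<oplus>\<^sub>m e)" .
  qed (rule bl(4))
qed

lemma pow_one_mat: "(1\<^sub>m n :: 'a :: semiring_1 mat) ^\<^sub>m k = 1\<^sub>m n"
  by (induction k) auto

text \<open>On [X, Y] the powers act separately: S1^i turns X into X T^i and fixes Y, while S2^(k-i)
  fixes X and turns Y into Y Z^(k-i).\<close>

lemma bisolvent_sum_coordinates:
  assumes A: "\<And>i. i \<le> k \<Longrightarrow> A i \<in> carrier_mat m m"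
    and X: "X \<in> carrier_mat m p" and Y: "Y \<in> carrier_mat m q"
    and T: "T \<in> carrier_mat p p" and Z: "Z \<in> carrier_mat q q"
    and S1: "S1 \<in> carrier_mat m m" and S2: "S2 \<in> carrier_mat m m"
    and eq1: "S1 * hcat X Y = hcat X Y * (T \<oplus>\<^sub>m 1\<^sub>m q)"
    and eq2: "S2 * hcat X Y = hcat X Y * (1\<^sub>m p \<oplus>\<^sub>m Z)"
  shows "mat_sum m m (\<lambda>i. A i * (S1 ^\<^sub>m i) * (S2 ^\<^sub>m (k - i))) {..k} * hcat X Y =
    hcat (mat_sum m p (\<lambda>i. A i * X * (T ^\<^sub>m i)) {..k}) (mat_sum m q (\<lambda>i. A i * Y * (Z ^\<^sub>m (k - i))) {..k})"
proof -
  let ?H = "hcat X Y"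
  have H: "?H \<in> carrier_mat m (p + q)" using X Y by simp
  note d = carrier_matD[OF X] carrier_matD[OF Y] carrier_matD[OF T] carrier_matD[OF Z]
    carrier_matD[OF S1] carrier_matD[OF S2]
  have "mat_sum m m (\<lambda>i. A i * (S1 ^\<^sub>m i) * (S2 ^\<^sub>m (k - i))) {..k} * ?H =
      mat_sum m (p + q) (\<lambda>i. A i * (S1 ^\<^sub>m i) * (S2 ^\<^sub>m (k - i)) * ?H) {..k}"
    by (rule mat_sum_mult[OF mult_carrier_mat[OF mult_carrier_mat[OF A pow_carrier_mat[OF S1]] pow_carrier_mat[OF S2]] H]) auto
  also have "\<dots> = mat_sum m (p + q) (\<lambda>i. hcat (A i * X * (T ^\<^sub>m i)) (A i * Y * (Z ^\<^sub>m (k - i)))) {..k}"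
  proof (rule mat_sum_cong[OF refl])
    fix i assume "i \<in> {..k}"
    then have dA: "dim_row (A i) = m" "dim_col (A i) = m" using A[of i] by auto
    have 1: "S1 ^\<^sub>m i * ?H = ?H * ((T ^\<^sub>m i) \<oplus>\<^sub>m 1\<^sub>m q)"
      using intertwine_pow[OF S1 block_sum_carrier[OF T one_carrier_mat] H eq1, of i]
        block_sum_pow[OF T one_carrier_mat, of q i] by (simp add: pow_one_mat)
    have 2: "S2 ^\<^sub>m (k - i) * ?H = ?H * (1\<^sub>m p \<oplus>\<^sub>m (Z ^\<^sub>m (k - i)))"
      using intertwine_pow[OF S2 block_sum_carrier[OF one_carrier_mat Z] H eq2, of "k - i"]
        block_sum_pow[OF one_carrier_mat Z, of p "k - i"] by (simp add: pow_one_mat)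
    have "A i * (S1 ^\<^sub>m i) * (S2 ^\<^sub>m (k - i)) * ?H = A i * (S1 ^\<^sub>m i * (S2 ^\<^sub>m (k - i) * ?H))"
      using d dA by (simp add: mult_mat_assoc)
    also have "\<dots> = A i * (S1 ^\<^sub>m i * ?H * (1\<^sub>m p \<oplus>\<^sub>m (Z ^\<^sub>m (k - i))))"
      unfolding 2 using d by (simp add: mult_mat_assoc)
    also have "\<dots> = hcat (A i * X * (T ^\<^sub>m i)) (A i * Y * (Z ^\<^sub>m (k - i)))"
      unfolding 1 using d dA by (simp add: hcat_block_sum mult_hcat mult_mat_assoc)
    finally show "A i * (S1 ^\<^sub>m i) * (S2 ^\<^sub>m (k - i)) * ?H = hcat (A i * X * (T ^\<^sub>m i)) (A i * Y * (Z ^\<^sub>m (k - i)))" .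
  qed
  also have "\<dots> = hcat (mat_sum m p (\<lambda>i. A i * X * (T ^\<^sub>m i)) {..k}) (mat_sum m q (\<lambda>i. A i * Y * (Z ^\<^sub>m (k - i))) {..k})"
    by (intro mat_sum_hcat mult_carrier_mat[OF mult_carrier_mat[OF A X] pow_carrier_mat[OF T]]
        mult_carrier_mat[OF mult_carrier_mat[OF A Y] pow_carrier_mat[OF Z]]) auto
  finally show ?thesis .
qed

lemma hcat_zero: "hcat (0\<^sub>m m p) (0\<^sub>m m q) = 0\<^sub>m m (p + q)"
  by (rule eq_matI) (auto simp: index_hcat)

text \<open>X and Y are bases of the range and of the kernel of E; multiplying the bisolvent
  equation by [X, Y] on the right separates it into the two null equations.\<close>

lemma separable_coordinates:
  assumes A: "\<And>i. i \<le> k \<Longrightarrow> A i \<in> carrier_mat m m"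
    and bis: "bisolvent m k A S1 S2" and sep: "separated_by m E S1 S2"
  obtains p q X Y T Z W' where "p + q = m" "null_pair m k A p q X Y T Z" "inverse_mats m (hcat X Y) W'"
    "S1 * hcat X Y = hcat X Y * (T \<oplus>\<^sub>m 1\<^sub>m q)" "S2 * hcat X Y = hcat X Y * (1\<^sub>m p \<oplus>\<^sub>m Z)"
    "E * hcat X Y = hcat X Y * (1\<^sub>m p \<oplus>\<^sub>m 0\<^sub>m q q)"
proof -
  have E: "E \<in> carrier_mat m m" "E * E = E" and S: "S1 \<in> carrier_mat m m" "S2 \<in> carrier_mat m m"
    and s1: "S1 = E * S1 * E + (1\<^sub>m m - E)" and s2: "S2 = E + (1\<^sub>m m - E) * S2 * (1\<^sub>m m - E)"
    using bis sep unfolding bisolvent_def separated_by_def by auto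
  obtain p q W W' where pq: "p + q = m" and W: "inverse_mats m W W'"
    and EW: "E * W = W * (1\<^sub>m p \<oplus>\<^sub>m 0\<^sub>m q q)"
    using idempotent_split[OF E] .
  note b = separated_block_form[of p q W W' E, unfolded pq, OF W EW E(1)]
  obtain T where T: "T \<in> carrier_mat p p" "S1 * W = W * (T \<oplus>\<^sub>m 1\<^sub>m q)" using b(1)[OF S(1) s1] by auto
  obtain Z where Z: "Z \<in> carrier_mat q q" "S2 * W = W * (1\<^sub>m p \<oplus>\<^sub>m Z)" using b(2)[OF S(2) s2] by auto
  have "W \<in> carrier_mat m (p + q)" using inverse_matsD[OF W] pq by auto
  then obtain X Y where XY: "W = hcat X Y" "X \<in> carrier_mat m p" "Y \<in> carrier_mat m q"
    using hcat_split by metis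
  have "hcat (mat_sum m p (\<lambda>i. A i * X * (T ^\<^sub>m i)) {..k}) (mat_sum m q (\<lambda>i. A i * Y * (Z ^\<^sub>m (k - i))) {..k}) =
      mat_sum m m (\<lambda>i. A i * (S1 ^\<^sub>m i) * (S2 ^\<^sub>m (k - i))) {..k} * W"
    unfolding XY(1)
    by (rule bisolvent_sum_coordinates[OF A XY(2,3) T(1) Z(1) S T(2)[unfolded XY(1)] Z(2)[unfolded XY(1)], symmetric])
  also have "\<dots> = 0\<^sub>m m m * W" using bis unfolding bisolvent_def by simp
  also have "\<dots> = hcat (0\<^sub>m m p) (0\<^sub>m m q)" using inverse_matsD[OF W] pq by (simp add: hcat_zero)
  finally have eq: "hcat (mat_sum m p (\<lambda>i. A i * X * (T ^\<^sub>m i)) {..k})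
      (mat_sum m q (\<lambda>i. A i * Y * (Z ^\<^sub>m (k - i))) {..k}) = hcat (0\<^sub>m m p) (0\<^sub>m m q)" .
  have "null_pair m k A p q X Y T Z"
    unfolding null_pair_def using hcat_eqD[OF eq] XY(2,3) T(1) Z(1) by simp
  with that pq W T Z EW show ?thesis unfolding XY(1) by blast
qed

text \<open>Since [X, Y] is invertible, every required identity may be checked after multiplication
  by it (\<open>inj\<close>), where it concerns block diagonal matrices. In particular S1 and S2
  commute because T \<oplus> I and I \<oplus> Z do.\<close>

lemma null_pair_separable:
  assumes A: "\<And>i. i \<le> k \<Longrightarrow> A i \<in> carrier_mat m m"
    and pq: "p + q = m" and np: "null_pair m k A p q X Y T Z" and W: "inverse_mats m (hcat X Y) W'"
    and S1: "S1 \<in> carrier_mat m m" and S2: "S2 \<in> carrier_mat m m"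
    and eq1: "S1 * hcat X Y = hcat X Y * (T \<oplus>\<^sub>m 1\<^sub>m q)"
    and eq2: "S2 * hcat X Y = hcat X Y * (1\<^sub>m p \<oplus>\<^sub>m Z)"
  shows "separable_bisolvent m k A S1 S2"
proof -
  let ?H = "hcat X Y"
  note c = null_pairD(1-4)[OF np]
  note d = carrier_matD[OF c(1)] carrier_matD[OF c(2)] carrier_matD[OF c(3)] carrier_matD[OF c(4)]
    carrier_matD[OF S1] carrier_matD[OF S2]
  note dW = inverse_matsD[OF W]
  have inj: "M = N" if "M * ?H = N * ?H" "M \<in> carrier_mat m m" "N \<in> carrier_mat m m" for M N
  proof -
    have "M = M * ?H * W'"
      by (rule inverse_mats_cancel_right(1)[OF W carrier_matD(2)[OF that(2)], symmetric])
    also have "\<dots> = N * ?H * W'" by (simp only: that(1))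
    also have "\<dots> = N" by (rule inverse_mats_cancel_right(1)[OF W carrier_matD(2)[OF that(3)]])
    finally show ?thesis .
  qed
  have "S1 * S2 = S2 * S1"
  proof (rule inj)
    have "S1 * S2 * ?H = S1 * ?H * (1\<^sub>m p \<oplus>\<^sub>m Z)" using d dW(5-) pq eq2 by (simp add: mult_mat_assoc)
    also have "\<dots> = ?H * (T \<oplus>\<^sub>m Z)" unfolding eq1 using d dW(5-) pq by (simp add: mult_mat_assoc block_sum_mult)
    also have "\<dots> = S2 * ?H * (T \<oplus>\<^sub>m 1\<^sub>m q)"
      unfolding eq2 using d dW(5-) pq by (simp add: mult_mat_assoc block_sum_mult)
    also have "\<dots> = S2 * S1 * ?H" using d dW(5-) pq eq1 by (simp add: mult_mat_assoc)
    finally show "S1 * S2 * ?H = S2 * S1 * ?H" .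
  qed (use S1 S2 in auto)
  moreover have "mat_sum m m (\<lambda>i. A i * (S1 ^\<^sub>m i) * (S2 ^\<^sub>m (k - i))) {..k} = 0\<^sub>m m m"
  proof (rule inj)
    show "mat_sum m m (\<lambda>i. A i * (S1 ^\<^sub>m i) * (S2 ^\<^sub>m (k - i))) {..k} * ?H = 0\<^sub>m m m * ?H"
    proof -
      have "mat_sum m m (\<lambda>i. A i * (S1 ^\<^sub>m i) * (S2 ^\<^sub>m (k - i))) {..k} * ?H =
          hcat (mat_sum m p (\<lambda>i. A i * X * (T ^\<^sub>m i)) {..k}) (mat_sum m q (\<lambda>i. A i * Y * (Z ^\<^sub>m (k - i))) {..k})"
        by (rule bisolvent_sum_coordinates[OF A c(1,3,2,4) S1 S2 eq1 eq2])
      also have "\<dots> = 0\<^sub>m m (p + q)" unfolding null_pairD(5,6)[OF np] by (rule hcat_zero)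
      also have "\<dots> = 0\<^sub>m m m * ?H" using dW(5-) d pq by simp
      finally show ?thesis .
    qed
  qed auto
  \<comment> \<open>The projection onto the span of the columns of X along the span of the columns
    of Y.\<close>
  moreover define E where "E = ?H * (1\<^sub>m p \<oplus>\<^sub>m 0\<^sub>m q q) * W'"
  have E: "E \<in> carrier_mat m m" unfolding E_def using dW pq by (intro mult_carrier_mat[of _ m m]) auto
  have EH: "E * ?H = ?H * (1\<^sub>m p \<oplus>\<^sub>m 0\<^sub>m q q)"
    unfolding E_def using dW pq d by (simp add: mult_mat_assoc)
  have cE: "1\<^sub>m m - E \<in> carrier_mat m m" using E by (intro minus_carrier_mat) auto
  have EH': "(1\<^sub>m m - E) * ?H = ?H * (0\<^sub>m p p \<oplus>\<^sub>m 1\<^sub>m q)"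
  proof -
    have "(1\<^sub>m m - E) * ?H = ?H - E * ?H"
      using minus_mult_distrib_mat[OF one_carrier_mat E dW(1)] dW by simp
    also have "\<dots> = hcat X Y - hcat X (0\<^sub>m m q)" unfolding EH using d by (simp add: hcat_block_sum)
    also have "\<dots> = hcat (0\<^sub>m m p) Y" using d by (intro eq_matI) (auto simp: index_hcat)
    finally show ?thesis using d by (simp add: hcat_block_sum)
  qed
  have "separated_by m E S1 S2"
    unfolding separated_by_def
  proof (intro conjI E)
    show "E * E = E"
    proof (rule inj)
      have "E * E * ?H = E * (E * ?H)" using carrier_matD[OF E] d by (intro mult_mat_assoc) auto
      also have "\<dots> = E * (?H * (1\<^sub>m p \<oplus>\<^sub>m 0\<^sub>m q q))" by (simp only: EH)
      also have "\<dots> = E * ?H * (1\<^sub>m p \<oplus>\<^sub>m 0\<^sub>m q q)"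
        using carrier_matD[OF E] d by (intro mult_mat_assoc[symmetric]) auto
      finally have "E * E * ?H = E * ?H * (1\<^sub>m p \<oplus>\<^sub>m 0\<^sub>m q q)" .
      then show "E * E * ?H = E * ?H" unfolding EH using d dW(5-) pq by (simp add: mult_mat_assoc block_sum_mult)
    qed (use E in auto)
    show "S1 = E * S1 * E + (1\<^sub>m m - E)"
    proof (rule inj)
      have "E * S1 * E * ?H = E * (S1 * ?H * (1\<^sub>m p \<oplus>\<^sub>m 0\<^sub>m q q))"
        using carrier_matD[OF E] dW(5-) pq EH d by (simp add: mult_mat_assoc)
      also have "\<dots> = E * ?H * (T \<oplus>\<^sub>m 0\<^sub>m q q)"
        unfolding eq1 using carrier_matD[OF E] dW(5-) pq d by (simp add: mult_mat_assoc block_sum_mult)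
      also have "\<dots> = hcat (X * T) (0\<^sub>m m q)"
        unfolding EH using dW(5-) pq d by (simp add: mult_mat_assoc block_sum_mult hcat_block_sum)
      finally have 1: "E * S1 * E * ?H = hcat (X * T) (0\<^sub>m m q)" .
      have "(E * S1 * E + (1\<^sub>m m - E)) * ?H = E * S1 * E * ?H + (1\<^sub>m m - E) * ?H"
        by (rule add_mult_distrib_mat[OF mult_carrier_mat[OF mult_carrier_mat[OF E S1] E] cE dW(1)])
      also have "\<dots> = hcat (X * T) (0\<^sub>m m q) + hcat (0\<^sub>m m p) Y"
        unfolding 1 EH' using d by (simp add: hcat_block_sum)
      also have "\<dots> = hcat (X * T) Y" using d by (intro eq_matI) (auto simp: index_hcat)
      also have "\<dots> = S1 * ?H" unfolding eq1 using d by (simp add: hcat_block_sum)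
      finally show "S1 * ?H = (E * S1 * E + (1\<^sub>m m - E)) * ?H" ..
    qed (use S1 E cE in auto)
    show "S2 = E + (1\<^sub>m m - E) * S2 * (1\<^sub>m m - E)"
    proof (rule inj)
      have "(1\<^sub>m m - E) * S2 * (1\<^sub>m m - E) * ?H = (1\<^sub>m m - E) * (S2 * ?H * (0\<^sub>m p p \<oplus>\<^sub>m 1\<^sub>m q))"
        using carrier_matD[OF cE] dW(5-) pq EH' d by (simp add: mult_mat_assoc)
      also have "\<dots> = (1\<^sub>m m - E) * ?H * (0\<^sub>m p p \<oplus>\<^sub>m Z)"
        unfolding eq2 using carrier_matD[OF cE] dW(5-) pq d by (simp add: mult_mat_assoc block_sum_mult)
      also have "\<dots> = hcat (0\<^sub>m m p) (Y * Z)"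
        unfolding EH' using dW(5-) pq d by (simp add: mult_mat_assoc block_sum_mult hcat_block_sum)
      finally have 1: "(1\<^sub>m m - E) * S2 * (1\<^sub>m m - E) * ?H = hcat (0\<^sub>m m p) (Y * Z)" .
      have "(E + (1\<^sub>m m - E) * S2 * (1\<^sub>m m - E)) * ?H = E * ?H + (1\<^sub>m m - E) * S2 * (1\<^sub>m m - E) * ?H"
        by (rule add_mult_distrib_mat[OF E mult_carrier_mat[OF mult_carrier_mat[OF cE S2] cE] dW(1)])
      also have "\<dots> = hcat X (0\<^sub>m m q) + hcat (0\<^sub>m m p) (Y * Z)"
        unfolding 1 EH using d by (simp add: hcat_block_sum)
      also have "\<dots> = hcat X (Y * Z)" using d by (intro eq_matI) (auto simp: index_hcat)
      also have "\<dots> = S2 * ?H" unfolding eq2 using d by (simp add: hcat_block_sum)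
      finally show "S2 * ?H = (E + (1\<^sub>m m - E) * S2 * (1\<^sub>m m - E)) * ?H" ..
    qed (use S2 E cE in auto)
  qed
  ultimately show ?thesis
    unfolding separable_bisolvent_def bisolvent_def using S1 S2 by blast
qed

section \<open>Right factors and separable bisolvents\<close>

lemma hcat_diff: "dim_row Y = dim_row X \<Longrightarrow> dim_row Y' = dim_row X' \<Longrightarrow> dim_row X = dim_row X' \<Longrightarrow>
  dim_col X = dim_col X' \<Longrightarrow> dim_col Y = dim_col Y' \<Longrightarrow>
  hcat X Y - hcat X' Y' = hcat (X - X') (Y - Y' :: 'a :: group_add mat)"
  by (rule eq_matI) (auto simp: index_hcat)

text \<open>The coefficients of a cofactor Q of grade k - 1 in P = Q * pencil C D. Demanding q l = 0
  from k on makes the recurrence uniform: for l = k - 1 it reads A k = q (k - 1) * C.\<close>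

definition cofactor_coeffs ::
  "nat \<Rightarrow> nat \<Rightarrow> (nat \<Rightarrow> complex mat) \<Rightarrow> complex mat \<Rightarrow> complex mat \<Rightarrow> (nat \<Rightarrow> complex mat) \<Rightarrow> bool" where
  "cofactor_coeffs m k A C D q \<longleftrightarrow>
     (\<forall>l. q l \<in> carrier_mat m m) \<and> (\<forall>l\<ge>k. q l = 0\<^sub>m m m) \<and>
     A 0 = q 0 * D \<and> (\<forall>l<k. A (Suc l) = q l * C + q (Suc l) * D)"

lemma cofactor_coeffs_matrix_poly:
  assumes A: "\<And>i. i \<le> k \<Longrightarrow> A i \<in> carrier_mat m m"
    and C: "C \<in> carrier_mat m m" and D: "D \<in> carrier_mat m m" and q: "cofactor_coeffs m k A C D q"
  shows "matrix_poly m k A = matrix_poly m k q * pencil C D"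
    and "coeff_mat l (matrix_poly m k q) = q l"
proof -
  have cq: "coeff_mat l (matrix_poly m k q) = q l" for l
    using coeff_mat_matrix_poly[of k q m l] q unfolding cofactor_coeffs_def by auto
  then show "coeff_mat l (matrix_poly m k q) = q l" .
  show "matrix_poly m k A = matrix_poly m k q * pencil C D"
  proof (subst matrix_poly_eq_mult_pencil_iff[OF A C D], assumption)
    show "A 0 = coeff_mat 0 (matrix_poly m k q) * D \<and>
      (\<forall>l<k. A (Suc l) = coeff_mat l (matrix_poly m k q) * C + coeff_mat (Suc l) (matrix_poly m k q) * D) \<and>
      (\<forall>l\<ge>k. coeff_mat l (matrix_poly m k q) * C + coeff_mat (Suc l) (matrix_poly m k q) * D = 0\<^sub>m m m)"
      using q C D unfolding cq cofactor_coeffs_def by auto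
  qed simp
qed

lemma graded_factor_iff:
  assumes A: "\<And>i. i \<le> k \<Longrightarrow> A i \<in> carrier_mat m m"
    and C: "C \<in> carrier_mat m m" and D: "D \<in> carrier_mat m m"
    and reg: "regular (matrix_poly m k A)"
  shows "graded_regular_right_factor m k (matrix_poly m k A) (pencil C D) \<longleftrightarrow>
    (\<exists>q. cofactor_coeffs m k A C D q)"
proof
  assume "graded_regular_right_factor m k (matrix_poly m k A) (pencil C D)"
  then obtain Q where Q: "Q \<in> carrier_mat m m" and eq: "matrix_poly m k A = Q * pencil C D"
    and z: "\<And>r c l. r < m \<Longrightarrow> c < m \<Longrightarrow> k \<le> l \<Longrightarrow> coeff (Q $$ (r, c)) l = 0"
    unfolding graded_regular_right_factor_def by blast
  have "coeff_mat l Q = 0\<^sub>m m m" if "k \<le> l" for l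
    using z[OF _ _ that] Q by (intro eq_matI) (auto simp: coeff_mat_def)
  then show "\<exists>q. cofactor_coeffs m k A C D q"
    using eq matrix_poly_eq_mult_pencil_iff[of k A m C D Q, OF _ C D Q] A Q
    unfolding cofactor_coeffs_def by (intro exI[of _ "\<lambda>l. coeff_mat l Q"]) auto
next
  assume "\<exists>q. cofactor_coeffs m k A C D q"
  then obtain q where q: "cofactor_coeffs m k A C D q" ..
  let ?Q = "matrix_poly m k q"
  have eq: "matrix_poly m k A = ?Q * pencil C D" by (rule cofactor_coeffs_matrix_poly(1)[OF A C D q])
  have cq: "coeff_mat l ?Q = q l" for l by (rule cofactor_coeffs_matrix_poly(2)[OF A C D q])
  \<comment> \<open>Regularity of the factor is inherited from P through the determinant.\<close>
  have "det (matrix_poly m k A) = det ?Q * det (pencil C D)"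
    unfolding eq by (rule det_mult[of _ m]) (use C D in auto)
  then have "regular (pencil C D)" using reg C D unfolding regular_def by auto
  moreover have "coeff (?Q $$ (r, c)) l = 0" if "r < m" "c < m" "k \<le> l" for r c l
  proof -
    have "coeff (?Q $$ (r, c)) l = coeff_mat l ?Q $$ (r, c)"
      using that unfolding coeff_mat_def by (simp add: matrix_poly_def)
    also have "\<dots> = 0" unfolding cq using q that unfolding cofactor_coeffs_def by auto
    finally show ?thesis .
  qed
  ultimately show "graded_regular_right_factor m k (matrix_poly m k A) (pencil C D)"
    unfolding graded_regular_right_factor_def using eq C D
    by (intro conjI bexI[of _ ?Q]) auto
qed

text \<open>The recurrences for the T part and the Z part, solved separately by x and y, are the two
  column blocks of the recurrence for Q in the basis [X, Y]; h_l = [x_l, y_l] [X, Y]^(-1) puts them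
  together.\<close>

lemma null_pair_cofactor:
  assumes A: "\<And>i. i \<le> k \<Longrightarrow> A i \<in> carrier_mat m m"
    and pq: "p + q = m" and np: "null_pair m k A p q X Y T Z" and W: "inverse_mats m (hcat X Y) W'"
    and S1: "S1 \<in> carrier_mat m m" and S2: "S2 \<in> carrier_mat m m"
    and eq1: "S1 * hcat X Y = hcat X Y * (T \<oplus>\<^sub>m 1\<^sub>m q)"
    and eq2: "S2 * hcat X Y = hcat X Y * (1\<^sub>m p \<oplus>\<^sub>m Z)"
  obtains h where "cofactor_coeffs m k A S2 (- S1) h"
proof -
  let ?H = "hcat X Y"
  note c = null_pairD(1-4)[OF np]
  obtain x where x: "\<And>l. x l \<in> carrier_mat m p" "\<And>l. k \<le> l \<Longrightarrow> x l = 0\<^sub>m m p"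
    "A 0 * X = - (x 0 * T)" "\<And>l. l < k \<Longrightarrow> A (Suc l) * X = x l - x (Suc l) * T"
    using finite_part_sequence_exists[of k A m X p T] A c null_pairD(5)[OF np] by blast
  obtain y where y: "\<And>l. y l \<in> carrier_mat m q" "\<And>l. k \<le> l \<Longrightarrow> y l = 0\<^sub>m m q"
    "A 0 * Y = - y 0" "\<And>l. l < k \<Longrightarrow> A (Suc l) * Y = y l * Z - y (Suc l)"
    using infinite_part_sequence_exists[of k A m Y q Z] A c null_pairD(6)[OF np] by blast
  note d = carrier_matD[OF c(1)] carrier_matD[OF c(2)] carrier_matD[OF c(3)] carrier_matD[OF c(4)]
    carrier_matD[OF S1] carrier_matD[OF S2] carrier_matD[OF x(1)] carrier_matD[OF y(1)]
  note dW = inverse_matsD[OF W]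
  define h where "h l = hcat (x l) (y l) * W'" for l
  have xy: "hcat (x l) (y l) \<in> carrier_mat m m" for l using hcat_carrier[OF x(1) y(1)] pq by simp
  have h: "h l \<in> carrier_mat m m" for l unfolding h_def by (rule mult_carrier_mat[OF xy dW(2)])
  have W1: "W' * S1 = (T \<oplus>\<^sub>m 1\<^sub>m q) * W'" and W2: "W' * S2 = (1\<^sub>m p \<oplus>\<^sub>m Z) * W'"
  proof -
    have *: "W' * S = B * W'" if "S * ?H = ?H * B" "S \<in> carrier_mat m m" "B \<in> carrier_mat m m" for S B
    proof -
      have "W' * S = W' * (S * ?H * W')"
        using inverse_mats_cancel_right(1)[OF W, of S] that by simp
      also have "\<dots> = W' * (?H * (B * W'))"
        unfolding that(1) using carrier_matD[OF that(3)] dW(5-) by (simp add: mult_mat_assoc)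
      also have "\<dots> = B * W'" using inverse_mats_cancel(2)[OF W] that by simp
      finally show ?thesis .
    qed
    show "W' * S1 = (T \<oplus>\<^sub>m 1\<^sub>m q) * W'" by (rule *[OF eq1 S1]) (use c pq in auto)
    show "W' * S2 = (1\<^sub>m p \<oplus>\<^sub>m Z) * W'" by (rule *[OF eq2 S2]) (use c pq in auto)
  qed
  have AH: "A i = hcat (A i * X) (A i * Y) * W'" if "i \<le> k" for i
  proof -
    have "A i = A i * ?H * W'" using inverse_mats_cancel_right(1)[OF W, of "A i"] A[OF that] by simp
    then show ?thesis using A[OF that] d by (simp add: mult_hcat)
  qed
  have hS1: "h l * S1 = hcat (x l * T) (y l) * W'" for l
  proof -
    have "h l * S1 = hcat (x l) (y l) * (W' * S1)"
      unfolding h_def using dW(5-) d pq by (intro mult_mat_assoc) auto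
    also have "\<dots> = hcat (x l) (y l) * (T \<oplus>\<^sub>m 1\<^sub>m q) * W'"
      unfolding W1 using dW(5-) d pq by (intro mult_mat_assoc[symmetric]) auto
    finally show ?thesis using d by (simp add: hcat_block_sum)
  qed
  have hS2: "h l * S2 = hcat (x l) (y l * Z) * W'" for l
  proof -
    have "h l * S2 = hcat (x l) (y l) * (W' * S2)"
      unfolding h_def using dW(5-) d pq by (intro mult_mat_assoc) auto
    also have "\<dots> = hcat (x l) (y l) * (1\<^sub>m p \<oplus>\<^sub>m Z) * W'"
      unfolding W2 using dW(5-) d pq by (intro mult_mat_assoc[symmetric]) auto
    finally show ?thesis using d by (simp add: hcat_block_sum)
  qed
  have "cofactor_coeffs m k A S2 (- S1) h"
    unfolding cofactor_coeffs_def
  proof (intro conjI allI impI)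
    show "h l \<in> carrier_mat m m" for l by (rule h)
    show "h l = 0\<^sub>m m m" if "k \<le> l" for l
      unfolding h_def x(2)[OF that] y(2)[OF that] hcat_zero pq using dW by simp
    have "A 0 = hcat (- (x 0 * T)) (- y 0) * W'" using AH[of 0] x(3) y(3) by simp
    also have "\<dots> = - (hcat (x 0 * T) (y 0)) * W'" using d by (simp add: uminus_hcat)
    also have "\<dots> = - (h 0 * S1)" unfolding hS1 using d dW(5-) pq by simp
    also have "\<dots> = h 0 * - S1" using d carrier_matD[OF h] by simp
    finally show "A 0 = h 0 * - S1" .
    show "A (Suc l) = h l * S2 + h (Suc l) * - S1" if "l < k" for l
    proof -
      have c1: "hcat (x l) (y l * Z) \<in> carrier_mat m m" "hcat (x (Suc l) * T) (y (Suc l)) \<in> carrier_mat m m"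
        using hcat_carrier[OF x(1) mult_carrier_mat[OF y(1) c(4)]]
          hcat_carrier[OF mult_carrier_mat[OF x(1) c(2)] y(1)] pq by auto
      have "A (Suc l) = hcat (x l - x (Suc l) * T) (y l * Z - y (Suc l)) * W'"
        using AH[of "Suc l"] x(4)[OF that] y(4)[OF that] that by simp
      also have "\<dots> = (hcat (x l) (y l * Z) - hcat (x (Suc l) * T) (y (Suc l))) * W'"
        using d by (simp add: hcat_diff)
      also have "\<dots> = h l * S2 - h (Suc l) * S1"
        unfolding hS1 hS2 by (rule minus_mult_distrib_mat[OF c1 dW(2)])
      also have "\<dots> = h l * S2 + - (h (Suc l) * S1)"
        by (rule minus_add_uminus_mat[OF mult_carrier_mat[OF h S2] mult_carrier_mat[OF h S1]])
      finally show ?thesis using d carrier_matD[OF h] by simp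
    qed
  qed
  with that show ?thesis .
qed

text \<open>The cofactor recurrence makes \<lambda> S2 - S1 a right factor of P, so its determinant
  divides the nonzero det P.\<close>

lemma separable_bisolvent_regular:
  assumes A: "\<And>i. i \<le> k \<Longrightarrow> A i \<in> carrier_mat m m" and reg: "regular (matrix_poly m k A)"
    and sep: "separable_bisolvent m k A S1 S2"
  obtains h where "cofactor_coeffs m k A S2 (- S1) h" "regular (pencil S2 (- S1))"
proof -
  obtain E where bis: "bisolvent m k A S1 S2" and E: "separated_by m E S1 S2"
    using sep unfolding separable_bisolvent_def by auto
  have S: "S1 \<in> carrier_mat m m" "S2 \<in> carrier_mat m m" using bis unfolding bisolvent_def by auto
  obtain p q X Y T Z W' where c: "p + q = m" "null_pair m k A p q X Y T Z" "inverse_mats m (hcat X Y) W'"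
    "S1 * hcat X Y = hcat X Y * (T \<oplus>\<^sub>m 1\<^sub>m q)" "S2 * hcat X Y = hcat X Y * (1\<^sub>m p \<oplus>\<^sub>m Z)"
    using separable_coordinates[of k A m, OF _ bis E] A by metis
  obtain h where h: "cofactor_coeffs m k A S2 (- S1) h"
    using null_pair_cofactor[of k A m, OF _ c(1,2,3) S c(4,5)] A by blast
  have "graded_regular_right_factor m k (matrix_poly m k A) (pencil S2 (- S1))"
    using graded_factor_iff[of k A m, OF _ S(2) _ reg, of "- S1"] A S h by auto
  then show ?thesis using that[OF h] unfolding graded_regular_right_factor_def by auto
qed

text \<open>After multiplication by [X, Y] the coefficient recurrence for f involves only f_l * U.
  The two column blocks of this product obey the recurrences that telescope to the null
  equations.\<close>

lemma cofactor_null_pair: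
  assumes A: "\<And>i. i \<le> k \<Longrightarrow> A i \<in> carrier_mat m m"
    and C: "C \<in> carrier_mat m m" and D: "D \<in> carrier_mat m m"
    and f: "cofactor_coeffs m k A C D f"
    and pq: "p + q = m" and T: "T \<in> carrier_mat p p" and Z: "Z \<in> carrier_mat q q"
    and U: "U \<in> carrier_mat m m" and X: "X \<in> carrier_mat m p" and Y: "Y \<in> carrier_mat m q"
    and CW: "C * hcat X Y = U * (1\<^sub>m p \<oplus>\<^sub>m Z)" and DW: "D * hcat X Y = - (U * (T \<oplus>\<^sub>m 1\<^sub>m q))"
  shows "null_pair m k A p q X Y T Z"
proof -
  have fc: "f l \<in> carrier_mat m m" for l using f unfolding cofactor_coeffs_def by auto
  have "\<exists>x y. f l * U = hcat x y \<and> x \<in> carrier_mat m p \<and> y \<in> carrier_mat m q" for l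
    using hcat_split[of "f l * U" m p q] mult_carrier_mat[OF fc U] pq by metis
  then obtain x y where xy: "\<And>l. f l * U = hcat (x l) (y l)" "\<And>l. x l \<in> carrier_mat m p"
    "\<And>l. y l \<in> carrier_mat m q" by metis
  note d = carrier_matD[OF T] carrier_matD[OF Z] carrier_matD[OF X] carrier_matD[OF Y]
    carrier_matD[OF C] carrier_matD[OF D] carrier_matD[OF U] carrier_matD[OF fc]
    carrier_matD[OF xy(2)] carrier_matD[OF xy(3)]
  have fC: "f l * C * hcat X Y = hcat (x l) (y l * Z)" for l
  proof -
    have "f l * C * hcat X Y = f l * (C * hcat X Y)" using d by (intro mult_mat_assoc) auto
    also have "\<dots> = f l * U * (1\<^sub>m p \<oplus>\<^sub>m Z)" unfolding CW using d pq by (intro mult_mat_assoc[symmetric]) auto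
    finally show ?thesis unfolding xy(1) using d by (simp add: hcat_block_sum)
  qed
  have fD: "f l * D * hcat X Y = - hcat (x l * T) (y l)" for l
  proof -
    have "f l * D * hcat X Y = f l * (D * hcat X Y)" using d by (intro mult_mat_assoc) auto
    also have "\<dots> = - (f l * (U * (T \<oplus>\<^sub>m 1\<^sub>m q)))" unfolding DW using d pq by simp
    also have "f l * (U * (T \<oplus>\<^sub>m 1\<^sub>m q)) = f l * U * (T \<oplus>\<^sub>m 1\<^sub>m q)"
      using d pq by (intro mult_mat_assoc[symmetric]) auto
    finally show ?thesis unfolding xy(1) using d by (simp add: hcat_block_sum)
  qed
  have "hcat (x k) (y k) = hcat (0\<^sub>m m p) (0\<^sub>m m q)"
    using f U unfolding xy(1)[symmetric] hcat_zero pq cofactor_coeffs_def by simp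
  from hcat_eqD[OF this] have xk: "x k = 0\<^sub>m m p" "y k = 0\<^sub>m m q" using d by simp_all
  have "hcat (A 0 * X) (A 0 * Y) = f 0 * D * hcat X Y"
    using f A[of 0] d unfolding cofactor_coeffs_def by (simp add: mult_hcat[symmetric])
  also have "\<dots> = hcat (- (x 0 * T)) (- y 0)" unfolding fD using d by (simp add: uminus_hcat)
  finally have e0: "hcat (A 0 * X) (A 0 * Y) = hcat (- (x 0 * T)) (- y 0)" .
  have x0: "A 0 * X = - (x 0 * T)" "A 0 * Y = - y 0" using hcat_eqD[OF e0] A[of 0] d by simp_all
  have xs: "A (Suc l) * X = x l - x (Suc l) * T \<and> A (Suc l) * Y = y l * Z - y (Suc l)" if l: "l < k" for l
  proof -
    have A': "A (Suc l) \<in> carrier_mat m m" using A l by auto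
    have "hcat (A (Suc l) * X) (A (Suc l) * Y) = A (Suc l) * hcat X Y"
      using A' d by (intro mult_hcat[symmetric]) auto
    also have "\<dots> = (f l * C + f (Suc l) * D) * hcat X Y"
      using f l unfolding cofactor_coeffs_def by simp
    also have "\<dots> = f l * C * hcat X Y + f (Suc l) * D * hcat X Y"
      by (rule add_mult_distrib_mat[OF mult_carrier_mat[OF fc C] mult_carrier_mat[OF fc D] hcat_carrier[OF X Y]])
    also have "\<dots> = hcat (x l) (y l * Z) - hcat (x (Suc l) * T) (y (Suc l))"
      unfolding fC fD using d by (intro eq_matI) auto
    also have "\<dots> = hcat (x l - x (Suc l) * T) (y l * Z - y (Suc l))" using d by (intro hcat_diff) auto
    finally have e: "hcat (A (Suc l) * X) (A (Suc l) * Y) = hcat (x l - x (Suc l) * T) (y l * Z - y (Suc l))" .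
    show ?thesis using hcat_eqD[OF e] A' d by simp
  qed
  show ?thesis
    unfolding null_pair_def
  proof (intro conjI X T Y Z)
    show "mat_sum m p (\<lambda>i. A i * X * (T ^\<^sub>m i)) {..k} = 0\<^sub>m m p"
      by (rule finite_part_sequence[where x = x and k = k and A = A, OF A X T xy(2) xk(1) x0(1)]) (use xs in auto)
    show "mat_sum m q (\<lambda>i. A i * Y * (Z ^\<^sub>m (k - i))) {..k} = 0\<^sub>m m q"
      by (rule infinite_part_sequence[where y = y and k = k and A = A, OF A Y Z xy(3) xk(2) x0(2)]) (use xs in auto)
  qed
qed

text \<open>A splitting gives C = U (I \<oplus> Z) W^(-1) and -D = U (T \<oplus> I) W^(-1). The
  factor G = W U^(-1) turns both into conjugates of the blocks by the same W, and \<lambda> S2 - S1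
  = G (\<lambda> C + D) dictates the signs. Conversely, cofactor coefficients for G times the pencil
  become coefficients for the pencil itself when multiplied by G on the right.\<close>

lemma graded_factor_iff_separable:
  assumes A: "\<And>i. i \<le> k \<Longrightarrow> A i \<in> carrier_mat m m" and reg: "regular (matrix_poly m k A)"
    and C: "C \<in> carrier_mat m m" and D: "D \<in> carrier_mat m m"
  shows "graded_regular_right_factor m k (matrix_poly m k A) (pencil C D) \<longleftrightarrow>
    (\<exists>G \<in> carrier_mat m m. invertible_mat G \<and> separable_bisolvent m k A (- (G * D)) (G * C))"
proof
  assume fac: "graded_regular_right_factor m k (matrix_poly m k A) (pencil C D)"
  then obtain \<alpha> where \<alpha>: "det (\<alpha> \<cdot>\<^sub>m C + D) \<noteq> 0"
    unfolding graded_regular_right_factor_def using regular_pencil_iff[OF C D] by auto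
  obtain f where f: "cofactor_coeffs m k A C D f"
    using graded_factor_iff[of k A m, OF _ C D reg] A fac by blast
  obtain p q T Z U U' W W' where pq: "p + q = m" and T: "T \<in> carrier_mat p p" and Z: "Z \<in> carrier_mat q q"
    and U: "inverse_mats m U U'" and W: "inverse_mats m W W'"
    and CW: "C * W = U * (1\<^sub>m p \<oplus>\<^sub>m Z)" and DW: "D * W = - (U * (T \<oplus>\<^sub>m 1\<^sub>m q))"
    using pencil_split[OF C D \<alpha>, of UNIV] by (metis UNIV_I)
  note dU = inverse_matsD[OF U] and dW = inverse_matsD[OF W]
  have "W \<in> carrier_mat m (p + q)" using dW pq by simp
  then obtain X Y where XY: "W = hcat X Y" "X \<in> carrier_mat m p" "Y \<in> carrier_mat m q"
    using hcat_split by metis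
  have np: "null_pair m k A p q X Y T Z"
    by (rule cofactor_null_pair[OF A C D f pq T Z dU(1) XY(2,3) CW[unfolded XY(1)] DW[unfolded XY(1)]])
  let ?G = "W * U'"
  have G: "?G \<in> carrier_mat m m" using dW dU by simp
  note d = carrier_matD[OF T] carrier_matD[OF Z] carrier_matD[OF C] carrier_matD[OF D]
  have GU: "?G * (U * B) = W * B" if "dim_row B = m" for B
  proof -
    have "?G * (U * B) = W * (U' * (U * B))" using dU(5-) dW(5-) that by (intro mult_mat_assoc) auto
    then show ?thesis using inverse_mats_cancel(2)[OF U that] by simp
  qed
  have e2: "?G * C * W = W * (1\<^sub>m p \<oplus>\<^sub>m Z)"
  proof -
    have "?G * C * W = ?G * (C * W)" using d dU(5-) dW(5-) by (intro mult_mat_assoc) auto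
    then show ?thesis unfolding CW using GU d pq by simp
  qed
  have e1: "- (?G * D) * W = W * (T \<oplus>\<^sub>m 1\<^sub>m q)"
  proof -
    have "- (?G * D) * W = - (?G * (D * W))"
      using d dU(5-) dW(5-) by (simp add: mult_mat_assoc)
    also have "?G * (D * W) = - (?G * (U * (T \<oplus>\<^sub>m 1\<^sub>m q)))"
      unfolding DW using dU(5-) dW(5-) d pq by simp
    finally show ?thesis using GU[of "T \<oplus>\<^sub>m 1\<^sub>m q"] d pq by simp
  qed
  have "separable_bisolvent m k A (- (?G * D)) (?G * C)"
    by (rule null_pair_separable[OF A pq np W[unfolded XY(1)]])
      (use G C D e1 e2 in \<open>simp_all add: XY(1)[symmetric]\<close>)
  moreover have "invertible_mat ?G"
    by (rule inverse_mats_imp_invertible[OF inverse_mats_mult[OF W inverse_mats_sym[OF U]]])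
  ultimately show "\<exists>G \<in> carrier_mat m m. invertible_mat G \<and> separable_bisolvent m k A (- (G * D)) (G * C)"
    using G by blast
next
  assume "\<exists>G \<in> carrier_mat m m. invertible_mat G \<and> separable_bisolvent m k A (- (G * D)) (G * C)"
  then obtain G where G: "G \<in> carrier_mat m m" and sep: "separable_bisolvent m k A (- (G * D)) (G * C)" by blast
  obtain h where h: "cofactor_coeffs m k A (G * C) (- (- (G * D))) h"
    using separable_bisolvent_regular[of k A m, OF _ reg sep] A by blast
  have hc: "h l \<in> carrier_mat m m" for l using h unfolding cofactor_coeffs_def by auto
  have as: "h l * (G * B) = h l * G * B" if "B \<in> carrier_mat m m" for l B
    using carrier_matD[OF hc] carrier_matD[OF G] carrier_matD[OF that] by (intro mult_mat_assoc[symmetric]) auto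
  have "cofactor_coeffs m k A C D (\<lambda>l. h l * G)"
    unfolding cofactor_coeffs_def
  proof (intro conjI allI impI)
    show "h l * G \<in> carrier_mat m m" for l by (rule mult_carrier_mat[OF hc G])
    show "k \<le> l \<Longrightarrow> h l * G = 0\<^sub>m m m" for l using h G unfolding cofactor_coeffs_def by simp
    show "A 0 = h 0 * G * D" using h unfolding cofactor_coeffs_def uminus_uminus_mat as[OF D] by simp
    show "A (Suc l) = h l * G * C + h (Suc l) * G * D" if "l < k" for l
      using h that unfolding cofactor_coeffs_def uminus_uminus_mat as[OF C] as[OF D] by simp
  qed
  then show "graded_regular_right_factor m k (matrix_poly m k A) (pencil C D)"
    using graded_factor_iff[of k A m, OF _ C D reg] A by blast
qed

text \<open>An invertible leading coefficient rules out cancellation of the top coefficients, so the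
  degree of the cofactor is automatically less than \<open>k\<close>.\<close>

lemma regular_factor_imp_graded:
  assumes A: "\<And>i. i \<le> k \<Longrightarrow> A i \<in> carrier_mat m m"
    and C: "C \<in> carrier_mat m m" and D: "D \<in> carrier_mat m m" and inv: "invertible_mat C"
    and fac: "regular_right_factor m (matrix_poly m k A) (pencil C D)"
  shows "graded_regular_right_factor m k (matrix_poly m k A) (pencil C D)"
proof -
  obtain Q where Q: "Q \<in> carrier_mat m m" and eq: "matrix_poly m k A = Q * pencil C D"
    using fac unfolding regular_right_factor_def by auto
  obtain C' where C': "inverse_mats m C C'" using invertible_imp_inverse_mats[OF inv C] .
  have rel: "coeff_mat l Q * C + coeff_mat (Suc l) Q * D = 0\<^sub>m m m" if "k \<le> l" for l
    using eq matrix_poly_eq_mult_pencil_iff[of k A m, OF _ C D Q] A that by auto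
  have down: "coeff_mat l Q = 0\<^sub>m m m" if "k \<le> l" "coeff_mat (Suc l) Q = 0\<^sub>m m m" for l
  proof -
    have cQ: "coeff_mat l Q \<in> carrier_mat m m" using Q by simp
    have "coeff_mat l Q * C = 0\<^sub>m m m"
      using rel[OF that(1)] D right_add_zero_mat[OF mult_carrier_mat[OF cQ C]] unfolding that(2) by simp
    then have "coeff_mat l Q = 0\<^sub>m m m * C'"
      using inverse_mats_cancel_right(1)[OF C' carrier_matD(2)[OF cQ]] by simp
    then show ?thesis using inverse_matsD[OF C'] by simp
  qed
  \<comment> \<open>A common bound for the degrees of the entries starts the descent;
    \<open>down\<close> carries vanishing from l + 1 to l as long as l \<ge> k.\<close>
  define N where "N = Max (insert 0 ((\<lambda>(r, c). degree (Q $$ (r, c))) ` ({..<m} \<times> {..<m})))"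
  have top: "coeff_mat l Q = 0\<^sub>m m m" if "N < l" for l
  proof (rule eq_matI)
    fix i j assume "i < dim_row (0\<^sub>m m m :: complex mat)" "j < dim_col (0\<^sub>m m m :: complex mat)"
    then have ij: "i < m" "j < m" by auto
    have "degree (Q $$ (i, j)) \<le> N" unfolding N_def using ij by (intro Max_ge) auto
    then have "coeff (Q $$ (i, j)) l = 0" using that by (intro coeff_eq_0) simp
    then show "coeff_mat l Q $$ (i, j) = 0\<^sub>m m m $$ (i, j)" using ij Q unfolding coeff_mat_def by simp
  qed (use Q in auto)
  have all: "coeff_mat l Q = 0\<^sub>m m m" if "k \<le> l" for l
  proof (cases "N < l")
    case False
    then have "l \<le> Suc N" by simp
    then show ?thesis using that
    proof (induction rule: inc_induct)
      case base
      then show ?case using top by simp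
    next
      case (step n)
      have "coeff_mat (Suc n) Q = 0\<^sub>m m m" using step.IH step.prems by simp
      with step.prems show ?case by (rule down)
    qed
  qed (rule top)
  have "coeff (Q $$ (r, c)) l = 0" if "r < m" "c < m" "k \<le> l" for r c l
    using arg_cong[OF all[OF that(3)], of "\<lambda>M. M $$ (r, c)"] that Q unfolding coeff_mat_def by simp
  then show ?thesis
    using fac Q eq unfolding regular_right_factor_def graded_regular_right_factor_def by blast
qed

subsection \<open>Restrictions of standard pairs\<close>

lemma block_row_controllability:
  assumes np: "null_pair m k A p q X Y T Z" and j: "j < k"
  shows "block_row m k j * controllability_mat m k X Y T Z = hcat (X * (T ^\<^sub>m j)) (Y * (Z ^\<^sub>m (k - 1 - j)))"
proof -
  note c = null_pairD(1-4)[OF np]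
  show ?thesis
    unfolding controllability_mat_stack using c
    by (intro block_row_mult_stack[OF j] hcat_carrier) auto
qed

text \<open>The first block of the controllability matrix is [X, Y Z^(k-1)] and the last is
  [X T^(k-1), Y]. After multiplication by [X, Y]^(-1) the first has the identity in its T corner and
  the last has it in its Z corner; H takes the T rows from the one and the Z rows from the
  other.\<close>

lemma controllability_left_inverse:
  assumes pq: "p + q = m" and np: "null_pair m k A p q X Y T Z" and W: "inverse_mats m (hcat X Y) W'"
    and k: "0 < k"
  obtains H where "H \<in> carrier_mat m (m * k)" "H * controllability_mat m k X Y T Z = 1\<^sub>m m"
proof -
  let ?\<Phi> = "controllability_mat m k X Y T Z"
  let ?F = "1\<^sub>m p \<oplus>\<^sub>m 0\<^sub>m q q :: complex mat" and ?F' = "0\<^sub>m p p \<oplus>\<^sub>m 1\<^sub>m q :: complex mat"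
  let ?H1 = "?F * W' * block_row m k 0" and ?H2 = "?F' * W' * block_row m k (k - 1)"
  note c = null_pairD(1-4)[OF np]
  note d = carrier_matD[OF c(1)] carrier_matD[OF c(2)] carrier_matD[OF c(3)] carrier_matD[OF c(4)]
  note dW = inverse_matsD[OF W]
  have \<Phi>: "?\<Phi> \<in> carrier_mat (m * k) m" using controllability_mat_carrier[OF np] pq by simp
  have H: "?H1 \<in> carrier_mat m (m * k)" "?H2 \<in> carrier_mat m (m * k)"
    using dW pq by (auto intro!: mult_carrier_mat[of _ m m])
  have W1: "W' * (hcat X Y * B) = B" if "dim_row B = m" for B
    using inverse_mats_cancel(2)[OF W that] .
  have "?H1 * ?\<Phi> = ?F * (W' * (block_row m k 0 * ?\<Phi>))"
    using carrier_matD[OF \<Phi>] dW(5-) pq by (simp add: mult_mat_assoc)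
  also have "block_row m k 0 * ?\<Phi> = hcat X Y * (1\<^sub>m p \<oplus>\<^sub>m (Z ^\<^sub>m (k - 1)))"
    using block_row_controllability[OF np k] d by (simp add: hcat_block_sum)
  also have "?F * (W' * \<dots>) = ?F"
    using W1[of "1\<^sub>m p \<oplus>\<^sub>m (Z ^\<^sub>m (k - 1))"] d pq by (simp add: block_sum_mult)
  finally have 1: "?H1 * ?\<Phi> = ?F" .
  have "?H2 * ?\<Phi> = ?F' * (W' * (block_row m k (k - 1) * ?\<Phi>))"
    using carrier_matD[OF \<Phi>] dW(5-) pq by (simp add: mult_mat_assoc)
  also have "block_row m k (k - 1) * ?\<Phi> = hcat X Y * ((T ^\<^sub>m (k - 1)) \<oplus>\<^sub>m 1\<^sub>m q)"
    using block_row_controllability[OF np, of "k - 1"] k d by (simp add: hcat_block_sum)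
  also have "?F' * (W' * \<dots>) = ?F'"
    using W1[of "(T ^\<^sub>m (k - 1)) \<oplus>\<^sub>m 1\<^sub>m q"] d pq by (simp add: block_sum_mult)
  finally have 2: "?H2 * ?\<Phi> = ?F'" .
  have "(?H1 + ?H2) * ?\<Phi> = ?F + ?F'"
    using add_mult_distrib_mat[OF H \<Phi>] unfolding 1 2 .
  also have "\<dots> = 1\<^sub>m m" using pq by (intro eq_matI) (auto simp: index_block_sum)
  finally show ?thesis using that[of "?H1 + ?H2"] H by simp
qed

text \<open>Both controllability matrices carry the companion pencil L to a block diagonal pencil: L
  \<Phi> = \<Psi> \<Delta> and L \<Phi>' = \<Psi>' \<Delta>'. As \<Phi> and \<Psi> are invertible,
  \<Theta> = \<Phi>^(-1) \<Phi>' and \<Omega> = \<Psi>^(-1) \<Psi>' satisfy \<Delta> \<Theta> =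
  \<Omega> \<Delta>'. A left inverse H of \<Phi>' yields the left inverse H \<Phi> of
  \<Theta>.\<close>

lemma null_pair_compare:
  assumes A: "\<And>i. i \<le> k \<Longrightarrow> A i \<in> carrier_mat m m" and reg: "regular (matrix_poly m k A)"
    and max: "maximal_standard_pair m k A p q X Y T Z"
    and np': "null_pair m k A p' q' X' Y' T' Z'"
    and H: "H \<in> carrier_mat (p' + q') (m * k)"
      "H * controllability_mat m k X' Y' T' Z' = 1\<^sub>m (p' + q')"
  obtains \<Theta> \<Omega> g \<alpha> where "\<Theta> \<in> carrier_mat (p + q) (p' + q')" "\<Omega> \<in> carrier_mat (p + q) (p' + q')"
    "(1\<^sub>m p \<oplus>\<^sub>m Z) * \<Theta> = \<Omega> * (1\<^sub>m p' \<oplus>\<^sub>m Z')" "(T \<oplus>\<^sub>m 1\<^sub>m q) * \<Theta> = \<Omega> * (T' \<oplus>\<^sub>m 1\<^sub>m q')"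
    "controllability_mat m k X Y T Z * \<Theta> = controllability_mat m k X' Y' T' Z'"
    "g \<in> carrier_mat (p' + q') (p + q)" "g * \<Theta> = 1\<^sub>m (p' + q')"
    "det (\<alpha> \<cdot>\<^sub>m (1\<^sub>m p \<oplus>\<^sub>m Z) + - (T \<oplus>\<^sub>m 1\<^sub>m q)) \<noteq> 0"
proof -
  let ?\<Phi> = "controllability_mat m k X Y T Z" and ?\<Phi>' = "controllability_mat m k X' Y' T' Z'"
  let ?n = "m * k" and ?n' = "p' + q'"
  let ?L1 = "companion1 m k A" and ?L0 = "companion0 m k A"
  let ?D1 = "1\<^sub>m p \<oplus>\<^sub>m Z" and ?D0 = "T \<oplus>\<^sub>m 1\<^sub>m q" and ?D1' = "1\<^sub>m p' \<oplus>\<^sub>m Z'" and ?D0' = "T' \<oplus>\<^sub>m 1\<^sub>m q'"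
  have np: "null_pair m k A p q X Y T Z" and pq: "p + q = ?n" and det\<Phi>: "det ?\<Phi> \<noteq> 0"
    using max unfolding maximal_standard_pair_iff by auto
  note c = null_pairD(1-4)[OF np] and c' = null_pairD(1-4)[OF np']
  have D: "?D1 \<in> carrier_mat ?n ?n" "?D0 \<in> carrier_mat ?n ?n"
    using c block_sum_carrier[OF one_carrier_mat c(4), of p] block_sum_carrier[OF c(2) one_carrier_mat, of q] pq
    by simp_all
  have D': "?D1' \<in> carrier_mat ?n' ?n'" "?D0' \<in> carrier_mat ?n' ?n'" using c' by auto
  have \<Phi>: "?\<Phi> \<in> carrier_mat ?n ?n" using controllability_mat_carrier[OF np] pq by simp
  have \<Phi>': "?\<Phi>' \<in> carrier_mat ?n ?n'" using controllability_mat_carrier[OF np'] .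
  obtain \<Phi>i where \<Phi>i: "inverse_mats ?n ?\<Phi> \<Phi>i" using det_imp_inverse_mats[OF \<Phi> det\<Phi>] .
  obtain \<Psi> where \<Psi>: "\<Psi> \<in> carrier_mat ?n ?n" "?L1 * ?\<Phi> = \<Psi> * ?D1" "?L0 * ?\<Phi> = - (\<Psi> * ?D0)"
    using null_pair_intertwine[of k A m, OF _ np] A pq by metis
  obtain \<Psi>' where \<Psi>': "\<Psi>' \<in> carrier_mat ?n ?n'" "?L1 * ?\<Phi>' = \<Psi>' * ?D1'" "?L0 * ?\<Phi>' = - (\<Psi>' * ?D0')"
    using null_pair_intertwine[of k A m, OF _ np'] A by metis
  obtain \<alpha> where "det (peval m k A \<alpha>) \<noteq> 0" using regular_matrix_poly[of k A m] A reg by blast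
  then have detL: "det (\<alpha> \<cdot>\<^sub>m ?L1 + ?L0) \<noteq> 0" using companion_regular[of k A m] A by blast
  let ?P = "\<alpha> \<cdot>\<^sub>m ?D1 + - ?D0"
  have Dc: "?P \<in> carrier_mat ?n ?n" using D by simp
  have "(\<alpha> \<cdot>\<^sub>m ?L1 + ?L0) * ?\<Phi> = \<alpha> \<cdot>\<^sub>m (?L1 * ?\<Phi>) + ?L0 * ?\<Phi>"
    using add_mult_distrib_mat[OF smult_carrier_mat[OF companion_carrier(1)] companion_carrier(2) \<Phi>]
      mult_smult_assoc_mat[OF companion_carrier(1) \<Phi>] by simp
  also have "\<dots> = \<alpha> \<cdot>\<^sub>m (\<Psi> * ?D1) + \<Psi> * - ?D0"
    unfolding \<Psi>(2,3) using carrier_matD[OF \<Psi>(1)] carrier_matD[OF D(2)] by simp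
  also have "\<dots> = \<Psi> * ?P"
    using mult_add_distrib_mat[OF \<Psi>(1) smult_carrier_mat[OF D(1)] uminus_carrier_mat[OF D(2)]]
      mult_smult_distrib[OF \<Psi>(1) D(1)] by simp
  \<comment> \<open>At a point \<alpha> where P is invertible the left side is nonzero, which gives
    both the invertibility of \<Psi> and the regularity of the diagonal pencil.\<close>
  finally have "det (\<alpha> \<cdot>\<^sub>m ?L1 + ?L0) * det ?\<Phi> = det \<Psi> * det ?P"
    using det_mult[OF _ \<Phi>, of "\<alpha> \<cdot>\<^sub>m ?L1 + ?L0"] det_mult[OF \<Psi>(1) Dc] by simp
  then have det\<Psi>: "det \<Psi> \<noteq> 0" and detD: "det ?P \<noteq> 0" using detL det\<Phi> by auto
  obtain \<Psi>i where \<Psi>i: "inverse_mats ?n \<Psi> \<Psi>i" using det_imp_inverse_mats[OF \<Psi>(1) det\<Psi>] .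
  note d = carrier_matD[OF \<Phi>] carrier_matD[OF \<Phi>'] inverse_matsD(5-)[OF \<Phi>i] inverse_matsD(5-)[OF \<Psi>i]
    carrier_matD[OF \<Psi>'(1)] carrier_matD[OF D(1)] carrier_matD[OF D(2)] carrier_matD[OF D'(1)] carrier_matD[OF D'(2)]
    carrier_matD[OF H(1)]
  define \<Theta> where "\<Theta> = \<Phi>i * ?\<Phi>'"
  define \<Omega> where "\<Omega> = \<Psi>i * \<Psi>'"
  have \<Theta>: "\<Theta> \<in> carrier_mat ?n ?n'" and \<Omega>: "\<Omega> \<in> carrier_mat ?n ?n'"
    unfolding \<Theta>_def \<Omega>_def using mult_carrier_mat[OF inverse_matsD(2)[OF \<Phi>i] \<Phi>']
      mult_carrier_mat[OF inverse_matsD(2)[OF \<Psi>i] \<Psi>'(1)] by auto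
  have \<Phi>\<Theta>: "?\<Phi> * \<Theta> = ?\<Phi>'" unfolding \<Theta>_def using inverse_mats_cancel(1)[OF \<Phi>i] d by simp
  have tr: "G * \<Theta> = \<Omega> * G'"
    if "M * ?\<Phi> = \<Psi> * G" "M * ?\<Phi>' = \<Psi>' * G'" "M \<in> carrier_mat ?n ?n" "G \<in> carrier_mat ?n ?n"
      "G' \<in> carrier_mat ?n' ?n'" for M G G'
  proof -
    note d' = carrier_matD[OF that(3)] carrier_matD[OF that(4)] carrier_matD[OF that(5)] carrier_matD[OF \<Theta>]
    have "G * \<Theta> = \<Psi>i * (\<Psi> * (G * \<Theta>))" using inverse_mats_cancel(2)[OF \<Psi>i, of "G * \<Theta>"] d' by simp
    also have "\<Psi> * (G * \<Theta>) = M * ?\<Phi> * \<Theta>"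
      unfolding that(1) using d d' by (intro mult_mat_assoc[symmetric]) auto
    also have "\<dots> = M * ?\<Phi>'" using mult_mat_assoc[of M ?\<Phi> \<Theta>] d d' \<Phi>\<Theta> by simp
    also have "\<Psi>i * (M * ?\<Phi>') = \<Omega> * G'"
      unfolding that(2) \<Omega>_def using d d' by (intro mult_mat_assoc[symmetric]) auto
    finally show ?thesis .
  qed
  have 1: "?D1 * \<Theta> = \<Omega> * ?D1'" by (rule tr[OF \<Psi>(2) \<Psi>'(2) companion_carrier(1) D(1) D'(1)])
  have 2: "?D0 * \<Theta> = \<Omega> * ?D0'"
  proof (rule tr[OF _ _ uminus_carrier_mat[OF companion_carrier(2)] D(2) D'(2)])
    show "- ?L0 * ?\<Phi> = \<Psi> * ?D0" using \<Psi>(3) d by simp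
    show "- ?L0 * ?\<Phi>' = \<Psi>' * ?D0'" using \<Psi>'(3) d by simp
  qed
  have "H * ?\<Phi> * \<Theta> = H * (?\<Phi> * \<Theta>)" using d carrier_matD[OF \<Theta>] by (intro mult_mat_assoc) auto
  then have g: "H * ?\<Phi> * \<Theta> = 1\<^sub>m ?n'" unfolding \<Phi>\<Theta> H(2) .
  show ?thesis
    by (rule that[OF _ _ 1 2 \<Phi>\<Theta> _ g detD]) (use \<Theta> \<Omega> mult_carrier_mat[OF H(1) \<Phi>] pq in auto)
qed

lemma left_inverse_block_sum:
  fixes a d g :: "complex mat"
  assumes a: "a \<in> carrier_mat p p'" and d: "d \<in> carrier_mat q q'"
    and g: "g \<in> carrier_mat (p' + q') (p + q)" and eq: "g * (a \<oplus>\<^sub>m d) = 1\<^sub>m (p' + q')"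
  obtains ga gd where "ga \<in> carrier_mat p' p" "ga * a = 1\<^sub>m p'" "gd \<in> carrier_mat q' q" "gd * d = 1\<^sub>m q'"
proof -
  obtain g1 g2 g3 g4 where geq: "g = four_block_mat g1 g2 g3 g4"
    and gc: "g1 \<in> carrier_mat p' p" "g2 \<in> carrier_mat p' q" "g3 \<in> carrier_mat q' p" "g4 \<in> carrier_mat q' q"
    using four_block_split[OF g] .
  have "g * (a \<oplus>\<^sub>m d) = four_block_mat (g1 * a) (g2 * d) (g3 * a) (g4 * d)"
    unfolding geq block_sum_def using gc a d by (simp add: four_block_mult)
  then have "four_block_mat (g1 * a) (g2 * d) (g3 * a) (g4 * d) =
      four_block_mat (1\<^sub>m p') (0\<^sub>m p' q') (0\<^sub>m q' p') (1\<^sub>m q')"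
    unfolding eq by simp
  note e = four_block_eqD[OF this mult_carrier_mat[OF gc(1) a] mult_carrier_mat[OF gc(2) d]
      mult_carrier_mat[OF gc(3) a] mult_carrier_mat[OF gc(4) d] one_carrier_mat zero_carrier_mat
      zero_carrier_mat one_carrier_mat]
  show ?thesis by (rule that[OF gc(1) e(1) gc(4) e(4)])
qed

text \<open>By disjointness the intertwiner \<Theta> is a block sum of a and d. The diagonal blocks
  of its left inverse are left inverses of a and d, whose columns are therefore bases of invariant
  subspaces.\<close>

lemma null_pair_restricts:
  assumes A: "\<And>i. i \<le> k \<Longrightarrow> A i \<in> carrier_mat m m" and reg: "regular (matrix_poly m k A)" and k: "0 < k"
    and max: "maximal_standard_pair m k A p q X Y T Z"
    and pq': "p' + q' = m" and np': "null_pair m k A p' q' X' Y' T' Z'" and W: "inverse_mats m (hcat X' Y') W'"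
    and disj: "spectrally_disjoint T Z'" "spectrally_disjoint T' Z"
  obtains a d ga gd where "a \<in> carrier_mat p p'" "d \<in> carrier_mat q q'" "T * a = a * T'" "Z * d = d * Z'"
    "X * a = X'" "Y * d = Y'" "ga \<in> carrier_mat p' p" "ga * a = 1\<^sub>m p'" "gd \<in> carrier_mat q' q" "gd * d = 1\<^sub>m q'"
proof -
  have np: "null_pair m k A p q X Y T Z" using max unfolding maximal_standard_pair_iff by auto
  note c = null_pairD(1-4)[OF np] and c' = null_pairD(1-4)[OF np']
  note d = carrier_matD[OF c(1)] carrier_matD[OF c(2)] carrier_matD[OF c(3)] carrier_matD[OF c(4)]
    carrier_matD[OF c'(1)] carrier_matD[OF c'(2)] carrier_matD[OF c'(3)] carrier_matD[OF c'(4)]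
  obtain H where H: "H \<in> carrier_mat (p' + q') (m * k)" "H * controllability_mat m k X' Y' T' Z' = 1\<^sub>m (p' + q')"
    using controllability_left_inverse[OF pq' np' W k] unfolding pq' .
  obtain \<Theta> \<Omega> g where \<Theta>: "\<Theta> \<in> carrier_mat (p + q) (p' + q')" "\<Omega> \<in> carrier_mat (p + q) (p' + q')"
    "(1\<^sub>m p \<oplus>\<^sub>m Z) * \<Theta> = \<Omega> * (1\<^sub>m p' \<oplus>\<^sub>m Z')" "(T \<oplus>\<^sub>m 1\<^sub>m q) * \<Theta> = \<Omega> * (T' \<oplus>\<^sub>m 1\<^sub>m q')"
    and \<Phi>\<Theta>: "controllability_mat m k X Y T Z * \<Theta> = controllability_mat m k X' Y' T' Z'"
    and g: "g \<in> carrier_mat (p' + q') (p + q)" "g * \<Theta> = 1\<^sub>m (p' + q')"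
    using null_pair_compare[of k A m, OF _ reg max np' H] A by metis
  obtain a dd where ad: "a \<in> carrier_mat p p'" "dd \<in> carrier_mat q q'" "\<Theta> = a \<oplus>\<^sub>m dd"
    "T * a = a * T'" "Z * dd = dd * Z'"
    using intertwine_blocks[OF c(2,4) c'(2,4) \<Theta> disj] .
  obtain ga gd where gg: "ga \<in> carrier_mat p' p" "ga * a = 1\<^sub>m p'" "gd \<in> carrier_mat q' q" "gd * dd = 1\<^sub>m q'"
    using left_inverse_block_sum[OF ad(1,2) g(1) g(2)[unfolded ad(3)]] .
  have row: "hcat (X * (T ^\<^sub>m j) * a) (Y * (Z ^\<^sub>m (k - 1 - j)) * dd) =
      hcat (X' * (T' ^\<^sub>m j)) (Y' * (Z' ^\<^sub>m (k - 1 - j)))" if "j < k" for j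
  proof -
    have "hcat (X * (T ^\<^sub>m j) * a) (Y * (Z ^\<^sub>m (k - 1 - j)) * dd) =
        hcat (X * (T ^\<^sub>m j)) (Y * (Z ^\<^sub>m (k - 1 - j))) * \<Theta>"
      unfolding ad(3) using d carrier_matD[OF ad(1)] carrier_matD[OF ad(2)]
      by (intro hcat_block_sum[symmetric]) auto
    also have "\<dots> = block_row m k j * controllability_mat m k X Y T Z * \<Theta>"
      unfolding block_row_controllability[OF np that] ..
    also have "\<dots> = block_row m k j * (controllability_mat m k X Y T Z * \<Theta>)"
      using carrier_matD[OF controllability_mat_carrier[OF np]] carrier_matD[OF \<Theta>(1)]
      by (intro mult_mat_assoc) auto
    finally show ?thesis unfolding \<Phi>\<Theta> block_row_controllability[OF np' that] .
  qed
  \<comment> \<open>The first block row contains T^0 and the last contains Z^0, so the equation for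
    X is read off at j = 0 and the one for Y at j = k - 1.\<close>
  have Xa: "X * a = X'"
    using hcat_eqD(1)[OF row[OF k]] d carrier_matD[OF ad(1)] carrier_matD[OF ad(2)] by simp
  have Yd: "Y * dd = Y'"
    using hcat_eqD(2)[OF row[of "k - 1"]] k d carrier_matD[OF ad(1)] carrier_matD[OF ad(2)] by simp
  show ?thesis by (rule that[OF ad(1,2,4,5) Xa Yd gg])
qed

text \<open>A splitting of the companion pencil yields a null pair whose controllability matrix is
  the invertible W, and \<Lambda> is passed on to \<open>pencil_split\<close>. For k = 0 the pair is
  empty, since m * k = 0.\<close>

lemma maximal_pair_exists:
  assumes A: "\<And>i. i \<le> k \<Longrightarrow> A i \<in> carrier_mat m m" and reg: "regular (matrix_poly m k A)"
    and \<Lambda>: "0 \<in> \<Lambda>"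
  obtains p q X Y T Z where "maximal_standard_pair m k A p q X Y T Z"
    "\<And>t. eigenvalue T t \<Longrightarrow> t \<in> \<Lambda>" "\<And>z t. eigenvalue Z z \<Longrightarrow> t \<in> \<Lambda> \<Longrightarrow> t * z \<noteq> 1"
proof (cases "k = 0")
  case True
  let ?O = "0\<^sub>m 0 0 :: complex mat" and ?X = "0\<^sub>m m 0 :: complex mat"
  have np: "null_pair m k A 0 0 ?X ?X ?O ?O"
    unfolding null_pair_def by (auto intro!: eq_matI)
  have "det (controllability_mat m k ?X ?X ?O ?O) \<noteq> 0"
    using det_dim_zero[of "controllability_mat m k ?X ?X ?O ?O"] controllability_mat_carrier[OF np] True by simp
  then have "maximal_standard_pair m k A 0 0 ?X ?X ?O ?O"
    unfolding maximal_standard_pair_iff using np True by simp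
  moreover have "\<not> eigenvalue ?O t" for t
    using eigenvalue_imp_nonzero_dim[of ?O 0 t] by auto
  ultimately show ?thesis using that by blast
next
  case False
  then have k: "0 < k" by simp
  obtain \<alpha> where "det (peval m k A \<alpha>) \<noteq> 0" using regular_matrix_poly[of k A m] A reg by blast
  then have "det (\<alpha> \<cdot>\<^sub>m companion1 m k A + companion0 m k A) \<noteq> 0" using companion_regular[of k A m] A by blast
  from pencil_split[OF companion_carrier this \<Lambda>]
  obtain p q T Z U U' W W' where pq: "p + q = m * k" and T: "T \<in> carrier_mat p p" and Z: "Z \<in> carrier_mat q q"
    and U: "inverse_mats (m * k) U U'" and W: "inverse_mats (m * k) W W'"
    and eq: "companion1 m k A * W = U * (1\<^sub>m p \<oplus>\<^sub>m Z)" "companion0 m k A * W = - (U * (T \<oplus>\<^sub>m 1\<^sub>m q))"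
    and ev: "\<And>t. eigenvalue T t \<Longrightarrow> t \<in> \<Lambda>" "\<And>z t. eigenvalue Z z \<Longrightarrow> t \<in> \<Lambda> \<Longrightarrow> t * z \<noteq> 1"
    by metis
  obtain X Y where np: "null_pair m k A p q X Y T Z" and WX: "W = controllability_mat m k X Y T Z"
    using companion_split_null_pair[of k A m, OF _ k T Z _ _ eq] A inverse_matsD[OF U] inverse_matsD[OF W] pq
    by metis
  have "maximal_standard_pair m k A p q X Y T Z"
    unfolding maximal_standard_pair_iff using np pq inverse_mats_imp_det[OF W] WX by simp
  then show ?thesis using that ev by blast
qed

text \<open>The left inverse makes the columns independent. Their distinctness is a separate point,
  because linear independence is stated for the set of columns and would not notice a
  repetition.\<close>

lemma left_inverse_basis_mat:
  fixes a :: "complex mat"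
  assumes a: "a \<in> carrier_mat n c" and g: "g \<in> carrier_mat c n" and ga: "g * a = 1\<^sub>m c"
  shows "basis_mat n {a *\<^sub>v w | w. w \<in> carrier_vec c} a"
    and "VectorSpace.subspace class_ring {a *\<^sub>v w | w. w \<in> carrier_vec c} (module_vec TYPE(complex) n)"
proof -
  interpret vec_space "TYPE(complex)" n .
  have inj: "v = 0\<^sub>v c" if "v \<in> carrier_vec c" "a *\<^sub>v v = 0\<^sub>v n" for v
  proof -
    have "v = g * a *\<^sub>v v" unfolding ga using that(1) by simp
    also have "\<dots> = g *\<^sub>v (a *\<^sub>v v)" by (rule assoc_mult_mat_vec[OF g a that(1)])
    also have "\<dots> = 0\<^sub>v c" unfolding that(2) using g by auto
    finally show ?thesis .
  qed
  have dist: "distinct (cols a)"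
    unfolding distinct_conv_nth
  proof (intro allI impI)
    fix i j assume ij: "i < length (cols a)" "j < length (cols a)" "i \<noteq> j"
    then have ij': "i < c" "j < c" using a by auto
    show "cols a ! i \<noteq> cols a ! j"
    proof
      assume "cols a ! i = cols a ! j"
      then have "col a i = col a j" using ij by simp
      then have "g *\<^sub>v col a i = g *\<^sub>v col a j" by simp
      then have "col (g * a) i = col (g * a) j" using col_mult2[OF g a] ij' by simp
      then have "(1\<^sub>m c :: complex mat) $$ (i, i) = 1\<^sub>m c $$ (i, j)"
        unfolding ga using ij' by (metis col_one index_one_mat(1) index_unit_vec(1) zero_neq_one)
      then show False using ij' ij(3) by simp
    qed
  qed
  have ind: "lin_indpt (set (cols a))"
    using lin_depE[OF a _ dist] inj by blast
  have span: "span (set (cols a)) = {a *\<^sub>v w | w. w \<in> carrier_vec c}"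
    using col_space_eq[OF a] a unfolding col_space_def by auto
  show "basis_mat n {a *\<^sub>v w | w. w \<in> carrier_vec c} a"
    unfolding basis_mat_def using a dist ind span by auto
  have "set (cols a) \<subseteq> carrier_vec n" using a cols_dim by blast
  then show "VectorSpace.subspace class_ring {a *\<^sub>v w | w. w \<in> carrier_vec c} (module_vec TYPE(complex) n)"
    unfolding span[symmetric] by (intro span_is_subspace) simp
qed

lemma left_inverse_invariant_subspace:
  fixes a :: "complex mat"
  assumes a: "a \<in> carrier_mat n c" and g: "g \<in> carrier_mat c n" and ga: "g * a = 1\<^sub>m c"
    and T: "T \<in> carrier_mat n n" and T': "T' \<in> carrier_mat c c" and eq: "T * a = a * T'"
  shows "invariant_subspace T {a *\<^sub>v w | w. w \<in> carrier_vec c}"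
  unfolding invariant_subspace_def
proof (intro conjI ballI)
  show "VectorSpace.subspace class_ring {a *\<^sub>v w | w. w \<in> carrier_vec c} (module_vec TYPE(complex) (dim_row T))"
    using left_inverse_basis_mat(2)[OF a g ga] T by simp
  fix v assume "v \<in> {a *\<^sub>v w | w. w \<in> carrier_vec c}"
  then obtain w where w: "v = a *\<^sub>v w" "w \<in> carrier_vec c" by auto
  have "T *\<^sub>v v = T * a *\<^sub>v w" unfolding w(1) by (rule assoc_mult_mat_vec[OF T a w(2), symmetric])
  also have "\<dots> = a *\<^sub>v (T' *\<^sub>v w)" unfolding eq by (rule assoc_mult_mat_vec[OF a T' w(2)])
  finally show "T *\<^sub>v v \<in> {a *\<^sub>v w | w. w \<in> carrier_vec c}" using T' w(2) by auto
qed

lemma restrictionI: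
  assumes T: "T \<in> carrier_mat p p" and Z: "Z \<in> carrier_mat q q"
    and T': "T' \<in> carrier_mat p' p'" and Z': "Z' \<in> carrier_mat q' q'" and pq: "p' + q' = m"
    and a: "a \<in> carrier_mat p p'" and d: "d \<in> carrier_mat q q'" and eqs: "T * a = a * T'" "Z * d = d * Z'"
    and ga: "ga \<in> carrier_mat p' p" "ga * a = 1\<^sub>m p'" and gd: "gd \<in> carrier_mat q' q" "gd * d = 1\<^sub>m q'"
    and inv: "invertible_mat (hcat (X * a) (Y * d))"
  obtains V1 V2 where "restriction m X Y T Z V1 V2 (X * a) (Y * d) T' Z'"
proof -
  let ?V1 = "{a *\<^sub>v w | w. w \<in> carrier_vec p'}" and ?V2 = "{d *\<^sub>v w | w. w \<in> carrier_vec q'}"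
  have "restriction m X Y T Z ?V1 ?V2 (X * a) (Y * d) T' Z'"
    unfolding restriction_def
    using left_inverse_invariant_subspace[OF a ga T T' eqs(1)] left_inverse_invariant_subspace[OF d gd Z Z' eqs(2)]
      left_inverse_basis_mat(1)[OF a ga] left_inverse_basis_mat(1)[OF d gd] inv a d T Z T' Z' pq eqs
    by (intro conjI exI[of _ a] exI[of _ d]) auto
  then show ?thesis using that by blast
qed

section \<open>Weierstrass forms and subordination\<close>

lemma jordan_form_nilpotent:
  fixes Z :: "complex mat"
  assumes Z: "Z \<in> carrier_mat n n" and ev: "\<And>z. eigenvalue Z z \<Longrightarrow> z = 0"
  obtains ns P Q where "0 \<notin> set ns" "sum_list ns = n" "inverse_mats n P Q"
    "Z * P = P * jordan_matrix (map (\<lambda>s. (s, 0)) ns)"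
proof -
  obtain js P Q where js: "0 \<notin> fst ` set js" "sum_list (map fst js) = n" and P: "inverse_mats n P Q"
    and ZP: "Z * P = P * jordan_matrix js"
    using jordan_form[OF Z] .
  have J: "jordan_matrix js \<in> carrier_mat n n" using js(2) by (metis jordan_matrix_carrier)
  note d = inverse_matsD[OF P] carrier_matD[OF Z] carrier_matD[OF J]
  have "Z = Z * P * Q" by (simp add: inverse_mats_cancel_right(1)[OF P, of Z] d)
  then have "similar_mat Z (jordan_matrix js)"
    unfolding ZP using d Z J by (intro similar_matI[of _ _ P Q n]) auto
  then have cp: "char_poly Z = (\<Prod>(s, a)\<leftarrow>js. [:- a, 1:] ^ s)"
    using char_poly_similar jordan_matrix_char_poly by metis
  have "a = 0" if "(s, a) \<in> set js" for s a
  proof -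
    \<comment> \<open>A block of size 0 would leave no trace in the characteristic polynomial;
      positive size makes its label a root.\<close>
    have "s \<noteq> 0" using js(1) that by force
    then have "poly (\<Prod>(s, a)\<leftarrow>js. [:- a, 1:] ^ s) a = 0"
      using that by (induction js) auto
    then show ?thesis using ev eigenvalue_root_char_poly[OF Z] cp by metis
  qed
  then have "js = map (\<lambda>s. (s, 0)) (map fst js)" by (intro nth_equalityI) (auto simp: prod_eq_iff in_set_conv_nth)
  then show ?thesis using that[of "map fst js" P Q] js P ZP by auto
qed

lemma const_mat_conjugate_blocks:
  assumes E: "E \<in> carrier_mat n n" and F: "F \<in> carrier_mat n n" and pq: "p + q = n"
    and "C1 \<in> carrier_mat p p" "D1 \<in> carrier_mat p p" "C2 \<in> carrier_mat q q" "D2 \<in> carrier_mat q q"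
  shows "const_mat E * (pencil C1 D1 \<oplus>\<^sub>m pencil C2 D2) * const_mat F =
    pencil (E * (C1 \<oplus>\<^sub>m C2) * F) (E * (D1 \<oplus>\<^sub>m D2) * F)"
proof -
  have c: "C1 \<oplus>\<^sub>m C2 \<in> carrier_mat n n" "D1 \<oplus>\<^sub>m D2 \<in> carrier_mat n n" using assms by auto
  show ?thesis
    unfolding pencil_block_sum[OF assms(4-7)] const_mat_mult_pencil[OF E c]
    by (rule pencil_mult_const_mat[OF mult_carrier_mat[OF E c(1)] mult_carrier_mat[OF E c(2)] F])
qed

text \<open>The Jordan bases are absorbed into the splitting: (P \<oplus> Q)^(-1) U^(-1) on the left
  and W (P \<oplus> Q) on the right bring the pencil to Weierstrass form.\<close>

lemma weierstrass_form_of_split: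
  assumes C: "C \<in> carrier_mat n n" and D: "D \<in> carrier_mat n n" and pq: "p + q = n"
    and T: "T \<in> carrier_mat p p" and Z: "Z \<in> carrier_mat q q"
    and U: "inverse_mats n U U'" and W: "inverse_mats n W W'"
    and CW: "C * W = U * (1\<^sub>m p \<oplus>\<^sub>m Z)" and DW: "D * W = - (U * (T \<oplus>\<^sub>m 1\<^sub>m q))"
    and js: "0 \<notin> fst ` set js" "sum_list (map fst js) = p"
    and P: "inverse_mats p P P'" "T * P = P * jordan_matrix js"
    and ns: "0 \<notin> set ns" "sum_list ns = q"
    and Q: "inverse_mats q Q Q'" "Z * Q = Q * jordan_matrix (map (\<lambda>s. (s, 0)) ns)"
  shows "weierstrass_form (pencil C D) js ns"
proof -
  let ?J = "jordan_matrix js" and ?N = "jordan_matrix (map (\<lambda>s. (s, 0)) ns) :: complex mat"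
  have J: "?J \<in> carrier_mat p p" using jordan_matrix_carrier[of js] js(2) by simp
  have N: "?N \<in> carrier_mat q q"
    using jordan_matrix_carrier[of "map (\<lambda>s. (s, 0 :: complex)) ns"] ns(2) by (simp add: comp_def)
  have PQ: "inverse_mats n (P \<oplus>\<^sub>m Q) (P' \<oplus>\<^sub>m Q')" using inverse_mats_block_sum[OF P(1) Q(1)] pq by simp
  let ?E = "(P' \<oplus>\<^sub>m Q') * U'" and ?F = "W * (P \<oplus>\<^sub>m Q)"
  have E: "inverse_mats n ?E (U * (P \<oplus>\<^sub>m Q))"
    using inverse_mats_mult[OF inverse_mats_sym[OF PQ] inverse_mats_sym[OF U]] .
  have F: "inverse_mats n ?F ((P' \<oplus>\<^sub>m Q') * W')" using inverse_mats_mult[OF W PQ] .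
  note d = inverse_matsD(5-)[OF U] inverse_matsD(5-)[OF W] inverse_matsD(5-)[OF P(1)] inverse_matsD(5-)[OF Q(1)]
    carrier_matD[OF C] carrier_matD[OF D] carrier_matD[OF T] carrier_matD[OF Z] carrier_matD[OF J] carrier_matD[OF N]
  have PTP: "P' * (T * P) = ?J" unfolding P(2) by (rule inverse_mats_cancel(2)[OF P(1) carrier_matD(1)[OF J]])
  have QZQ: "Q' * (Z * Q) = ?N" unfolding Q(2) by (rule inverse_mats_cancel(2)[OF Q(1) carrier_matD(1)[OF N]])
  have conj: "?E * M * ?F = (P' \<oplus>\<^sub>m Q') * (B * (P \<oplus>\<^sub>m Q))"
    if MW: "M * W = U * B" and "M \<in> carrier_mat n n" "B \<in> carrier_mat n n" for M B
  proof -
    note d' = carrier_matD[OF that(2)] carrier_matD[OF that(3)]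
    have "?E * M * ?F = (P' \<oplus>\<^sub>m Q') * (U' * (M * W * (P \<oplus>\<^sub>m Q)))"
      by (simp add: d d' pq mult_mat_assoc)
    also have "U' * (M * W * (P \<oplus>\<^sub>m Q)) = U' * (U * (B * (P \<oplus>\<^sub>m Q)))"
      unfolding MW by (simp add: d d' pq mult_mat_assoc)
    also have "\<dots> = B * (P \<oplus>\<^sub>m Q)" by (simp add: inverse_mats_cancel(2)[OF U, of "B * (P \<oplus>\<^sub>m Q)"] d')
    finally show ?thesis .
  qed
  have EC: "?E * C * ?F = 1\<^sub>m p \<oplus>\<^sub>m ?N"
  proof -
    have "?E * C * ?F = (P' \<oplus>\<^sub>m Q') * ((1\<^sub>m p \<oplus>\<^sub>m Z) * (P \<oplus>\<^sub>m Q))"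
      by (rule conj[OF CW C]) (use Z pq in auto)
    also have "\<dots> = (P' * P) \<oplus>\<^sub>m (Q' * (Z * Q))" by (simp add: d block_sum_mult)
    finally show ?thesis unfolding QZQ using inverse_matsD(4)[OF P(1)] by simp
  qed
  have ED: "?E * D * ?F = - ?J \<oplus>\<^sub>m - 1\<^sub>m q"
  proof -
    have TT: "T \<oplus>\<^sub>m 1\<^sub>m q \<in> carrier_mat n n" using T pq by auto
    have "?E * D * ?F = (P' \<oplus>\<^sub>m Q') * (- (T \<oplus>\<^sub>m 1\<^sub>m q) * (P \<oplus>\<^sub>m Q))"
      by (rule conj[OF _ D uminus_carrier_mat[OF TT]]) (use DW d pq in simp)
    also have "\<dots> = - ((P' * (T * P)) \<oplus>\<^sub>m (Q' * Q))" by (simp add: d block_sum_mult)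
    also have "\<dots> = - (?J \<oplus>\<^sub>m 1\<^sub>m q)" unfolding PTP using inverse_matsD(4)[OF Q(1)] by simp
    finally show ?thesis by (simp add: uminus_block_sum)
  qed
  have "const_mat ?E * pencil C D * const_mat ?F = pencil (?E * C * ?F) (?E * D * ?F)"
    unfolding const_mat_mult_pencil[OF inverse_matsD(1)[OF E] C D]
    by (rule pencil_mult_const_mat[OF mult_carrier_mat[OF inverse_matsD(1)[OF E] C]
          mult_carrier_mat[OF inverse_matsD(1)[OF E] D] inverse_matsD(1)[OF F]])
  also have "\<dots> = pencil (1\<^sub>m p) (- ?J) \<oplus>\<^sub>m pencil ?N (- 1\<^sub>m q)"
    unfolding EC ED using J N by (intro pencil_block_sum[symmetric]) auto
  finally have eq: "const_mat ?E * pencil C D * const_mat ?F =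
      pencil (1\<^sub>m (dim_row ?J)) (- ?J) \<oplus>\<^sub>m pencil ?N (- 1\<^sub>m (dim_row ?N))"
    unfolding carrier_matD[OF J] carrier_matD[OF N] .
  have "strictly_equivalent (pencil C D) (pencil (1\<^sub>m (dim_row ?J)) (- ?J) \<oplus>\<^sub>m pencil ?N (- 1\<^sub>m (dim_row ?N)))"
    unfolding strictly_equivalent_def
    by (rule exI[of _ n], rule exI[of _ ?E], rule exI[of _ ?F])
      (intro conjI pencil_carrier C D inverse_matsD(1)[OF E] inverse_matsD(1)[OF F]
        inverse_mats_imp_invertible[OF E] inverse_mats_imp_invertible[OF F] eq)
  then show ?thesis unfolding weierstrass_form_def Let_def using js ns by auto
qed

lemma intertwine_similar:
  fixes a :: "complex mat"
  assumes a: "a \<in> carrier_mat n n'" and g: "g \<in> carrier_mat n' n" "g * a = 1\<^sub>m n'"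
    and eq: "T * a = a * T'" and T: "T \<in> carrier_mat n n" and T': "T' \<in> carrier_mat n' n'"
    and P: "inverse_mats n P Q" "T * P = P * J" and P': "inverse_mats n' P' Q'" "T' * P' = P' * J'"
    and J: "J \<in> carrier_mat n n" and J': "J' \<in> carrier_mat n' n'"
  obtains b h where "b \<in> carrier_mat n n'" "h \<in> carrier_mat n' n" "h * b = 1\<^sub>m n'" "J * b = b * J'"
proof -
  note d = carrier_matD[OF a] carrier_matD[OF g(1)] carrier_matD[OF T] carrier_matD[OF T']
    carrier_matD[OF J] carrier_matD[OF J'] inverse_matsD(5-)[OF P(1)] inverse_matsD(5-)[OF P'(1)]
  let ?b = "Q * a * P'" and ?h = "Q' * g * P"
  have "?h * ?b = Q' * (g * (P * (Q * (a * P'))))" by (simp add: d mult_mat_assoc)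
  also have "P * (Q * (a * P')) = a * P'" by (simp add: inverse_mats_cancel(1)[OF P(1)] d)
  also have "g * (a * P') = P'" by (simp add: mult_mat_assoc[of g a P', symmetric] d g(2))
  also have "Q' * P' = 1\<^sub>m n'" using inverse_matsD(4)[OF P'(1)] .
  finally have 1: "?h * ?b = 1\<^sub>m n'" .
  have "J * ?b = Q * (P * (J * ?b))" by (simp add: inverse_mats_cancel(2)[OF P(1), of "J * ?b"] d)
  also have "P * (J * ?b) = T * P * ?b" unfolding P(2) by (simp add: d mult_mat_assoc)
  also have "\<dots> = T * (P * (Q * (a * P')))" by (simp add: d mult_mat_assoc)
  also have "P * (Q * (a * P')) = a * P'" by (simp add: inverse_mats_cancel(1)[OF P(1)] d)
  also have "T * (a * P') = T * a * P'" by (intro mult_mat_assoc[symmetric]) (simp_all add: d)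
  also have "\<dots> = a * (T' * P')" unfolding eq by (intro mult_mat_assoc) (simp_all add: d)
  also have "Q * (a * (T' * P')) = ?b * J'" unfolding P'(2) by (simp add: d mult_mat_assoc)
  finally have 2: "J * ?b = ?b * J'" .
  show ?thesis
    by (rule that[OF mult_carrier_mat[OF mult_carrier_mat[OF inverse_matsD(2)[OF P(1)] a] inverse_matsD(1)[OF P'(1)]]
          mult_carrier_mat[OF mult_carrier_mat[OF inverse_matsD(2)[OF P'(1)] g(1)] inverse_matsD(1)[OF P(1)]] 1 2])
qed

text \<open>Both pencils are split with \<Lambda> = UNIV. All finite eigenvalues then sit in T and
  T', while Z and Z' are nilpotent and so disjoint from any T. The transported intertwiner is
  therefore block diagonal, and its two blocks compare the finite and the infinite Jordan structure
  separately.\<close>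

lemma intertwine_subordinate:
  assumes C: "C \<in> carrier_mat n n" and D: "D \<in> carrier_mat n n"
    and C': "C' \<in> carrier_mat n' n'" and D': "D' \<in> carrier_mat n' n'"
    and \<Theta>: "\<Theta> \<in> carrier_mat n n'" and \<Omega>: "\<Omega> \<in> carrier_mat n n'"
    and g: "g \<in> carrier_mat n' n" "g * \<Theta> = 1\<^sub>m n'"
    and eqC: "C * \<Theta> = \<Omega> * C'" and eqD: "D * \<Theta> = \<Omega> * D'"
    and reg: "det (\<alpha> \<cdot>\<^sub>m C + D) \<noteq> 0" and reg': "det (\<beta> \<cdot>\<^sub>m C' + D') \<noteq> 0"
  shows "subordinate (pencil C' D') (pencil C D)"
proof -
  obtain p q T Z U Ui W Wi where pq: "p + q = n" and T: "T \<in> carrier_mat p p" and Z: "Z \<in> carrier_mat q q"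
    and U: "inverse_mats n U Ui" and W: "inverse_mats n W Wi"
    and CW: "C * W = U * (1\<^sub>m p \<oplus>\<^sub>m Z)" and DW: "D * W = - (U * (T \<oplus>\<^sub>m 1\<^sub>m q))"
    and evZ: "\<And>z t. eigenvalue Z z \<Longrightarrow> t * z \<noteq> 1"
    using pencil_split[OF C D reg, of UNIV] by (metis UNIV_I)
  obtain p' q' T' Z' U' Ui' W' Wi' where pq': "p' + q' = n'" and T': "T' \<in> carrier_mat p' p'" and Z': "Z' \<in> carrier_mat q' q'"
    and U': "inverse_mats n' U' Ui'" and W': "inverse_mats n' W' Wi'"
    and CW': "C' * W' = U' * (1\<^sub>m p' \<oplus>\<^sub>m Z')" and DW': "D' * W' = - (U' * (T' \<oplus>\<^sub>m 1\<^sub>m q'))"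
    and evZ': "\<And>z t. eigenvalue Z' z \<Longrightarrow> t * z \<noteq> 1"
    using pencil_split[OF C' D' reg', of UNIV] by (metis UNIV_I)
  \<comment> \<open>A nonzero z would violate the condition at t = 1 / z.\<close>
  have nil: "z = 0" if "eigenvalue Z z" for z using evZ[OF that, of "1 / z"] by (cases "z = 0") auto
  have nil': "z = 0" if "eigenvalue Z' z" for z using evZ'[OF that, of "1 / z"] by (cases "z = 0") auto
  note d = carrier_matD[OF C] carrier_matD[OF D] carrier_matD[OF C'] carrier_matD[OF D']
    carrier_matD[OF \<Theta>] carrier_matD[OF \<Omega>] carrier_matD[OF g(1)]
    inverse_matsD(5-)[OF U] inverse_matsD(5-)[OF W] inverse_matsD(5-)[OF U'] inverse_matsD(5-)[OF W']
    carrier_matD[OF T] carrier_matD[OF Z] carrier_matD[OF T'] carrier_matD[OF Z']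
  let ?\<Theta> = "Wi * \<Theta> * W'" and ?\<Omega> = "Ui * \<Omega> * U'" and ?g = "Wi' * g * W"
  have \<Theta>c: "?\<Theta> \<in> carrier_mat (p + q) (p' + q')" and \<Omega>c: "?\<Omega> \<in> carrier_mat (p + q) (p' + q')"
    and gc: "?g \<in> carrier_mat (p' + q') (p + q)"
    unfolding pq pq'
    using mult_carrier_mat[OF mult_carrier_mat[OF inverse_matsD(2)[OF W] \<Theta>] inverse_matsD(1)[OF W']]
      mult_carrier_mat[OF mult_carrier_mat[OF inverse_matsD(2)[OF U] \<Omega>] inverse_matsD(1)[OF U']]
      mult_carrier_mat[OF mult_carrier_mat[OF inverse_matsD(2)[OF W'] g(1)] inverse_matsD(1)[OF W]] .
  have tr: "B * ?\<Theta> = ?\<Omega> * B'"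
    if "M * W = U * B" "M' * W' = U' * B'" "M * \<Theta> = \<Omega> * M'" "M \<in> carrier_mat n n" "M' \<in> carrier_mat n' n'"
      "B \<in> carrier_mat n n" "B' \<in> carrier_mat n' n'" for M M' B B'
  proof -
    note d' = carrier_matD[OF that(4)] carrier_matD[OF that(5)] carrier_matD[OF that(6)] carrier_matD[OF that(7)]
    have "B * ?\<Theta> = Ui * (U * (B * ?\<Theta>))" by (simp add: inverse_mats_cancel(2)[OF U, of "B * ?\<Theta>"] d')
    also have "U * (B * ?\<Theta>) = M * W * ?\<Theta>" unfolding that(1) by (simp add: d d' mult_mat_assoc)
    also have "\<dots> = M * (W * (Wi * (\<Theta> * W')))" by (simp add: d d' mult_mat_assoc)
    also have "W * (Wi * (\<Theta> * W')) = \<Theta> * W'" by (simp add: inverse_mats_cancel(1)[OF W] d)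
    also have "M * (\<Theta> * W') = M * \<Theta> * W'" by (intro mult_mat_assoc[symmetric]) (simp_all add: d d')
    also have "\<dots> = \<Omega> * (M' * W')" unfolding that(3) by (intro mult_mat_assoc) (simp_all add: d d')
    also have "Ui * \<dots> = ?\<Omega> * B'" unfolding that(2) by (simp add: d d' mult_mat_assoc)
    finally show ?thesis .
  qed
  have B: "1\<^sub>m p \<oplus>\<^sub>m Z \<in> carrier_mat n n" "T \<oplus>\<^sub>m 1\<^sub>m q \<in> carrier_mat n n"
      "1\<^sub>m p' \<oplus>\<^sub>m Z' \<in> carrier_mat n' n'" "T' \<oplus>\<^sub>m 1\<^sub>m q' \<in> carrier_mat n' n'"
    using T Z T' Z' pq pq' by auto
  have e1: "(1\<^sub>m p \<oplus>\<^sub>m Z) * ?\<Theta> = ?\<Omega> * (1\<^sub>m p' \<oplus>\<^sub>m Z')"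
    by (rule tr[OF CW CW' eqC C C' B(1,3)])
  have e2: "(T \<oplus>\<^sub>m 1\<^sub>m q) * ?\<Theta> = ?\<Omega> * (T' \<oplus>\<^sub>m 1\<^sub>m q')"
  proof (rule tr[OF _ _ _ uminus_carrier_mat[OF D] uminus_carrier_mat[OF D'] B(2,4)])
    show "- D * W = U * (T \<oplus>\<^sub>m 1\<^sub>m q)" by (simp add: DW d)
    show "- D' * W' = U' * (T' \<oplus>\<^sub>m 1\<^sub>m q')" by (simp add: DW' d)
    show "- D * \<Theta> = \<Omega> * - D'" by (simp add: eqD d)
  qed
  have disj: "spectrally_disjoint T Z'" "spectrally_disjoint T' Z"
    unfolding spectrally_disjoint_def using evZ evZ' by blast+
  obtain a e where ae: "a \<in> carrier_mat p p'" "e \<in> carrier_mat q q'" "?\<Theta> = a \<oplus>\<^sub>m e"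
    "T * a = a * T'" "Z * e = e * Z'"
    using intertwine_blocks[OF T Z T' Z' \<Theta>c \<Omega>c e1 e2 disj] .
  have "?g * ?\<Theta> = Wi' * (g * (W * (Wi * (\<Theta> * W'))))" by (simp add: d mult_mat_assoc)
  also have "W * (Wi * (\<Theta> * W')) = \<Theta> * W'" by (simp add: inverse_mats_cancel(1)[OF W] d)
  also have "g * (\<Theta> * W') = W'" by (simp add: mult_mat_assoc[of g \<Theta> W', symmetric] d g(2))
  also have "Wi' * W' = 1\<^sub>m (p' + q')" using inverse_matsD(4)[OF W'] pq' by simp
  finally have "?g * (a \<oplus>\<^sub>m e) = 1\<^sub>m (p' + q')" unfolding ae(3) .
  then obtain ga ge where gg: "ga \<in> carrier_mat p' p" "ga * a = 1\<^sub>m p'" "ge \<in> carrier_mat q' q" "ge * e = 1\<^sub>m q'"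
    using left_inverse_block_sum[OF ae(1,2) gc] by metis
  obtain js P Pi where js: "0 \<notin> fst ` set js" "sum_list (map fst js) = p"
    and P: "inverse_mats p P Pi" "T * P = P * jordan_matrix js" using jordan_form[OF T] .
  obtain js' P' Pi' where js': "0 \<notin> fst ` set js'" "sum_list (map fst js') = p'"
    and P': "inverse_mats p' P' Pi'" "T' * P' = P' * jordan_matrix js'" using jordan_form[OF T'] .
  obtain ns Q Qi where ns: "0 \<notin> set ns" "sum_list ns = q"
    and Q: "inverse_mats q Q Qi" "Z * Q = Q * jordan_matrix (map (\<lambda>s. (s, 0)) ns)"
    using jordan_form_nilpotent[OF Z nil] .
  obtain ns' Q' Qi' where ns': "0 \<notin> set ns'" "sum_list ns' = q'"
    and Q': "inverse_mats q' Q' Qi'" "Z' * Q' = Q' * jordan_matrix (map (\<lambda>s. (s, 0)) ns')"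
    using jordan_form_nilpotent[OF Z' nil'] .
  have w: "weierstrass_form (pencil C D) js ns"
    by (rule weierstrass_form_of_split[OF C D pq T Z U W CW DW js P ns Q])
  have w': "weierstrass_form (pencil C' D') js' ns'"
    by (rule weierstrass_form_of_split[OF C' D' pq' T' Z' U' W' CW' DW' js' P' ns' Q'])
  have J: "jordan_matrix js \<in> carrier_mat p p" "jordan_matrix js' \<in> carrier_mat p' p'"
    using jordan_matrix_carrier[of js] jordan_matrix_carrier[of js'] js(2) js'(2) by simp_all
  let ?z = "\<lambda>xs :: nat list. map (\<lambda>s. (s, 0 :: complex)) xs"
  have sz: "sum_list (map fst (?z xs)) = sum_list xs" for xs by (simp add: comp_def)
  have N: "jordan_matrix (?z ns) \<in> carrier_mat q q" "jordan_matrix (?z ns') \<in> carrier_mat q' q'"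
    using jordan_matrix_carrier[of "?z ns"] jordan_matrix_carrier[of "?z ns'"] unfolding sz ns(2) ns'(2) .
  have fz: "map fst (filter (\<lambda>b. snd b = 0) (?z xs)) = xs" for xs by (induction xs) auto
  obtain b h where b: "b \<in> carrier_mat p p'" "h \<in> carrier_mat p' p" "h * b = 1\<^sub>m p'"
    "jordan_matrix js * b = b * jordan_matrix js'"
    using intertwine_similar[OF ae(1) gg(1,2) ae(4) T T' P P' J] .
  obtain b0 h0 where b0: "b0 \<in> carrier_mat q q'" "h0 \<in> carrier_mat q' q" "h0 * b0 = 1\<^sub>m q'"
    "jordan_matrix (?z ns) * b0 = b0 * jordan_matrix (?z ns')"
    using intertwine_similar[OF ae(2) gg(3,4) ae(5) Z Z' Q Q' N] .
  have "nth_default 0 (partial_mults js' ns' e) i \<le> nth_default 0 (partial_mults js ns e) i" for e i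
  proof (cases e)
    case None
    \<comment> \<open>The multiplicities at infinity are those of the eigenvalue 0 of the nilpotent
      part.\<close>
    have "nth_default 0 (rev (sort (map fst (filter (\<lambda>b. snd b = 0) (?z ns'))))) i
        \<le> nth_default 0 (rev (sort (map fst (filter (\<lambda>b. snd b = 0) (?z ns))))) i"
      by (rule jordan_intertwine_partial_mults[where a = b0 and g = h0])
        (use b0 in \<open>simp_all only: sz ns(2) ns'(2)\<close>)
    then show ?thesis unfolding None fz by simp
  next
    case (Some x)
    have "nth_default 0 (rev (sort (map fst (filter (\<lambda>b. snd b = x) js')))) i
        \<le> nth_default 0 (rev (sort (map fst (filter (\<lambda>b. snd b = x) js)))) i"
      by (rule jordan_intertwine_partial_mults[where a = b and g = h])
        (use b in \<open>simp_all only: js(2) js'(2)\<close>)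
    then show ?thesis unfolding Some by simp
  qed
  then show ?thesis unfolding subordinate_def using w w' by blast
qed

section \<open>Subordination and restriction for separable bisolvents\<close>

lemma bisolvent_degree_pos:
  assumes A0: "A 0 \<in> carrier_mat m m" "A 0 \<noteq> 0\<^sub>m m m" and bis: "bisolvent m k A S1 S2"
  shows "0 < k"
proof (rule ccontr)
  assume "\<not> 0 < k"
  then have k: "k = 0" by simp
  have S: "S1 \<in> carrier_mat m m" "S2 \<in> carrier_mat m m"
    and s: "mat_sum m m (\<lambda>i. A i * (S1 ^\<^sub>m i) * (S2 ^\<^sub>m (k - i))) {..k} = 0\<^sub>m m m"
    using bis unfolding bisolvent_def by auto
  \<comment> \<open>For k = 0 the bisolvent equation degenerates to A 0 = 0.\<close>
  have "mat_sum m m (\<lambda>i. A i * (S1 ^\<^sub>m i) * (S2 ^\<^sub>m (k - i))) {..k} = A 0"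
    unfolding k using A0(1) carrier_matD[OF S(1)] carrier_matD[OF S(2)] by (intro eq_matI) auto
  then show False using s A0(2) by simp
qed

text \<open>An intertwiner between the pencil of the pair and the split form of \<lambda> S2 - S1
  comes from \<open>null_pair_compare\<close>. The factor [X', Y']^(-1) undoes the adapted
  coordinates, and I \<oplus> -I changes the sign of the Z part from \<lambda> Z - I to I -
  \<lambda> Z.\<close>

lemma separable_bisolvent_subordinate:
  assumes A: "\<And>i. i \<le> k \<Longrightarrow> A i \<in> carrier_mat m m" and A0: "A 0 \<noteq> 0\<^sub>m m m"
    and reg: "regular (matrix_poly m k A)"
    and max: "maximal_standard_pair m k A p q X Y T Z" and sep: "separable_bisolvent m k A S1 S2"
  shows "subordinate (pencil S2 (- S1)) (pencil (1\<^sub>m p) (- T) \<oplus>\<^sub>m pencil (- Z) (1\<^sub>m q))"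
proof -
  obtain E where bis: "bisolvent m k A S1 S2" and E: "separated_by m E S1 S2"
    using sep unfolding separable_bisolvent_def by auto
  have S: "S1 \<in> carrier_mat m m" "S2 \<in> carrier_mat m m" using bis unfolding bisolvent_def by auto
  have mS: "- S1 \<in> carrier_mat m m" using S by simp
  have k: "0 < k" using bisolvent_degree_pos[OF A[of 0] A0 bis] by simp
  have "regular (pencil S2 (- S1))" using separable_bisolvent_regular[of k A m, OF _ reg sep] A by blast
  then obtain \<beta> where \<beta>: "det (\<beta> \<cdot>\<^sub>m S2 + - S1) \<noteq> 0" using regular_pencil_iff[OF S(2) mS] by auto
  obtain p' q' X' Y' T' Z' W' where pq': "p' + q' = m" and np': "null_pair m k A p' q' X' Y' T' Z'"
    and W: "inverse_mats m (hcat X' Y') W'"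
    and eq1: "S1 * hcat X' Y' = hcat X' Y' * (T' \<oplus>\<^sub>m 1\<^sub>m q')"
    and eq2: "S2 * hcat X' Y' = hcat X' Y' * (1\<^sub>m p' \<oplus>\<^sub>m Z')"
    using separable_coordinates[of k A m, OF _ bis E] A by metis
  obtain H where H: "H \<in> carrier_mat m (m * k)" "H * controllability_mat m k X' Y' T' Z' = 1\<^sub>m m"
    using controllability_left_inverse[OF pq' np' W k] .
  obtain \<Theta> \<Omega> g \<alpha> where \<Theta>: "\<Theta> \<in> carrier_mat (p + q) (p' + q')" and \<Omega>: "\<Omega> \<in> carrier_mat (p + q) (p' + q')"
    and e1: "(1\<^sub>m p \<oplus>\<^sub>m Z) * \<Theta> = \<Omega> * (1\<^sub>m p' \<oplus>\<^sub>m Z')" and e2: "(T \<oplus>\<^sub>m 1\<^sub>m q) * \<Theta> = \<Omega> * (T' \<oplus>\<^sub>m 1\<^sub>m q')"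
    and g: "g \<in> carrier_mat (p' + q') (p + q)" "g * \<Theta> = 1\<^sub>m (p' + q')"
    and \<alpha>: "det (\<alpha> \<cdot>\<^sub>m (1\<^sub>m p \<oplus>\<^sub>m Z) + - (T \<oplus>\<^sub>m 1\<^sub>m q)) \<noteq> 0"
    using null_pair_compare[of k A m, OF _ reg max np'] A H unfolding pq' by metis
  have np: "null_pair m k A p q X Y T Z" using max unfolding maximal_standard_pair_iff by auto
  note c = null_pairD(2,4)[OF np] and c' = null_pairD(2,4)[OF np']
  note dW = inverse_matsD[OF W]
  note d = carrier_matD[OF c(1)] carrier_matD[OF c(2)] carrier_matD[OF c'(1)] carrier_matD[OF c'(2)]
    carrier_matD[OF S(1)] carrier_matD[OF S(2)] carrier_matD[OF \<Theta>] carrier_matD[OF \<Omega>] carrier_matD[OF g(1)] dW(5-)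
    carrier_matD[OF null_pairD(1)[OF np']] carrier_matD[OF null_pairD(3)[OF np']] pq'
  let ?n = "p + q" and ?H = "hcat X' Y'" and ?F = "1\<^sub>m p \<oplus>\<^sub>m - 1\<^sub>m q :: complex mat"
  let ?C = "1\<^sub>m p \<oplus>\<^sub>m - Z" and ?E = "- T \<oplus>\<^sub>m 1\<^sub>m q"
  have F: "?F \<in> carrier_mat ?n ?n" by auto
  have Cc: "1\<^sub>m p \<oplus>\<^sub>m Z \<in> carrier_mat ?n ?n" "T \<oplus>\<^sub>m 1\<^sub>m q \<in> carrier_mat ?n ?n" using c by auto
  have C: "?C = ?F * (1\<^sub>m p \<oplus>\<^sub>m Z)" "?E = ?F * - (T \<oplus>\<^sub>m 1\<^sub>m q)"
    using d by (simp_all add: block_sum_mult uminus_block_sum)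
  have W1: "B * W' = W' * M" if "M * ?H = ?H * B" "M \<in> carrier_mat m m" "B \<in> carrier_mat m m" for M B
  proof -
    have "B * W' = W' * (?H * (B * W'))" by (simp add: inverse_mats_cancel(2)[OF W] carrier_matD[OF that(3)] d)
    also have "?H * (B * W') = M * ?H * W'"
      unfolding that(1) by (intro mult_mat_assoc[symmetric]) (simp_all add: carrier_matD[OF that(3)] d)
    also have "\<dots> = M" using inverse_mats_cancel_right(1)[OF W] that(2) by simp
    finally show ?thesis .
  qed
  have B: "1\<^sub>m p' \<oplus>\<^sub>m Z' \<in> carrier_mat m m" "T' \<oplus>\<^sub>m 1\<^sub>m q' \<in> carrier_mat m m" using c' pq' by auto
  let ?\<Theta> = "\<Theta> * W'" and ?\<Omega> = "?F * \<Omega> * W'"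
  have tr: "?F * M * ?\<Theta> = ?\<Omega> * N"
    if "M * \<Theta> = \<Omega> * G" "N * ?H = ?H * G" "M \<in> carrier_mat ?n ?n" "G \<in> carrier_mat m m" "N \<in> carrier_mat m m" for M N G
  proof -
    note d' = carrier_matD[OF that(3)] carrier_matD[OF that(4)] carrier_matD[OF that(5)]
    have "?F * M * ?\<Theta> = ?F * (M * \<Theta> * W')" by (simp add: d d' pq' mult_mat_assoc)
    also have "\<dots> = ?F * (\<Omega> * (G * W'))" unfolding that(1) by (simp add: d d' pq' mult_mat_assoc)
    also have "\<dots> = ?\<Omega> * N" unfolding W1[OF that(2,5,4)] by (simp add: d d' pq' mult_mat_assoc)
    finally show ?thesis .
  qed
  have reg': "det (\<alpha> \<cdot>\<^sub>m ?C + ?E) \<noteq> 0"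
  proof -
    have "\<alpha> \<cdot>\<^sub>m ?C + ?E = ?F * (\<alpha> \<cdot>\<^sub>m (1\<^sub>m p \<oplus>\<^sub>m Z) + - (T \<oplus>\<^sub>m 1\<^sub>m q))"
      unfolding C using mult_add_distrib_mat[OF F smult_carrier_mat[OF Cc(1)] uminus_carrier_mat[OF Cc(2)]]
        mult_smult_distrib[OF F Cc(1)] by simp
    then have "det (\<alpha> \<cdot>\<^sub>m ?C + ?E) = det ?F * det (\<alpha> \<cdot>\<^sub>m (1\<^sub>m p \<oplus>\<^sub>m Z) + - (T \<oplus>\<^sub>m 1\<^sub>m q))"
      using det_mult[OF F, of "\<alpha> \<cdot>\<^sub>m (1\<^sub>m p \<oplus>\<^sub>m Z) + - (T \<oplus>\<^sub>m 1\<^sub>m q)"] Cc by simp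
    moreover have "inverse_mats ?n ?F ?F"
      using F unfolding inverse_mats_def by (auto simp: block_sum_mult block_sum_one)
    ultimately show ?thesis using \<alpha> inverse_mats_imp_det by auto
  qed
  have "subordinate (pencil S2 (- S1)) (pencil ?C ?E)"
  proof (rule intertwine_subordinate[where \<Theta> = ?\<Theta> and \<Omega> = ?\<Omega> and g = "?H * g" and n = ?n and n' = m])
    show "?C * ?\<Theta> = ?\<Omega> * S2" unfolding C(1) by (rule tr[OF e1 eq2 Cc(1) B(1) S(2)])
    have "?F * (T \<oplus>\<^sub>m 1\<^sub>m q) * ?\<Theta> = ?\<Omega> * S1" by (rule tr[OF e2 eq1 Cc(2) B(2) S(1)])
    then show "?E * ?\<Theta> = ?\<Omega> * - S1" unfolding C(2) by (simp add: d pq')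
    have "?H * g * ?\<Theta> = ?H * (g * \<Theta> * W')" by (simp add: d pq' mult_mat_assoc)
    then show "?H * g * ?\<Theta> = 1\<^sub>m m" unfolding g(2) by (simp add: dW pq')
  qed (use c S d dW pq' \<beta> reg' in auto)
  also have "pencil ?C ?E = pencil (1\<^sub>m p) (- T) \<oplus>\<^sub>m pencil (- Z) (1\<^sub>m q)"
    using c by (intro pencil_block_sum[symmetric]) auto
  finally show ?thesis .
qed

text \<open>The idempotent of the bisolvent may distribute the eigenvalues in another way than (T,
  Z), so \<lambda> S2 - S1 is split afresh in accordance with (T, Z). The new splitting has
  different matrices U and W on its two sides; G = W (I \<oplus> -I) U^(-1) turns it into a
  conjugation by W and also adjusts the sign of the Z part.\<close>

lemma separable_bisolvent_restriction:
  assumes A: "\<And>i. i \<le> k \<Longrightarrow> A i \<in> carrier_mat m m" and A0: "A 0 \<noteq> 0\<^sub>m m m"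
    and reg: "regular (matrix_poly m k A)"
    and max: "maximal_standard_pair m k A p q X Y T Z" and disj: "spectrally_disjoint T Z"
    and sep: "separable_bisolvent m k A S1 S2"
  shows "\<exists>V1 V2 X' Y' T' Z' W G.
    restriction m X Y T Z V1 V2 X' Y' T' Z' \<and>
    W \<in> carrier_mat m m \<and> inverts_mat (hcat X' Y') W \<and> inverts_mat W (hcat X' Y') \<and>
    G \<in> carrier_mat m m \<and> invertible_mat G \<and>
    const_mat G * pencil S2 (- S1) =
      const_mat (hcat X' Y') *
      (pencil (1\<^sub>m (dim_row T')) (- T') \<oplus>\<^sub>m pencil (- Z') (1\<^sub>m (dim_row Z'))) *
      const_mat W"
proof -
  have bis: "bisolvent m k A S1 S2" using sep unfolding separable_bisolvent_def by auto
  have S: "S1 \<in> carrier_mat m m" "S2 \<in> carrier_mat m m" using bis unfolding bisolvent_def by auto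
  have mS: "- S1 \<in> carrier_mat m m" using S by simp
  have k: "0 < k" using bisolvent_degree_pos[OF A[of 0] A0 bis] by simp
  obtain f where f: "cofactor_coeffs m k A S2 (- S1) f" and "regular (pencil S2 (- S1))"
    using separable_bisolvent_regular[of k A m, OF _ reg sep] A by blast
  then obtain \<beta> where \<beta>: "det (\<beta> \<cdot>\<^sub>m S2 + - S1) \<noteq> 0" using regular_pencil_iff[OF S(2) mS] by auto
  \<comment> \<open>All t that are not reciprocals of eigenvalues of Z. Then T' is disjoint from Z
    by construction; the eigenvalues of T lie in \<Lambda> because the pair is spectrally disjoint,
    so T is disjoint from Z' as well.\<close>
  define \<Lambda> where "\<Lambda> = {t. \<forall>z. eigenvalue Z z \<longrightarrow> t * z \<noteq> 1}"
  have "0 \<in> \<Lambda>" unfolding \<Lambda>_def by simp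
  from pencil_split[OF S(2) mS \<beta> this]
  obtain p' q' T' Z' U U' W W' where pq': "p' + q' = m" and T': "T' \<in> carrier_mat p' p'" and Z': "Z' \<in> carrier_mat q' q'"
    and U: "inverse_mats m U U'" and W: "inverse_mats m W W'"
    and e2: "S2 * W = U * (1\<^sub>m p' \<oplus>\<^sub>m Z')" and e1: "- S1 * W = - (U * (T' \<oplus>\<^sub>m 1\<^sub>m q'))"
    and ev: "\<And>t. eigenvalue T' t \<Longrightarrow> t \<in> \<Lambda>" "\<And>z t. eigenvalue Z' z \<Longrightarrow> t \<in> \<Lambda> \<Longrightarrow> t * z \<noteq> 1"
    by metis
  note dW = inverse_matsD[OF W] and dU = inverse_matsD[OF U]
  have "W \<in> carrier_mat m (p' + q')" by (simp add: dW pq')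
  then obtain X' Y' where XY: "W = hcat X' Y'" "X' \<in> carrier_mat m p'" "Y' \<in> carrier_mat m q'"
    using hcat_split by metis
  have np': "null_pair m k A p' q' X' Y' T' Z'"
    by (rule cofactor_null_pair[OF A S(2) mS f pq' T' Z' dU(1) XY(2,3) e2[unfolded XY(1)] e1[unfolded XY(1)]])
  have disj1: "spectrally_disjoint T' Z" using ev(1) unfolding spectrally_disjoint_def \<Lambda>_def by blast
  have disj2: "spectrally_disjoint T Z'" using disj ev(2) unfolding spectrally_disjoint_def \<Lambda>_def by blast
  obtain a d ga gd where ad: "a \<in> carrier_mat p p'" "d \<in> carrier_mat q q'" "T * a = a * T'" "Z * d = d * Z'"
    "X * a = X'" "Y * d = Y'" "ga \<in> carrier_mat p' p" "ga * a = 1\<^sub>m p'" "gd \<in> carrier_mat q' q" "gd * d = 1\<^sub>m q'"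
    using null_pair_restricts[of k A m, OF _ reg k max pq' np' W[unfolded XY(1)] disj2 disj1] A by metis
  have np: "null_pair m k A p q X Y T Z" using max unfolding maximal_standard_pair_iff by auto
  have "invertible_mat (hcat (X * a) (Y * d))"
    unfolding ad(5,6) XY(1)[symmetric] by (rule inverse_mats_imp_invertible[OF W])
  from restrictionI[OF null_pairD(2,4)[OF np] T' Z' pq' ad(1-4,7-10) this]
  obtain V1 V2 where res: "restriction m X Y T Z V1 V2 X' Y' T' Z'" unfolding ad(5,6) by blast
  let ?F = "1\<^sub>m p' \<oplus>\<^sub>m - 1\<^sub>m q' :: complex mat"
  have iF: "inverse_mats m ?F ?F"
    using pq' unfolding inverse_mats_def by (auto simp: block_sum_mult block_sum_one)
  let ?G = "W * ?F * U'"
  have iG: "inverse_mats m ?G (U * (?F * W'))"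
    by (rule inverse_mats_mult[OF inverse_mats_mult[OF W iF] inverse_mats_sym[OF U]])
  note dS = carrier_matD[OF S(1)] carrier_matD[OF S(2)] carrier_matD[OF T'] carrier_matD[OF Z']
  have GM: "?G * M = W * (?F * B) * W'" if "M * W = U * B" "M \<in> carrier_mat m m" "B \<in> carrier_mat m m" for M B
  proof -
    note d' = carrier_matD[OF that(2)] carrier_matD[OF that(3)]
    have "?G * M = W * (?F * (U' * M))" by (simp add: dW(5-) dU(5-) d' pq' mult_mat_assoc)
    also have "U' * M = B * W'"
    proof -
      have "M = M * W * W'" by (simp add: inverse_mats_cancel_right(1)[OF W, of M] d')
      also have "\<dots> = U * (B * W')" unfolding that(1) by (intro mult_mat_assoc) (simp_all add: dW(5-) dU(5-) d')
      finally show ?thesis by (simp add: inverse_mats_cancel(2)[OF U, of "B * W'"] d')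
    qed
    finally show ?thesis by (simp add: dW(5-) dU(5-) d' pq' mult_mat_assoc)
  qed
  have B: "1\<^sub>m p' \<oplus>\<^sub>m Z' \<in> carrier_mat m m" "T' \<oplus>\<^sub>m 1\<^sub>m q' \<in> carrier_mat m m" using T' Z' pq' by auto
  have GS2: "?G * S2 = W * (1\<^sub>m p' \<oplus>\<^sub>m - Z') * W'"
    using GM[OF e2 S(2) B(1)] dS by (simp add: block_sum_mult)
  have GS1: "?G * - S1 = W * (- T' \<oplus>\<^sub>m 1\<^sub>m q') * W'"
  proof -
    have "- S1 * W = U * - (T' \<oplus>\<^sub>m 1\<^sub>m q')" using e1 dU(5-) dS pq' by simp
    from GM[OF this mS uminus_carrier_mat[OF B(2)]] show ?thesis
      by (simp add: dS block_sum_mult uminus_block_sum)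
  qed
  have "const_mat ?G * pencil S2 (- S1) = pencil (?G * S2) (?G * - S1)"
    by (rule const_mat_mult_pencil[OF inverse_matsD(1)[OF iG] S(2) mS])
  also have "\<dots> = const_mat W * (pencil (1\<^sub>m p') (- T') \<oplus>\<^sub>m pencil (- Z') (1\<^sub>m q')) * const_mat W'"
    unfolding GS2 GS1 using T' Z'
    by (intro const_mat_conjugate_blocks[OF dW(1,2) pq', symmetric]) auto
  finally have eq: "const_mat ?G * pencil S2 (- S1) = const_mat (hcat X' Y') *
      (pencil (1\<^sub>m (dim_row T')) (- T') \<oplus>\<^sub>m pencil (- Z') (1\<^sub>m (dim_row Z'))) * const_mat W'"
    unfolding XY(1)[symmetric] by (simp add: dS)
  have "inverts_mat (hcat X' Y') W'" "inverts_mat W' (hcat X' Y')"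
    unfolding inverts_mat_def XY(1)[symmetric] using dW by auto
  then show ?thesis
    using res dW(2) inverse_matsD(1)[OF iG] inverse_mats_imp_invertible[OF iG] eq by blast
qed

lemma hcat_left_inverses:
  fixes X Y :: "complex mat"
  assumes X: "X \<in> carrier_mat m p" and Y: "Y \<in> carrier_mat m q" and W: "inverse_mats m (hcat X Y) W'" and pq: "p + q = m"
  obtains g h where "g \<in> carrier_mat p m" "g * X = 1\<^sub>m p" "h \<in> carrier_mat q m" "h * Y = 1\<^sub>m q"
proof -
  let ?P = "1\<^sub>m p \<oplus>\<^sub>m 0\<^sub>m q q :: complex mat"
  have "W' \<in> carrier_mat (p + q) (m + 0)" using inverse_matsD[OF W] pq by simp
  then obtain g1 g2 g3 g4 where geq: "W' = four_block_mat g1 g2 g3 g4"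
    and gc: "g1 \<in> carrier_mat p m" "g2 \<in> carrier_mat p 0" "g3 \<in> carrier_mat q m" "g4 \<in> carrier_mat q 0"
    by (rule four_block_split)
  have "W' * hcat X Y = four_block_mat (g1 * X + g2 * 0\<^sub>m 0 p) (g1 * Y + g2 * 0\<^sub>m 0 q)
      (g3 * X + g4 * 0\<^sub>m 0 p) (g3 * Y + g4 * 0\<^sub>m 0 q)"
    unfolding geq hcat_def using gc X Y by (subst four_block_mult) auto
  also have "\<dots> = four_block_mat (g1 * X) (g1 * Y) (g3 * X) (g3 * Y)"
    using gc X Y right_add_zero_mat[OF mult_carrier_mat[OF gc(1) X]] right_add_zero_mat[OF mult_carrier_mat[OF gc(1) Y]]
      right_add_zero_mat[OF mult_carrier_mat[OF gc(3) X]] right_add_zero_mat[OF mult_carrier_mat[OF gc(3) Y]]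
    by simp
  finally have "four_block_mat (g1 * X) (g1 * Y) (g3 * X) (g3 * Y) =
      four_block_mat (1\<^sub>m p) (0\<^sub>m p q) (0\<^sub>m q p) (1\<^sub>m q)"
    using inverse_matsD(4)[OF W] pq by simp
  note e = four_block_eqD[OF this mult_carrier_mat[OF gc(1) X] mult_carrier_mat[OF gc(1) Y]
      mult_carrier_mat[OF gc(3) X] mult_carrier_mat[OF gc(3) Y] one_carrier_mat zero_carrier_mat
      zero_carrier_mat one_carrier_mat]
  show ?thesis by (rule that[OF gc(1) e(1) gc(3) e(4)])
qed

lemma eigenvector_transfer:
  fixes M N X :: "complex mat"
  assumes ev: "eigenvalue N t" and N: "N \<in> carrier_mat p p" and M: "M \<in> carrier_mat m m" and X: "X \<in> carrier_mat m p"
    and eq: "M * X = X * N" and g: "g \<in> carrier_mat p m" "g * X = 1\<^sub>m p"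
  obtains x where "x \<in> carrier_vec p" "eigenvector M (X *\<^sub>v x) t"
proof -
  obtain x where x: "x \<in> carrier_vec p" "x \<noteq> 0\<^sub>v p" "N *\<^sub>v x = t \<cdot>\<^sub>v x" using eigenvalueE[OF ev N] .
  have Xx: "X *\<^sub>v x \<in> carrier_vec m" using X x by auto
  have "X *\<^sub>v x \<noteq> 0\<^sub>v m"
  proof
    assume z: "X *\<^sub>v x = 0\<^sub>v m"
    have "x = g * X *\<^sub>v x" unfolding g(2) using x by simp
    also have "\<dots> = g *\<^sub>v (X *\<^sub>v x)" by (rule assoc_mult_mat_vec[OF g(1) X x(1)])
    also have "\<dots> = 0\<^sub>v p" unfolding z using g(1) by auto
    finally show False using x(2) by simp
  qed
  moreover have "M *\<^sub>v (X *\<^sub>v x) = t \<cdot>\<^sub>v (X *\<^sub>v x)"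
  proof -
    have "M *\<^sub>v (X *\<^sub>v x) = X * N *\<^sub>v x" unfolding eq[symmetric] by (rule assoc_mult_mat_vec[OF M X x(1), symmetric])
    also have "\<dots> = X *\<^sub>v (t \<cdot>\<^sub>v x)" unfolding x(3)[symmetric] by (rule assoc_mult_mat_vec[OF X N x(1)])
    also have "\<dots> = t \<cdot>\<^sub>v (X *\<^sub>v x)" by (rule mult_mat_vec[OF X x(1)])
    finally show ?thesis .
  qed
  ultimately show ?thesis using that[OF x(1)] eigenvectorI[OF M Xx] by blast
qed

text \<open>The roles are exchanged: the coordinates come from E itself, so conjugation by [X', Y']
  gives S1 and S2 exactly and no G arises, and the maximal pair is chosen to match. Spectral
  separation makes T' and Z' disjoint, so that a single \<Lambda> is compatible with both.\<close>

lemma spectrally_separated_bisolvent_restriction: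
  assumes A: "\<And>i. i \<le> k \<Longrightarrow> A i \<in> carrier_mat m m" and A0: "A 0 \<noteq> 0\<^sub>m m m"
    and reg: "regular (matrix_poly m k A)"
    and bis: "bisolvent m k A S1 S2" and E: "separated_by m E S1 S2" and spec: "spectrally_separated_by E S1 S2"
  shows "\<exists>p q X Y T Z V1 V2 X' Y' T' Z' W.
    maximal_standard_pair m k A p q X Y T Z \<and>
    restriction m X Y T Z V1 V2 X' Y' T' Z' \<and>
    W \<in> carrier_mat m m \<and> inverts_mat (hcat X' Y') W \<and> inverts_mat W (hcat X' Y') \<and>
    pencil S2 (- S1) =
      const_mat (hcat X' Y') *
      (pencil (1\<^sub>m (dim_row T')) (- T') \<oplus>\<^sub>m pencil Z' (- 1\<^sub>m (dim_row Z'))) *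
      const_mat W"
proof -
  have S: "S1 \<in> carrier_mat m m" "S2 \<in> carrier_mat m m" using bis unfolding bisolvent_def by auto
  have Ec: "E \<in> carrier_mat m m" using E unfolding separated_by_def by auto
  have k: "0 < k" using bisolvent_degree_pos[OF A[of 0] A0 bis] by simp
  obtain p' q' X' Y' T' Z' W' where pq': "p' + q' = m" and np': "null_pair m k A p' q' X' Y' T' Z'"
    and W: "inverse_mats m (hcat X' Y') W'"
    and eq1: "S1 * hcat X' Y' = hcat X' Y' * (T' \<oplus>\<^sub>m 1\<^sub>m q')"
    and eq2: "S2 * hcat X' Y' = hcat X' Y' * (1\<^sub>m p' \<oplus>\<^sub>m Z')"
    and eqE: "E * hcat X' Y' = hcat X' Y' * (1\<^sub>m p' \<oplus>\<^sub>m 0\<^sub>m q' q')"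
    using separable_coordinates[of k A m, OF _ bis E] A by metis
  note c' = null_pairD(1-4)[OF np'] and dW = inverse_matsD[OF W]
  note d = carrier_matD[OF c'(1)] carrier_matD[OF c'(2)] carrier_matD[OF c'(3)] carrier_matD[OF c'(4)]
    carrier_matD[OF S(1)] carrier_matD[OF S(2)] carrier_matD[OF Ec]
  have h1: "hcat (S1 * X') (S1 * Y') = hcat (X' * T') Y'" and h2: "hcat (S2 * X') (S2 * Y') = hcat X' (Y' * Z')"
    and hE: "hcat (E * X') (E * Y') = hcat X' (0\<^sub>m m q')"
    using eq1 eq2 eqE d by (simp_all add: hcat_block_sum mult_hcat)
  have S1X: "S1 * X' = X' * T'" using hcat_eqD(1)[OF h1] d by simp
  have S2Y: "S2 * Y' = Y' * Z'" using hcat_eqD(2)[OF h2] d by simp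
  have EX: "E * X' = X'" using hcat_eqD(1)[OF hE] d by simp
  have EY: "E * Y' = 0\<^sub>m m q'" using hcat_eqD(2)[OF hE] d by simp
  obtain g h where g: "g \<in> carrier_mat p' m" "g * X' = 1\<^sub>m p'" and h: "h \<in> carrier_mat q' m" "h * Y' = 1\<^sub>m q'"
    using hcat_left_inverses[OF c'(1,3) W pq'] .
  \<comment> \<open>A reciprocal pair of eigenvalues would give an eigenvector X' x of S1 fixed by E
    and an eigenvector Y' y of S2 in the kernel of E, the configuration that
    \<open>spectrally_separated_by\<close> excludes.\<close>
  have disj': "spectrally_disjoint T' Z'"
    unfolding spectrally_disjoint_def
  proof
    assume "\<exists>t z. t * z = 1 \<and> eigenvalue T' t \<and> eigenvalue Z' z"
    then obtain t z where tz: "t * z = 1" "eigenvalue T' t" "eigenvalue Z' z" by blast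
    obtain x where x: "x \<in> carrier_vec p'" "eigenvector S1 (X' *\<^sub>v x) t"
      using eigenvector_transfer[OF tz(2) c'(2) S(1) c'(1) S1X g] .
    obtain y where y: "y \<in> carrier_vec q'" "eigenvector S2 (Y' *\<^sub>v y) z"
      using eigenvector_transfer[OF tz(3) c'(4) S(2) c'(3) S2Y h] .
    have "E *\<^sub>v (X' *\<^sub>v x) = X' *\<^sub>v x"
      using assoc_mult_mat_vec[OF Ec c'(1) x(1)] unfolding EX by simp
    moreover have "E *\<^sub>v (Y' *\<^sub>v y) = 0\<^sub>v (dim_row E)"
    proof -
      have "E *\<^sub>v (Y' *\<^sub>v y) = 0\<^sub>m m q' *\<^sub>v y"
        using assoc_mult_mat_vec[OF Ec c'(3) y(1)] unfolding EY by simp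
      also have "\<dots> = 0\<^sub>v (dim_row E)" by (rule eq_vecI) (use y(1) Ec in auto)
      finally show ?thesis .
    qed
    ultimately show False using spec tz(1) x(2) y(2) unfolding spectrally_separated_by_def by blast
  qed
  \<comment> \<open>This set contains the eigenvalues of T' by \<open>disj'\<close> and avoids the
    reciprocals of those of Z', so a maximal pair split along it is disjoint from the blocks of the
    bisolvent in both mixed combinations.\<close>
  define \<Lambda> where "\<Lambda> = {t. \<forall>z. eigenvalue Z' z \<longrightarrow> t * z \<noteq> 1}"
  have \<Lambda>: "0 \<in> \<Lambda>" unfolding \<Lambda>_def by simp
  obtain p q X Y T Z where max: "maximal_standard_pair m k A p q X Y T Z"
    and ev: "\<And>t. eigenvalue T t \<Longrightarrow> t \<in> \<Lambda>" "\<And>z t. eigenvalue Z z \<Longrightarrow> t \<in> \<Lambda> \<Longrightarrow> t * z \<noteq> 1"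
    using maximal_pair_exists[of k A m, OF _ reg \<Lambda>] A by metis
  have disj1: "spectrally_disjoint T Z'" using ev(1) unfolding spectrally_disjoint_def \<Lambda>_def by blast
  have disj2: "spectrally_disjoint T' Z" using disj' ev(2) unfolding spectrally_disjoint_def \<Lambda>_def by blast
  obtain a e ga ge where ad: "a \<in> carrier_mat p p'" "e \<in> carrier_mat q q'" "T * a = a * T'" "Z * e = e * Z'"
    "X * a = X'" "Y * e = Y'" "ga \<in> carrier_mat p' p" "ga * a = 1\<^sub>m p'" "ge \<in> carrier_mat q' q" "ge * e = 1\<^sub>m q'"
    using null_pair_restricts[of k A m, OF _ reg k max pq' np' W disj1 disj2] A by metis
  have np: "null_pair m k A p q X Y T Z" using max unfolding maximal_standard_pair_iff by auto
  have "invertible_mat (hcat (X * a) (Y * e))"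
    unfolding ad(5,6) by (rule inverse_mats_imp_invertible[OF W])
  from restrictionI[OF null_pairD(2,4)[OF np] c'(2,4) pq' ad(1-4,7-10) this]
  obtain V1 V2 where res: "restriction m X Y T Z V1 V2 X' Y' T' Z'" unfolding ad(5,6) by blast
  have SW: "S2 = hcat X' Y' * (1\<^sub>m p' \<oplus>\<^sub>m Z') * W'"
    unfolding eq2[symmetric] using inverse_mats_cancel_right(1)[OF W, of S2] S by simp
  have mSW: "- S1 = hcat X' Y' * (- T' \<oplus>\<^sub>m - 1\<^sub>m q') * W'"
  proof -
    have "hcat X' Y' * (- T' \<oplus>\<^sub>m - 1\<^sub>m q') = - (S1 * hcat X' Y')"
      unfolding eq1 uminus_block_sum[symmetric] by (simp add: d)
    moreover have "- (S1 * hcat X' Y') * W' = - (S1 * hcat X' Y' * W')"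
      by (rule uminus_mult_left_mat) (simp add: d pq' dW(7,8))
    ultimately have "hcat X' Y' * (- T' \<oplus>\<^sub>m - 1\<^sub>m q') * W' = - (S1 * hcat X' Y' * W')" by simp
    then show ?thesis using inverse_mats_cancel_right(1)[OF W, of S1] S by simp
  qed
  have "pencil S2 (- S1) = pencil (hcat X' Y' * (1\<^sub>m p' \<oplus>\<^sub>m Z') * W') (hcat X' Y' * (- T' \<oplus>\<^sub>m - 1\<^sub>m q') * W')"
    using SW mSW by simp
  also have "\<dots> = const_mat (hcat X' Y') * (pencil (1\<^sub>m p') (- T') \<oplus>\<^sub>m pencil Z' (- 1\<^sub>m q')) * const_mat W'"
    using c' by (intro const_mat_conjugate_blocks[OF dW(1,2) pq', symmetric]) auto
  finally have eq: "pencil S2 (- S1) = const_mat (hcat X' Y') *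
      (pencil (1\<^sub>m (dim_row T')) (- T') \<oplus>\<^sub>m pencil Z' (- 1\<^sub>m (dim_row Z'))) * const_mat W'"
    by (simp add: d)
  have "inverts_mat (hcat X' Y') W'" "inverts_mat W' (hcat X' Y')"
    unfolding inverts_mat_def using dW by auto
  then show ?thesis using max res dW(2) eq by blast
qed

theorem theorem16:
  fixes m k :: nat and A :: "nat \<Rightarrow> complex mat"
  assumes "\<And>i. i \<le> k \<Longrightarrow> A i \<in> carrier_mat m m"
    and "A 0 \<noteq> 0\<^sub>m m m" and "A k \<noteq> 0\<^sub>m m m"
    and "regular (matrix_poly m k A)"
  shows
    "(\<exists>p q X Y T Z. maximal_standard_pair m k A p q X Y T Z \<and> spectrally_disjoint T Z) \<and>
     (\<forall>p q X Y T Z S1 S2.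
        maximal_standard_pair m k A p q X Y T Z \<and> spectrally_disjoint T Z \<and>
        separable_bisolvent m k A S1 S2 \<longrightarrow>
        (\<exists>V1 V2 X' Y' T' Z' W G.
           restriction m X Y T Z V1 V2 X' Y' T' Z' \<and>
           W \<in> carrier_mat m m \<and> inverts_mat (hcat X' Y') W \<and> inverts_mat W (hcat X' Y') \<and>
           G \<in> carrier_mat m m \<and> invertible_mat G \<and>
           const_mat G * pencil S2 (- S1) =
             const_mat (hcat X' Y') *
             (pencil (1\<^sub>m (dim_row T')) (- T') \<oplus>\<^sub>m pencil (- Z') (1\<^sub>m (dim_row Z'))) *
             const_mat W)) \<and>
     (\<forall>S1 S2 E.
        bisolvent m k A S1 S2 \<and> separated_by m E S1 S2 \<and> spectrally_separated_by E S1 S2 \<longrightarrow>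
        (\<exists>p q X Y T Z V1 V2 X' Y' T' Z' W.
           maximal_standard_pair m k A p q X Y T Z \<and>
           restriction m X Y T Z V1 V2 X' Y' T' Z' \<and>
           W \<in> carrier_mat m m \<and> inverts_mat (hcat X' Y') W \<and> inverts_mat W (hcat X' Y') \<and>
           pencil S2 (- S1) =
             const_mat (hcat X' Y') *
             (pencil (1\<^sub>m (dim_row T')) (- T') \<oplus>\<^sub>m pencil Z' (- 1\<^sub>m (dim_row Z'))) *
             const_mat W)) \<and>
     (\<forall>p q X Y T Z S1 S2.
        maximal_standard_pair m k A p q X Y T Z \<and> separable_bisolvent m k A S1 S2 \<longrightarrow>
        subordinate (pencil S2 (- S1))
          (pencil (1\<^sub>m p) (- T) \<oplus>\<^sub>m pencil (- Z) (1\<^sub>m q))) \<and>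
     (\<forall>C \<in> carrier_mat m m. \<forall>D \<in> carrier_mat m m.
        graded_regular_right_factor m k (matrix_poly m k A) (pencil C D) \<longleftrightarrow>
        (\<exists>G \<in> carrier_mat m m. invertible_mat G \<and>
           separable_bisolvent m k A (- (G * D)) (G * C))) \<and>
     (\<forall>C \<in> carrier_mat m m. \<forall>D \<in> carrier_mat m m. invertible_mat C \<longrightarrow>
        (regular_right_factor m (matrix_poly m k A) (pencil C D) \<longleftrightarrow>
         (\<exists>G \<in> carrier_mat m m. invertible_mat G \<and>
            separable_bisolvent m k A (- (G * D)) (G * C))))"
proof -
  note A = assms(1) and A0 = assms(2) and reg = assms(4)
  have ex: "\<exists>p q X Y T Z. maximal_standard_pair m k A p q X Y T Z \<and> spectrally_disjoint T Z"
  proof -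
    \<comment> \<open>With \<Lambda> = UNIV no eigenvalue of Z has a reciprocal, so Z is nilpotent
      and disjoint from any T.\<close>
    obtain p q X Y T Z where "maximal_standard_pair m k A p q X Y T Z"
      and ev: "\<And>z t. eigenvalue Z z \<Longrightarrow> t \<in> UNIV \<Longrightarrow> t * z \<noteq> 1"
      using maximal_pair_exists[of k A m, OF _ reg UNIV_I] A by metis
    moreover have "spectrally_disjoint T Z" unfolding spectrally_disjoint_def using ev by blast
    ultimately show ?thesis by blast
  qed
  have ungraded: "regular_right_factor m (matrix_poly m k A) (pencil C D) \<longleftrightarrow>
      (\<exists>G \<in> carrier_mat m m. invertible_mat G \<and> separable_bisolvent m k A (- (G * D)) (G * C))"
    if C: "C \<in> carrier_mat m m" and D: "D \<in> carrier_mat m m" and inv: "invertible_mat C" for C D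
  proof -
    \<comment> \<open>An invertible C makes the grade condition automatic, which reduces the claim
      to the graded equivalence.\<close>
    have "regular_right_factor m (matrix_poly m k A) (pencil C D) \<longleftrightarrow>
        graded_regular_right_factor m k (matrix_poly m k A) (pencil C D)"
      using regular_factor_imp_graded[of k A m, OF _ C D inv] A
      unfolding regular_right_factor_def graded_regular_right_factor_def by blast
    then show ?thesis using graded_factor_iff_separable[of k A m, OF _ reg C D] A by blast
  qed
  show ?thesis
    by (intro conjI allI ballI impI; (elim conjE)?;
        (rule ex
          | (rule separable_bisolvent_restriction[OF A A0 reg]; assumption)
          | (rule spectrally_separated_bisolvent_restriction[OF A A0 reg]; assumption)
          | (rule separable_bisolvent_subordinate[OF A A0 reg]; assumption)
          | (rule graded_factor_iff_separable[OF A reg]; assumption)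
          | (rule ungraded; assumption)))
qed

end
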